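(* Let $G$ be a finite unipotent group scheme over an algebraically closed field $k$ of characteristic $p>0$. For every positive integer $n$, there are only finitely many isomorphism classes of endotrivial $kG$-modules of dimension $n$.
   Context: $kG$ is the group algebra (dual of the coordinate algebra) of $G$, a finite-dimensional cocommutative Hopf algebra; $G$ is unipotent if $kG$ is local. A $kG$-module $M$ is endotrivial if $M^*\otimes_k M\cong k\oplus P$ as $kG$-modules with $P$ projective. *)

theory Defs
  imports "Jordan_Normal_Form.Matrix" "HOL-Computational_Algebra.Polynomial"
begin

text \<open>A finite-dimensional Hopf algebra over the field 'k, presented by structure
constants with respect to a basis e_0, ..., e_(d-1):
  e_i e_j = sum_l hmul i j l e_l,   1 = sum_l hunit l e_l,
  Delta(e_i) = sum_(j,l) hcomul i j l (e_j (x) e_l),   eps(e_i) = hcounit i,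
  S(e_i) = sum_a hanti i a e_a.\<close>

record 'k hopf =
  hdim :: nat
  hmul :: "nat \<Rightarrow> nat \<Rightarrow> nat \<Rightarrow> 'k"
  hunit :: "nat \<Rightarrow> 'k"
  hcomul :: "nat \<Rightarrow> nat \<Rightarrow> nat \<Rightarrow> 'k"
  hcounit :: "nat \<Rightarrow> 'k"
  hanti :: "nat \<Rightarrow> nat \<Rightarrow> 'k"

definition alg_closed_field :: "'k::field itself \<Rightarrow> bool" where
  "alg_closed_field _ \<longleftrightarrow> (\<forall>q :: 'k poly. degree q > 0 \<longrightarrow> (\<exists>x. poly q x = 0))"

definition kd :: "nat \<Rightarrow> nat \<Rightarrow> 'k::field" where
  "kd a b = (if a = b then 1 else 0)"

definition hopf_algebra :: "'k::field hopf \<Rightarrow> bool" where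
  "hopf_algebra H \<longleftrightarrow> (let d = hdim H; m = hmul H; u = hunit H; c = hcomul H;
                          e = hcounit H; S = hanti H in
     \<comment> \<open>associativity\<close>
     (\<forall>i<d. \<forall>j<d. \<forall>l<d. \<forall>t<d.
        (\<Sum>s<d. m i j s * m s l t) = (\<Sum>s<d. m j l s * m i s t)) \<and>
     \<comment> \<open>unit\<close>
     (\<forall>j<d. \<forall>t<d. (\<Sum>s<d. u s * m s j t) = kd j t \<and> (\<Sum>s<d. u s * m j s t) = kd j t) \<and>
     \<comment> \<open>coassociativity\<close>
     (\<forall>i<d. \<forall>a<d. \<forall>b<d. \<forall>t<d.
        (\<Sum>j<d. c i j t * c j a b) = (\<Sum>l<d. c i a l * c l b t)) \<and>
     \<comment> \<open>counit\<close>
     (\<forall>i<d. \<forall>t<d. (\<Sum>j<d. e j * c i j t) = kd i t \<and> (\<Sum>l<d. c i t l * e l) = kd i t) \<and>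
     \<comment> \<open>comultiplication is an algebra map\<close>
     (\<forall>i<d. \<forall>j<d. \<forall>a<d. \<forall>b<d.
        (\<Sum>s<d. m i j s * c s a b) =
        (\<Sum>p<d. \<Sum>q<d. \<Sum>r<d. \<Sum>v<d. c i p q * c j r v * m p r a * m q v b)) \<and>
     (\<forall>a<d. \<forall>b<d. (\<Sum>s<d. u s * c s a b) = u a * u b) \<and>
     \<comment> \<open>counit is an algebra map\<close>
     (\<forall>i<d. \<forall>j<d. (\<Sum>s<d. m i j s * e s) = e i * e j) \<and>
     (\<Sum>s<d. u s * e s) = 1 \<and>
     \<comment> \<open>antipode\<close>
     (\<forall>i<d. \<forall>t<d.
        (\<Sum>j<d. \<Sum>l<d. \<Sum>a<d. c i j l * S j a * m a l t) = e i * u t \<and>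
        (\<Sum>j<d. \<Sum>l<d. \<Sum>a<d. c i j l * S l a * m j a t) = e i * u t))"

definition cocommutative :: "'k::field hopf \<Rightarrow> bool" where
  "cocommutative H \<longleftrightarrow> (\<forall>i<hdim H. \<forall>j<hdim H. \<forall>l<hdim H. hcomul H i j l = hcomul H i l j)"

definition helems :: "'k::field hopf \<Rightarrow> (nat \<Rightarrow> 'k) set" where
  "helems H = {x. \<forall>l\<ge>hdim H. x l = 0}"

definition hprod :: "'k::field hopf \<Rightarrow> (nat \<Rightarrow> 'k) \<Rightarrow> (nat \<Rightarrow> 'k) \<Rightarrow> (nat \<Rightarrow> 'k)" where
  "hprod H x y = (\<lambda>l. if l < hdim H then
      (\<Sum>i<hdim H. \<Sum>j<hdim H. x i * y j * hmul H i j l) else 0)"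

definition left_ideal :: "'k::field hopf \<Rightarrow> (nat \<Rightarrow> 'k) set \<Rightarrow> bool" where
  "left_ideal H I \<longleftrightarrow> I \<subseteq> helems H \<and> (\<lambda>_. 0) \<in> I \<and>
     (\<forall>x\<in>I. \<forall>y\<in>I. (\<lambda>l. x l + y l) \<in> I) \<and>
     (\<forall>a\<in>helems H. \<forall>x\<in>I. hprod H a x \<in> I)"

definition maximal_left_ideal :: "'k::field hopf \<Rightarrow> (nat \<Rightarrow> 'k) set \<Rightarrow> bool" where
  "maximal_left_ideal H I \<longleftrightarrow> left_ideal H I \<and> I \<noteq> helems H \<and>
     (\<forall>J. left_ideal H J \<and> I \<subseteq> J \<and> J \<noteq> helems H \<longrightarrow> J = I)"

definition local_alg :: "'k::field hopf \<Rightarrow> bool" where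
  "local_alg H \<longleftrightarrow> (\<exists>!I. maximal_left_ideal H I)"

definition lincomb :: "nat \<Rightarrow> nat \<Rightarrow> (nat \<Rightarrow> 'k::field mat) \<Rightarrow> (nat \<Rightarrow> 'k) \<Rightarrow> 'k mat" where
  "lincomb d n \<rho> x = mat n n (\<lambda>(a,b). \<Sum>s<d. x s * (\<rho> s $$ (a,b)))"

text \<open>rho i is the matrix by which the basis element e_i acts on k^n.\<close>
definition is_module :: "'k::field hopf \<Rightarrow> nat \<Rightarrow> (nat \<Rightarrow> 'k mat) \<Rightarrow> bool" where
  "is_module H n \<rho> \<longleftrightarrow> (\<forall>i<hdim H. \<rho> i \<in> carrier_mat n n) \<and>
     (\<forall>i<hdim H. \<forall>j<hdim H. \<rho> i * \<rho> j = lincomb (hdim H) n \<rho> (hmul H i j)) \<and>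
     lincomb (hdim H) n \<rho> (hunit H) = 1\<^sub>m n"

definition iso_mod :: "'k::field hopf \<Rightarrow> nat \<Rightarrow> (nat \<Rightarrow> 'k mat) \<Rightarrow> nat \<Rightarrow> (nat \<Rightarrow> 'k mat) \<Rightarrow> bool" where
  "iso_mod H n \<sigma> n' \<tau> \<longleftrightarrow> n = n' \<and>
     (\<exists>P \<in> carrier_mat n n. invertible_mat P \<and> (\<forall>i<hdim H. P * \<sigma> i = \<tau> i * P))"

definition triv_mod :: "'k::field hopf \<Rightarrow> nat \<Rightarrow> 'k mat" where
  "triv_mod H i = mat 1 1 (\<lambda>_. hcounit H i)"

text \<open>Dual module: h acts on M^* by f \<mapsto> f \<circ> S(h); in the dual basis this is the transpose.\<close>
definition dual_mod :: "'k::field hopf \<Rightarrow> nat \<Rightarrow> (nat \<Rightarrow> 'k mat) \<Rightarrow> nat \<Rightarrow> 'k mat" where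
  "dual_mod H n \<rho> i = transpose_mat (lincomb (hdim H) n \<rho> (hanti H i))"

definition tensor_mod :: "'k::field hopf \<Rightarrow> nat \<Rightarrow> (nat \<Rightarrow> 'k mat) \<Rightarrow> nat \<Rightarrow> (nat \<Rightarrow> 'k mat) \<Rightarrow> nat \<Rightarrow> 'k mat" where
  "tensor_mod H n1 \<sigma> n2 \<tau> i = mat (n1 * n2) (n1 * n2) (\<lambda>(r,s).
     \<Sum>j<hdim H. \<Sum>l<hdim H. hcomul H i j l * (\<sigma> j $$ (r div n2, s div n2)) * (\<tau> l $$ (r mod n2, s mod n2)))"

definition dsum_mod :: "nat \<Rightarrow> (nat \<Rightarrow> 'k::field mat) \<Rightarrow> nat \<Rightarrow> (nat \<Rightarrow> 'k mat) \<Rightarrow> nat \<Rightarrow> 'k mat" where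
  "dsum_mod n1 \<sigma> n2 \<tau> i = four_block_mat (\<sigma> i) (0\<^sub>m n1 n2) (0\<^sub>m n2 n1) (\<tau> i)"

definition free_mod :: "'k::field hopf \<Rightarrow> nat \<Rightarrow> nat \<Rightarrow> 'k mat" where
  "free_mod H r i = mat (r * hdim H) (r * hdim H) (\<lambda>(a,b).
     if a div hdim H = b div hdim H then hmul H i (b mod hdim H) (a mod hdim H) else 0)"

definition projective_mod :: "'k::field hopf \<Rightarrow> nat \<Rightarrow> (nat \<Rightarrow> 'k mat) \<Rightarrow> bool" where
  "projective_mod H n \<rho> \<longleftrightarrow> is_module H n \<rho> \<and>
     (\<exists>r n' \<tau>. is_module H n' \<tau> \<and>
        iso_mod H (n + n') (dsum_mod n \<rho> n' \<tau>) (r * hdim H) (free_mod H r))"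

definition endotrivial :: "'k::field hopf \<Rightarrow> nat \<Rightarrow> (nat \<Rightarrow> 'k mat) \<Rightarrow> bool" where
  "endotrivial H n \<rho> \<longleftrightarrow> is_module H n \<rho> \<and>
     (\<exists>n' P. projective_mod H n' P \<and>
        iso_mod H (n * n) (tensor_mod H n (dual_mod H n \<rho>) n \<rho>) (1 + n') (dsum_mod 1 (triv_mod H) n' P))"

end

theory Submission
  imports Defs "Jordan_Normal_Form.Determinant" "HOL-Library.Function_Algebras"
begin

text \<open>Write $A$ for the Hopf algebra. For an endotrivial module $M$ of dimension $n$ we have
  $M^* \otimes M \cong k \oplus A^r$ with $n^2 = 1 + r \dim A$, because projectives over a local
  algebra are free. A right integral $s$ of $A$ turns functionals on a module $V$ into module maps
  $V \to A$, namely $v \mapsto \sum S(s_1)\, x(s_2 v)$, and every module map $V \to A$ arises in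
  this way. Choose functionals $X$ and vectors $Y$ describing a splitting $A^r \to M^* \otimes M \to A^r$ of
  the free part. For any other module $N$ of dimension $n$, the same $X$ and $Y$ give a composite
  $A^r \to M^* \otimes N \to A^r$; its determinant $f_M(N)$ is a polynomial in the matrix
  entries of $N$ whose degree is bounded independently of $M$. We have $f_M(M) = 1$, and if $f_M(N) \neq 0$ then
  $M^* \otimes N \cong k \oplus A^r$; tensoring with $M$ and cancelling free summands gives
  $M \cong N$. So pairwise non-isomorphic endotrivial modules of dimension $n$ yield linearly independent
  polynomials in a fixed finite-dimensional space.\<close>

section \<open>Calculus of structure constants\<close>

text \<open>A module map out of the tensor product with M says nothing about another module N,
  whereas functionals and vectors live in a coordinate space shared by all modules of the same
  dimension. This is why maps are encoded by X and Y. The encoding is an explicit form of Hom_A(V,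
  A) = dual of V: the integral makes the map of any functional linear, and locality makes sum S(s_1)
  x(s_2) a unit for a suitable x, so that x can be normalised and every map recovered. The maps into
  and out of A^r depend linearly on the matrix entries of N, so the composite has quadratic entries
  and its determinant is homogeneous of degree 2 r dim A. Since n determines r, all f_M lie in one
  space. If f_M(N) is nonzero, the free summand has a complement of dimension n^2 - r dim A = 1.
  This complement is given by a character of A, and the augmentation is the only one, because its
  kernel is the only maximal left ideal. Freeness of projectives and cancellation both rest on one
  exchange argument for the regular module, whose endomorphisms are the right
  multiplications.\<close>

lemma sum_rotate:
  "(\<Sum>s\<in>A. \<Sum>a\<in>B. \<Sum>b\<in>C. f s a b) = (\<Sum>a\<in>B. \<Sum>b\<in>C. \<Sum>s\<in>A. f s a b)"
  by (subst sum.swap) (intro sum.cong refl sum.swap)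

locale hopf_alg =
  fixes H :: "'k::field hopf"
  assumes hopf: "hopf_algebra H"
begin

abbreviation d where "d \<equiv> hdim H"
abbreviation e where "e \<equiv> hcounit H"

text \<open>Elements of tensor powers of $A$ enter only through multilinear functionals, given by their values on the
  basis: \<open>ls w f\<close> is $f(w)$, while \<open>mu i j f\<close>, \<open>an i f\<close>, \<open>un f\<close> and \<open>co i F\<close> stand for $f(e_i e_j)$,
  $f(S e_i)$, $f(1)$ and $\sum F((e_i)_1, (e_i)_2)$. Identities in Sweedler notation thus become
  identities between nested operators.\<close>

definition ls :: "(nat \<Rightarrow> 'k) \<Rightarrow> (nat \<Rightarrow> 'k) \<Rightarrow> 'k" where
  "ls w f = (\<Sum>s<d. w s * f s)"

abbreviation mu where "mu i j \<equiv> ls (hmul H i j)"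
abbreviation an where "an i \<equiv> ls (hanti H i)"
abbreviation un where "un \<equiv> ls (hunit H)"

definition co :: "nat \<Rightarrow> (nat \<Rightarrow> nat \<Rightarrow> 'k) \<Rightarrow> 'k" where
  "co i F = (\<Sum>j<d. \<Sum>l<d. hcomul H i j l * F j l)"

text \<open>This congruence rule and the next give the simplifier the index bounds inside nested
  operators; the Hopf identities are available only for indices below \<open>d\<close>.\<close>

lemma ls_cong [cong]: "w = w' \<Longrightarrow> (\<And>s. s < d \<Longrightarrow> f s = g s) \<Longrightarrow> ls w f = ls w' g"
  by (simp add: ls_def)

lemma co_cong [cong]:
  "i = i' \<Longrightarrow> (\<And>j l. j < d \<Longrightarrow> l < d \<Longrightarrow> F j l = G j l) \<Longrightarrow> co i F = co i' G"
  by (simp add: co_def)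

lemma ls_mult_left: "ls w (\<lambda>s. a * f s) = a * ls w f"
  by (simp add: ls_def sum_distrib_left mult.left_commute)

lemma ls_mult_right: "ls w (\<lambda>s. f s * a) = ls w f * a"
  by (simp add: ls_def sum_distrib_right mult.assoc)

lemma co_mult_left: "co i (\<lambda>s t. a * F s t) = a * co i F"
  by (simp add: co_def sum_distrib_left mult.left_commute)

lemma co_mult_right: "co i (\<lambda>s t. F s t * a) = co i F * a"
  by (simp add: co_def sum_distrib_right mult.assoc)

text \<open>Functionals in independent variables commute. Later calls
  \<open>subst (k) ls_swap\<close> select the k-th nested pair and so reorder a Sweedler
  expression.\<close>

lemma ls_swap: "ls w (\<lambda>s. ls v (F s)) = ls v (\<lambda>t. ls w (\<lambda>s. F s t))"
  unfolding ls_def sum_distrib_left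
  by (subst sum.swap) (simp add: mult.left_commute)

lemma ls_sum: "ls w (\<lambda>s. \<Sum>x\<in>X. F s x) = (\<Sum>x\<in>X. ls w (\<lambda>s. F s x))"
  unfolding ls_def sum_distrib_left by (rule sum.swap)

lemma co_sum: "co i (\<lambda>s t. \<Sum>x\<in>X. F s t x) = (\<Sum>x\<in>X. co i (\<lambda>s t. F s t x))"
  unfolding co_def sum_distrib_left
  by (subst sum.swap[of _ X]) (intro sum.cong refl sum.swap)

lemma ls_co: "ls w (\<lambda>s. co i (F s)) = co i (\<lambda>p q. ls w (\<lambda>s. F s p q))"
  unfolding ls_def[of w] co_sum by (simp add: co_mult_left)

lemma co_co: "co i (\<lambda>p q. co j (F p q)) = co j (\<lambda>r v. co i (\<lambda>p q. F p q r v))"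
proof -
  have "co i (\<lambda>p q. co j (F p q)) = (\<Sum>r<d. \<Sum>v<d. co i (\<lambda>p q. hcomul H j r v * F p q r v))"
    unfolding co_def[of j] by (simp add: co_sum)
  also have "\<dots> = co j (\<lambda>r v. co i (\<lambda>p q. F p q r v))"
    by (simp add: co_mult_left co_def[of j])
  finally show ?thesis .
qed

lemma ls_add: "ls w (\<lambda>s. f s + g s) = ls w f + ls w g"
  by (simp add: ls_def algebra_simps sum.distrib)

lemma ls_kd: "t < d \<Longrightarrow> ls w (\<lambda>s. kd s t) = w t"
  by (simp add: ls_def kd_def if_distrib sum.delta cong: if_cong)

lemma ls_kd': "i < d \<Longrightarrow> (\<Sum>t<d. kd i t * f t) = f i"
proof -
  assume "i < d"
  have "(\<Sum>t<d. kd i t * f t) = (\<Sum>t<d. if t = i then f t else 0)"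
    by (intro sum.cong) (auto simp: kd_def)
  then show ?thesis using \<open>i < d\<close> by simp
qed

section \<open>Hopf axioms as identities between functionals\<close>

lemmas hopfD = hopf[unfolded hopf_algebra_def Let_def]
lemmas ax_assoc = hopfD[THEN conjunct1]
lemmas ax_unit = hopfD[THEN conjunct2, THEN conjunct1]
lemmas ax_coassoc = hopfD[THEN conjunct2, THEN conjunct2, THEN conjunct1]
lemmas ax_counit = hopfD[THEN conjunct2, THEN conjunct2, THEN conjunct2, THEN conjunct1]
lemmas ax_bialg = hopfD[THEN conjunct2, THEN conjunct2, THEN conjunct2, THEN conjunct2, THEN conjunct1]
lemmas ax_uncom = hopfD[THEN conjunct2, THEN conjunct2, THEN conjunct2, THEN conjunct2, THEN conjunct2, THEN conjunct1]
lemmas ax_emul = hopfD[THEN conjunct2, THEN conjunct2, THEN conjunct2, THEN conjunct2, THEN conjunct2, THEN conjunct2, THEN conjunct1]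
lemmas ax_eun = hopfD[THEN conjunct2, THEN conjunct2, THEN conjunct2, THEN conjunct2, THEN conjunct2, THEN conjunct2, THEN conjunct2, THEN conjunct1]
lemmas ax_anti = hopfD[THEN conjunct2, THEN conjunct2, THEN conjunct2, THEN conjunct2, THEN conjunct2, THEN conjunct2, THEN conjunct2, THEN conjunct2]

lemma mu_assoc:
  assumes "i < d" "j < d" "l < d"
  shows "mu i j (\<lambda>s. mu s l f) = mu j l (\<lambda>s. mu i s f)"
proof -
  have ax: "(\<Sum>s<d. hmul H i j s * hmul H s l t) = (\<Sum>s<d. hmul H j l s * hmul H i s t)"
    if "t < d" for t using ax_assoc assms that by blast
  have "mu i j (\<lambda>s. mu s l f) = (\<Sum>t<d. (\<Sum>s<d. hmul H i j s * hmul H s l t) * f t)"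
    unfolding ls_def sum_distrib_left sum_distrib_right by (subst sum.swap) (simp add: mult.assoc)
  also have "\<dots> = (\<Sum>t<d. (\<Sum>s<d. hmul H j l s * hmul H i s t) * f t)"
    using ax by simp
  also have "\<dots> = mu j l (\<lambda>s. mu i s f)"
    unfolding ls_def sum_distrib_left sum_distrib_right by (subst sum.swap) (simp add: mult.assoc)
  finally show ?thesis .
qed

lemma un_mu:
  assumes "j < d"
  shows "un (\<lambda>s. mu s j f) = f j" "un (\<lambda>s. mu j s f) = f j"
proof -
  have ax: "(\<Sum>s<d. hunit H s * hmul H s j t) = kd j t"
    "(\<Sum>s<d. hunit H s * hmul H j s t) = kd j t"
    if "t < d" for t using ax_unit assms that by blast+
  have "un (\<lambda>s. mu s j f) = (\<Sum>t<d. (\<Sum>s<d. hunit H s * hmul H s j t) * f t)"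
    unfolding ls_def sum_distrib_left sum_distrib_right by (subst sum.swap) (simp add: mult.assoc)
  also have "\<dots> = (\<Sum>t<d. kd j t * f t)" using ax(1) by simp
  finally show "un (\<lambda>s. mu s j f) = f j" using ls_kd'[OF assms] by simp
  have "un (\<lambda>s. mu j s f) = (\<Sum>t<d. (\<Sum>s<d. hunit H s * hmul H j s t) * f t)"
    unfolding ls_def sum_distrib_left sum_distrib_right by (subst sum.swap) (simp add: mult.assoc)
  also have "\<dots> = (\<Sum>t<d. kd j t * f t)" using ax(2) by simp
  finally show "un (\<lambda>s. mu j s f) = f j" using ls_kd'[OF assms] by simp
qed

lemma counit:
  assumes "i < d"
  shows "co i (\<lambda>j l. e j * F l) = F i" "co i (\<lambda>j l. F j * e l) = F i"
proof -
  have ax: "(\<Sum>j<d. e j * hcomul H i j t) = kd i t" "(\<Sum>l<d. hcomul H i t l * e l) = kd i t"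
    if "t < d" for t using ax_counit assms that by blast+
  have "co i (\<lambda>j l. e j * F l) = (\<Sum>t<d. (\<Sum>j<d. e j * hcomul H i j t) * F t)"
    unfolding co_def sum_distrib_right by (subst sum.swap) (simp add: ac_simps)
  also have "\<dots> = (\<Sum>t<d. kd i t * F t)" using ax(1) by simp
  finally show "co i (\<lambda>j l. e j * F l) = F i" using ls_kd'[OF assms] by simp
  have "co i (\<lambda>j l. F j * e l) = (\<Sum>t<d. (\<Sum>l<d. hcomul H i t l * e l) * F t)"
    unfolding co_def sum_distrib_right by (simp add: ac_simps)
  also have "\<dots> = (\<Sum>t<d. kd i t * F t)" using ax(2) by simp
  finally show "co i (\<lambda>j l. F j * e l) = F i" using ls_kd'[OF assms] by simp
qed

lemma coassoc:
  assumes "i < d"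
  shows "co i (\<lambda>j l. co j (\<lambda>a b. F a b l)) = co i (\<lambda>a l. co l (\<lambda>b t. F a b t))"
proof -
  have ax: "(\<Sum>j<d. hcomul H i j t * hcomul H j a b) = (\<Sum>l<d. hcomul H i a l * hcomul H l b t)"
    if "a < d" "b < d" "t < d" for a b t using ax_coassoc assms that by blast
  have "co i (\<lambda>j l. co j (\<lambda>a b. F a b l))
      = (\<Sum>j<d. \<Sum>t<d. \<Sum>a<d. \<Sum>b<d. hcomul H i j t * hcomul H j a b * F a b t)"
    by (simp add: co_def sum_distrib_left mult.assoc)
  also have "\<dots> = (\<Sum>t<d. \<Sum>a<d. \<Sum>b<d. \<Sum>j<d. hcomul H i j t * hcomul H j a b * F a b t)"
    by (subst sum.swap) (intro sum.cong refl sum_rotate)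
  also have "\<dots> = (\<Sum>t<d. \<Sum>a<d. \<Sum>b<d. \<Sum>l<d. hcomul H i a l * hcomul H l b t * F a b t)"
    by (simp add: ax flip: sum_distrib_right)
  also have "\<dots> = (\<Sum>a<d. \<Sum>l<d. \<Sum>b<d. \<Sum>t<d. hcomul H i a l * hcomul H l b t * F a b t)"
    by (subst sum_rotate) (intro sum.cong refl sum_rotate[symmetric])
  also have "\<dots> = co i (\<lambda>a l. co l (\<lambda>b t. F a b t))"
    by (simp add: co_def sum_distrib_left mult.assoc)
  finally show ?thesis .
qed

lemma mu_co:
  assumes "i < d" "j < d"
  shows "mu i j (\<lambda>s. co s F)
    = co i (\<lambda>p q. co j (\<lambda>r v. mu p r (\<lambda>a. mu q v (\<lambda>b. F a b))))"
proof -
  have ax: "(\<Sum>s<d. hmul H i j s * hcomul H s a b)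
      = co i (\<lambda>p q. co j (\<lambda>r v. hmul H p r a * hmul H q v b))"
    if "a < d" "b < d" for a b
  proof -
    have "(\<Sum>s<d. hmul H i j s * hcomul H s a b) = (\<Sum>p<d. \<Sum>q<d. \<Sum>r<d. \<Sum>v<d.
        hcomul H i p q * hcomul H j r v * hmul H p r a * hmul H q v b)"
      using ax_bialg assms that by blast
    then show ?thesis by (simp add: co_def sum_distrib_left mult.assoc)
  qed
  have "mu i j (\<lambda>s. co s F) = (\<Sum>a<d. \<Sum>b<d. (\<Sum>s<d. hmul H i j s * hcomul H s a b) * F a b)"
    unfolding ls_def co_def sum_distrib_left sum_distrib_right
    by (subst sum_rotate) (simp add: mult.assoc)
  also have "\<dots> = (\<Sum>a<d. \<Sum>b<d. co i (\<lambda>p q. co j (\<lambda>r v. hmul H p r a * (hmul H q v b * F a b))))"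
    by (simp add: ax mult.assoc flip: co_mult_right)
  also have "\<dots> = co i (\<lambda>p q. co j (\<lambda>r v. mu p r (\<lambda>a. mu q v (\<lambda>b. F a b))))"
    unfolding ls_def by (simp add: co_sum sum_distrib_left)
  finally show ?thesis .
qed

lemma un_co: "un (\<lambda>s. co s F) = un (\<lambda>a. un (\<lambda>b. F a b))"
proof -
  have ax: "(\<Sum>s<d. hunit H s * hcomul H s a b) = hunit H a * hunit H b"
    if "a < d" "b < d" for a b
    using ax_uncom that by blast
  have "un (\<lambda>s. co s F) = (\<Sum>a<d. \<Sum>b<d. (\<Sum>s<d. hunit H s * hcomul H s a b) * F a b)"
    unfolding ls_def co_def sum_distrib_left sum_distrib_right
    by (subst sum_rotate) (simp add: mult.assoc)
  then show ?thesis by (simp add: ax ls_def sum_distrib_left mult.assoc)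
qed

lemma mu_e: "i < d \<Longrightarrow> j < d \<Longrightarrow> mu i j e = e i * e j"
  using ax_emul unfolding ls_def by blast

lemma un_e: "un e = 1"
  using ax_eun unfolding ls_def by blast

lemma antip:
  assumes "i < d"
  shows "co i (\<lambda>j l. an j (\<lambda>a. mu a l f)) = e i * un f"
    "co i (\<lambda>j l. an l (\<lambda>a. mu j a f)) = e i * un f"
proof -
  have ax: "(\<Sum>j<d. \<Sum>l<d. \<Sum>a<d. hcomul H i j l * hanti H j a * hmul H a l t) = e i * hunit H t"
   "(\<Sum>j<d. \<Sum>l<d. \<Sum>a<d. hcomul H i j l * hanti H l a * hmul H j a t) = e i * hunit H t"
    if "t < d" for t using ax_anti assms that by blast+
  have "co i (\<lambda>j l. an j (\<lambda>a. mu a l f)) =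
     (\<Sum>t<d. co i (\<lambda>j l. an j (\<lambda>a. hmul H a l t)) * f t)"
    unfolding ls_def by (simp add: co_mult_right[symmetric] co_sum[symmetric] sum_distrib_left
       sum_distrib_right mult.assoc) (subst sum.swap, simp)
  also have "\<dots> = (\<Sum>t<d. e i * hunit H t * f t)"
    by (intro sum.cong refl) (simp add: co_def ls_def sum_distrib_left ax flip: mult.assoc)
  finally show "co i (\<lambda>j l. an j (\<lambda>a. mu a l f)) = e i * un f"
    by (simp add: ls_def sum_distrib_left mult.assoc)
  have "co i (\<lambda>j l. an l (\<lambda>a. mu j a f)) =
     (\<Sum>t<d. co i (\<lambda>j l. an l (\<lambda>a. hmul H j a t)) * f t)"
    unfolding ls_def by (simp add: co_mult_right[symmetric] co_sum[symmetric] sum_distrib_left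
       sum_distrib_right mult.assoc) (subst sum.swap, simp)
  also have "\<dots> = (\<Sum>t<d. e i * hunit H t * f t)"
    by (intro sum.cong refl) (simp add: co_def ls_def sum_distrib_left ax flip: mult.assoc)
  finally show "co i (\<lambda>j l. an l (\<lambda>a. mu j a f)) = e i * un f"
    by (simp add: ls_def sum_distrib_left mult.assoc)
qed

section \<open>Consequences for the unit, the antipode and integrals\<close>

lemma d_pos: "d > 0"
  using un_e by (cases "d = 0") (auto simp: ls_def)

text \<open>Since Delta(1) = 1 (x) 1 and eps(1) = 1, the antipode axiom at 1 reads S(1) 1 =
  1.\<close>

lemma un_an: "un (\<lambda>s. an s f) = un f"
proof -
  have "un f = un (\<lambda>i. co i (\<lambda>j l. an j (\<lambda>a. mu a l f)))"
    by (simp add: antip ls_mult_right un_e)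
  also have "\<dots> = un (\<lambda>j. an j (\<lambda>a. un (\<lambda>l. mu a l f)))"
    unfolding un_co by (subst (2) ls_swap) (rule refl)
  also have "\<dots> = un (\<lambda>s. an s f)" by (simp add: un_mu)
  finally show ?thesis by simp
qed

text \<open>Apply the algebra map eps to the antipode axiom: sum eps(S(h_1)) eps(h_2) = eps(h), and
  the counit law removes the second factor.\<close>

lemma an_e: "i < d \<Longrightarrow> an i e = e i"
proof -
  assume i: "i < d"
  have "e i = co i (\<lambda>j l. an j (\<lambda>a. mu a l e))" by (simp add: antip i un_e)
  also have "\<dots> = co i (\<lambda>j l. an j e * e l)" by (simp add: mu_e ls_mult_right)
  also have "\<dots> = an i e" by (rule counit(2)[OF i])
  finally show ?thesis by simp
qed

text \<open>In Sweedler notation: $\sum S(h_1 a) h_2 = \varepsilon(h) S(a)$.\<close>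

lemma antip_mult_cancel:
  assumes i: "i < d" and j: "j < d"
  shows "co i (\<lambda>p q. mu p j (\<lambda>s. an s (\<lambda>a. mu a q f))) = e i * an j f"
proof -
  have "co i (\<lambda>p q. mu p j (\<lambda>s. an s (\<lambda>a. mu a q f)))
     = co i (\<lambda>p q. co j (\<lambda>r v. mu p r (\<lambda>s. an s (\<lambda>a. mu a q f)) * e v))"
    by (simp add: counit(2) j)
  \<comment> \<open>Here h and a are the basis elements \<open>i\<close> and \<open>j\<close>. After
    a is split as a_1 eps(a_2), the scalar eps(a_2) is replaced by a_2 S(a_3). This puts a_2 next to
    h_2, and h_1 a_1, h_2 a_2 can then be recombined to Delta(h a_1).\<close>
  also have "\<dots> = co i (\<lambda>p q. co j (\<lambda>r v. co v (\<lambda>v1 v2. an v2 (\<lambda>w. mu v1 w (\<lambda>z.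
       mu p r (\<lambda>s. an s (\<lambda>a. mu q z (\<lambda>y. mu a y f))))))))"
  proof (intro co_cong refl)
    fix p q r v assume b: "p < d" "q < d" "r < d" "v < d"
    have "un (\<lambda>z. mu p r (\<lambda>s. an s (\<lambda>a. mu q z (\<lambda>y. mu a y f))))
        = mu p r (\<lambda>s. an s (\<lambda>a. un (\<lambda>z. mu q z (\<lambda>y. mu a y f))))"
      by (subst ls_swap, subst (2) ls_swap, rule refl)
    also have "\<dots> = mu p r (\<lambda>s. an s (\<lambda>a. mu a q f))"
      using b by (simp add: un_mu)
    finally show "mu p r (\<lambda>s. an s (\<lambda>a. mu a q f)) * e v = co v (\<lambda>v1 v2. an v2 (\<lambda>w. mu v1 w (\<lambda>z.
       mu p r (\<lambda>s. an s (\<lambda>a. mu q z (\<lambda>y. mu a y f))))))"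
      using b by (simp add: antip)
  qed
  also have "\<dots> = co i (\<lambda>p q. co j (\<lambda>r v. co v (\<lambda>v1 v2. 
       mu p r (\<lambda>s. mu q v1 (\<lambda>z. an s (\<lambda>a. an v2 (\<lambda>w. mu z w (\<lambda>y. mu a y f))))))))"
  proof (intro co_cong refl)
    fix p q r v v1 v2 assume b: "p < d" "q < d" "r < d" "v < d" "v1 < d" "v2 < d"
    have "an v2 (\<lambda>w. mu v1 w (\<lambda>z. mu p r (\<lambda>s. an s (\<lambda>a. mu q z (\<lambda>y. mu a y f)))))
      = an v2 (\<lambda>w. mu p r (\<lambda>s. an s (\<lambda>a. mu v1 w (\<lambda>z. mu q z (\<lambda>y. mu a y f)))))"
      by (subst (2) ls_swap, subst (3) ls_swap, rule refl)
    also have "\<dots> = an v2 (\<lambda>w. mu p r (\<lambda>s. an s (\<lambda>a. mu q v1 (\<lambda>z. mu z w (\<lambda>y. mu a y f)))))"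
      using b by (simp add: mu_assoc)
    also have "\<dots> = mu p r (\<lambda>s. an s (\<lambda>a. mu q v1 (\<lambda>z. an v2 (\<lambda>w. mu z w (\<lambda>y. mu a y f)))))"
      by (subst ls_swap, subst (2) ls_swap, subst (3) ls_swap, rule refl)
    also have "\<dots> = mu p r (\<lambda>s. mu q v1 (\<lambda>z. an s (\<lambda>a. an v2 (\<lambda>w. mu z w (\<lambda>y. mu a y f)))))"
      by (intro ls_cong refl ls_swap)
    finally show "an v2 (\<lambda>w. mu v1 w (\<lambda>z. mu p r (\<lambda>s. an s (\<lambda>a. mu q z (\<lambda>y. mu a y f)))))
      = mu p r (\<lambda>s. mu q v1 (\<lambda>z. an s (\<lambda>a. an v2 (\<lambda>w. mu z w (\<lambda>y. mu a y f)))))" .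
  qed
  also have "\<dots> = co i (\<lambda>p q. co j (\<lambda>v v2. co v (\<lambda>r v1.
       mu p r (\<lambda>s. mu q v1 (\<lambda>z. an s (\<lambda>a. an v2 (\<lambda>w. mu z w (\<lambda>y. mu a y f))))))))"
    by (simp add: coassoc[OF j])
  also have "\<dots> = co j (\<lambda>v v2. co i (\<lambda>p q. co v (\<lambda>r v1.
       mu p r (\<lambda>s. mu q v1 (\<lambda>z. an s (\<lambda>a. an v2 (\<lambda>w. mu z w (\<lambda>y. mu a y f))))))))"
    by (rule co_co)
  also have "\<dots> = co j (\<lambda>v v2. mu i v (\<lambda>t. co t (\<lambda>s z. 
      an s (\<lambda>a. an v2 (\<lambda>w. mu z w (\<lambda>y. mu a y f))))))"
    by (intro co_cong refl) (simp add: mu_co[OF i])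
  also have "\<dots> = co j (\<lambda>v v2. mu i v (\<lambda>t. co t (\<lambda>s z. 
      an s (\<lambda>a. mu a z (\<lambda>y. an v2 (\<lambda>w. mu y w f))))))"
  proof -
    have "an v2 (\<lambda>w. mu z w (\<lambda>y. mu a y f)) = mu a z (\<lambda>y. an v2 (\<lambda>w. mu y w f))"
      if "z < d" "a < d" "v2 < d" for z a v2
    proof -
      have "an v2 (\<lambda>w. mu z w (\<lambda>y. mu a y f)) = an v2 (\<lambda>w. mu a z (\<lambda>y. mu y w f))"
        using that by (simp add: mu_assoc)
      also have "\<dots> = mu a z (\<lambda>y. an v2 (\<lambda>w. mu y w f))" by (rule ls_swap)
      finally show ?thesis .
    qed
    then show ?thesis by simp
  qed
  also have "\<dots> = co j (\<lambda>v v2. mu i v (\<lambda>t. e t * un (\<lambda>y. an v2 (\<lambda>w. mu y w f))))"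
    by (simp add: antip)
  also have "\<dots> = co j (\<lambda>v v2. e i * (e v * an v2 f))"
  proof (intro co_cong refl)
    fix v v2 assume b: "v < d" "v2 < d"
    have "un (\<lambda>y. an v2 (\<lambda>w. mu y w f)) = an v2 (\<lambda>w. un (\<lambda>y. mu y w f))" by (rule ls_swap)
    also have "\<dots> = an v2 f" by (simp add: un_mu)
    finally show "mu i v (\<lambda>t. e t * un (\<lambda>y. an v2 (\<lambda>w. mu y w f))) = e i * (e v * an v2 f)"
      using b i by (simp add: ls_mult_right mu_e mult.assoc)
  qed
  also have "\<dots> = e i * an j f" by (simp add: co_mult_left counit(1)[OF j])
  finally show ?thesis .
qed

text \<open>Multiply S(h_1 a) by eps(h_2) = h_2 S(h_3) and regroup: \<open>antip_mult_cancel\<close>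
  contracts S(h_1 a) h_2 to eps(h_1) S(a), which leaves S(a) S(h).\<close>

lemma an_mu:
  assumes i: "i < d" and j: "j < d"
  shows "mu i j (\<lambda>s. an s f) = an j (\<lambda>b. an i (\<lambda>a. mu b a f))"
proof -
  have "mu i j (\<lambda>s. an s f) = co i (\<lambda>p q. mu p j (\<lambda>s. an s f) * e q)"
    by (simp add: counit(2) i)
  also have "\<dots> = co i (\<lambda>p q. co q (\<lambda>q1 q2.
      mu p j (\<lambda>s. an s (\<lambda>a. mu a q1 (\<lambda>z. an q2 (\<lambda>w. mu z w f))))))"
  proof (intro co_cong refl)
    fix p q assume b: "p < d" "q < d"
    have "mu p j (\<lambda>s. an s f) = un (\<lambda>z. mu p j (\<lambda>s. an s (\<lambda>a. mu a z f)))"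
    proof -
      have "un (\<lambda>z. mu p j (\<lambda>s. an s (\<lambda>a. mu a z f))) = mu p j (\<lambda>s. an s (\<lambda>a. un (\<lambda>z. mu a z f)))"
        by (subst ls_swap, subst (2) ls_swap, rule refl)
      then show ?thesis by (simp add: un_mu)
    qed
    then have "mu p j (\<lambda>s. an s f) * e q
       = co q (\<lambda>q1 q2. an q2 (\<lambda>w. mu q1 w (\<lambda>z. mu p j (\<lambda>s. an s (\<lambda>a. mu a z f)))))"
      using b by (simp add: antip)
    also have "\<dots> = co q (\<lambda>q1 q2. an q2 (\<lambda>w. mu p j (\<lambda>s. an s (\<lambda>a. mu q1 w (\<lambda>z. mu a z f)))))"
      by (subst (2) ls_swap, subst (3) ls_swap, rule refl)
    also have "\<dots> = co q (\<lambda>q1 q2. an q2 (\<lambda>w. mu p j (\<lambda>s. an s (\<lambda>a. mu a q1 (\<lambda>z. mu z w f)))))"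
      by (simp add: mu_assoc)
    also have "\<dots> = co q (\<lambda>q1 q2. mu p j (\<lambda>s. an s (\<lambda>a. mu a q1 (\<lambda>z. an q2 (\<lambda>w. mu z w f)))))"
      by (subst ls_swap, subst (2) ls_swap, subst (3) ls_swap, rule refl)
    finally show "mu p j (\<lambda>s. an s f) * e q = co q (\<lambda>q1 q2.
      mu p j (\<lambda>s. an s (\<lambda>a. mu a q1 (\<lambda>z. an q2 (\<lambda>w. mu z w f)))))" .
  qed
  also have "\<dots> = co i (\<lambda>p q2. co p (\<lambda>p1 q1.
      mu p1 j (\<lambda>s. an s (\<lambda>a. mu a q1 (\<lambda>z. an q2 (\<lambda>w. mu z w f))))))"
    by (rule coassoc[OF i, symmetric])
  also have "\<dots> = co i (\<lambda>p q2. e p * an j (\<lambda>z. an q2 (\<lambda>w. mu z w f)))"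
    using j by (simp add: antip_mult_cancel)
  also have "\<dots> = an j (\<lambda>z. an i (\<lambda>w. mu z w f))" by (rule counit(1)[OF i])
  finally show ?thesis .
qed

lemma co_swap:
  assumes "cocommutative H" "i < d"
  shows "co i (\<lambda>p q. F q p) = co i F"
proof -
  have "co i (\<lambda>p q. F q p) = (\<Sum>q<d. \<Sum>p<d. hcomul H i p q * F q p)"
    unfolding co_def by (rule sum.swap)
  also have "\<dots> = co i F"
    using assms unfolding co_def cocommutative_def by (intro sum.cong refl) auto
  finally show ?thesis .
qed

text \<open>In Sweedler notation: $\sum h S(s_1) \otimes s_2 = \sum S(s_1) \otimes s_2 h$ for a right integral $s$.\<close>

lemma right_integral_shift:
  assumes sg: "\<And>h f. h < d \<Longrightarrow> ls sg (\<lambda>s. mu s h f) = e h * ls sg f" and h: "h < d"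
  shows "ls sg (\<lambda>s. co s (\<lambda>p q. an p (\<lambda>a. mu h a (\<lambda>b. F b q))))
       = ls sg (\<lambda>s. co s (\<lambda>p q. an p (\<lambda>a. mu q h (\<lambda>b. F a b))))" (is "?L = ?R")
proof -
  \<comment> \<open>\<open>Z\<close> stands for h_1 S(s_1 h_2) (x) s_2 h_3, which is evaluated in
    two ways. Contracting h_1 S(h_2) leaves the right side; recombining s_1 h_2 and s_2 h_3 to the
    coproduct of s h_2 and using the integral property leaves the left side.\<close>
  define Z where "Z h1 h2 h3 = ls sg (\<lambda>s. co s (\<lambda>p q. mu p h2 (\<lambda>y. an y (\<lambda>a. mu q h3 (\<lambda>b.
      mu h1 a (\<lambda>z. F z b))))))" for h1 h2 h3
  have "co h (\<lambda>h12 h3. co h12 (\<lambda>h1 h2. Z h1 h2 h3)) = 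
     co h (\<lambda>h12 h3. e h12 * ls sg (\<lambda>s. co s (\<lambda>p q. mu q h3 (\<lambda>b. an p (\<lambda>z. F z b)))))"
  proof (intro co_cong refl)
    fix h12 h3 assume b: "h12 < d" "h3 < d"
    have "co h12 (\<lambda>h1 h2. Z h1 h2 h3) = ls sg (\<lambda>s. co s (\<lambda>p q. co h12 (\<lambda>h1 h2.
        mu p h2 (\<lambda>y. an y (\<lambda>a. mu q h3 (\<lambda>b. mu h1 a (\<lambda>z. F z b)))))))"
      unfolding Z_def by (subst ls_co[symmetric], subst co_co, rule refl)
    also have "\<dots> = ls sg (\<lambda>s. co s (\<lambda>p q. co h12 (\<lambda>h1 h2.
        an h2 (\<lambda>x. an p (\<lambda>y. mu x y (\<lambda>a. mu q h3 (\<lambda>b. mu h1 a (\<lambda>z. F z b))))))))"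
      using b by (simp add: an_mu)
    also have "\<dots> = ls sg (\<lambda>s. co s (\<lambda>p q. co h12 (\<lambda>h1 h2.
        an h2 (\<lambda>x. mu q h3 (\<lambda>b. an p (\<lambda>y. mu x y (\<lambda>a. mu h1 a (\<lambda>z. F z b))))))))"
      by (subst (4) ls_swap, subst (3) ls_swap, rule refl)
    also have "\<dots> = ls sg (\<lambda>s. co s (\<lambda>p q. co h12 (\<lambda>h1 h2.
        an h2 (\<lambda>x. mu q h3 (\<lambda>b. an p (\<lambda>y. mu h1 x (\<lambda>a. mu a y (\<lambda>z. F z b))))))))"
      using b by (simp add: mu_assoc)
    also have "\<dots> = ls sg (\<lambda>s. co s (\<lambda>p q. co h12 (\<lambda>h1 h2.
        an h2 (\<lambda>x. mu h1 x (\<lambda>a. mu q h3 (\<lambda>b. an p (\<lambda>y. mu a y (\<lambda>z. F z b))))))))"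
      by (subst (4) ls_swap, subst (3) ls_swap, rule refl)
    also have "\<dots> = ls sg (\<lambda>s. co s (\<lambda>p q. e h12 *
        un (\<lambda>a. mu q h3 (\<lambda>b. an p (\<lambda>y. mu a y (\<lambda>z. F z b))))))"
      using b by (simp add: antip)
    also have "\<dots> = ls sg (\<lambda>s. co s (\<lambda>p q. e h12 *
        mu q h3 (\<lambda>b. an p (\<lambda>y. un (\<lambda>a. mu a y (\<lambda>z. F z b))))))"
      by (subst (2) ls_swap, subst (3) ls_swap, rule refl)
    also have "\<dots> = e h12 * ls sg (\<lambda>s. co s (\<lambda>p q. mu q h3 (\<lambda>b. an p (\<lambda>z. F z b))))"
      by (simp add: un_mu co_mult_left ls_mult_left)
    finally show "co h12 (\<lambda>h1 h2. Z h1 h2 h3)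
        = e h12 * ls sg (\<lambda>s. co s (\<lambda>p q. mu q h3 (\<lambda>b. an p (\<lambda>z. F z b))))" .
  qed
  also have "\<dots> = ls sg (\<lambda>s. co s (\<lambda>p q. mu q h (\<lambda>b. an p (\<lambda>z. F z b))))"
    by (rule counit(1)[OF h])
  also have "\<dots> = ?R" by (subst (2) ls_swap, rule refl)
  finally have R: "co h (\<lambda>h12 h3. co h12 (\<lambda>h1 h2. Z h1 h2 h3)) = ?R" .
  have "co h (\<lambda>h12 h3. co h12 (\<lambda>h1 h2. Z h1 h2 h3)) = co h (\<lambda>h1 k. co k (\<lambda>h2 h3. Z h1 h2 h3))"
    by (rule coassoc[OF h])
  also have "\<dots> = co h (\<lambda>h1 k. ls sg (\<lambda>s. co s (\<lambda>p q. an p (\<lambda>a. mu h1 a (\<lambda>z. F z q)))) * e k)"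
  proof (intro co_cong refl)
    fix h1 k assume b: "h1 < d" "k < d"
    have "co k (\<lambda>h2 h3. Z h1 h2 h3) = ls sg (\<lambda>s. co s (\<lambda>p q. co k (\<lambda>h2 h3.
        mu p h2 (\<lambda>y. an y (\<lambda>a. mu q h3 (\<lambda>b. mu h1 a (\<lambda>z. F z b)))))))"
      unfolding Z_def by (subst ls_co[symmetric], subst co_co, rule refl)
    also have "\<dots> = ls sg (\<lambda>s. co s (\<lambda>p q. co k (\<lambda>h2 h3.
        mu p h2 (\<lambda>y. mu q h3 (\<lambda>b. an y (\<lambda>a. mu h1 a (\<lambda>z. F z b)))))))"
      by (subst (3) ls_swap, rule refl)
    also have "\<dots> = ls sg (\<lambda>s. mu s k (\<lambda>t. co t (\<lambda>y b. an y (\<lambda>a. mu h1 a (\<lambda>z. F z b)))))"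
      using b by (simp add: mu_co)
    also have "\<dots> = ls sg (\<lambda>s. co s (\<lambda>p q. an p (\<lambda>a. mu h1 a (\<lambda>z. F z q)))) * e k"
      using b by (simp add: sg mult.commute)
    finally show "co k (\<lambda>h2 h3. Z h1 h2 h3) =
      ls sg (\<lambda>s. co s (\<lambda>p q. an p (\<lambda>a. mu h1 a (\<lambda>z. F z q)))) * e k" .
  qed
  also have "\<dots> = ?L" by (rule counit(2)[OF h])
  finally show ?thesis using R by simp
qed

end

section \<open>Matrices and complements\<close>

text \<open>The library rule would undo rewriting with associativity from right to left.\<close>

declare assoc_mult_mat [simp del]

lemma mat_assoc: "dim_col A = dim_row B \<Longrightarrow> dim_col B = dim_row C \<Longrightarrow> A * B * C = A * (B * C)"
  for A B C :: "'a::semiring_0 mat"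
  by (rule assoc_mult_mat[of A "dim_row A" "dim_row B" B "dim_row C" C "dim_col C"]) auto

lemma mat_distrib_left:
  "dim_row B = dim_row C \<Longrightarrow> dim_col B = dim_col C \<Longrightarrow> dim_col A = dim_row B \<Longrightarrow> A * (B + C) = A * B + A * C"
  for A B C :: "'a::semiring_0 mat"
  by (rule mult_add_distrib_mat[of A "dim_row A" "dim_row B" B "dim_col B" C]) auto

lemma mat_distrib_right:
  "dim_row A = dim_row B \<Longrightarrow> dim_col A = dim_col B \<Longrightarrow> dim_col A = dim_row C \<Longrightarrow> (A + B) * C = A * C + B * C"
  for A B C :: "'a::semiring_0 mat"
  by (rule add_mult_distrib_mat[of A "dim_row A" "dim_row C" B C "dim_col C"]) auto

lemma mat_distrib_left_minus:
  "dim_row B = dim_row C \<Longrightarrow> dim_col B = dim_col C \<Longrightarrow> dim_col A = dim_row B \<Longrightarrow> A * (B - C) = A * B - A * C"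
  for A B C :: "'a::ring mat"
  by (rule mult_minus_distrib_mat[of A "dim_row A" "dim_row B" B "dim_col B" C]) auto

lemma mat_distrib_right_minus:
  "dim_row A = dim_row B \<Longrightarrow> dim_col A = dim_col B \<Longrightarrow> dim_col A = dim_row C \<Longrightarrow> (A - B) * C = A * C - B * C"
  for A B C :: "'a::ring mat"
  by (rule minus_mult_distrib_mat[of A "dim_row A" "dim_row C" B C "dim_col C"]) auto

lemma mat_diff_zero: "A - 0\<^sub>m (dim_row A) (dim_col A) = A" for A :: "'a::group_add mat"
  by (rule eq_matI) auto

lemmas mat_ring = mat_assoc mat_distrib_left mat_distrib_right
  mat_distrib_left_minus mat_distrib_right_minus

text \<open>Lets an identity for \<open>A * B\<close> fire inside products that
  \<open>mat_assoc\<close> has bracketed to the right.\<close>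

lemma mat_cancel_mid:
  "A * B = C \<Longrightarrow> dim_col A = dim_row B \<Longrightarrow> dim_col B = dim_row X \<Longrightarrow> A * (B * X) = C * X"
  for A B X :: "'a::semiring_0 mat"
  by (simp flip: mat_assoc)

lemma index_mult_mat_sum:
  "i < dim_row A \<Longrightarrow> j < dim_col B \<Longrightarrow> dim_col A = dim_row B \<Longrightarrow>
   (A * B) $$ (i,j) = (\<Sum>k<dim_row B. A $$ (i,k) * B $$ (k,j))"
  by (simp add: scalar_prod_def lessThan_atLeast0)

text \<open>If \<open>p < m\<close>, padding with zeros to size \<open>m\<close> gives square
  matrices with product 1, hence with product 1 in the other order as well; but row \<open>p\<close>
  of \<open>B' * A'\<close> vanishes.\<close>

lemma inverse_mats_dim_le:
  fixes A B :: "'a::field mat"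
  assumes A: "A \<in> carrier_mat m p" and B: "B \<in> carrier_mat p m" and AB: "A * B = 1\<^sub>m m"
  shows "m \<le> p"
proof (rule ccontr)
  assume "\<not> m \<le> p"
  then have pm: "p < m" by simp
  define A' where "A' = mat m m (\<lambda>(i,j). if j < p then A $$ (i,j) else 0)"
  define B' where "B' = mat m m (\<lambda>(i,j). if i < p then B $$ (i,j) else 0)"
  have c: "A' \<in> carrier_mat m m" "B' \<in> carrier_mat m m" by (auto simp: A'_def B'_def)
  have "A' * B' = 1\<^sub>m m"
  proof (rule eq_matI)
    fix i j assume ij: "i < dim_row (1\<^sub>m m)" "j < dim_col (1\<^sub>m m)"
    have "(A' * B') $$ (i,j) = (\<Sum>k<m. A' $$ (i,k) * B' $$ (k,j))"
      using ij c by (subst index_mult_mat_sum) auto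
    also have "\<dots> = (\<Sum>k<p. A $$ (i,k) * B $$ (k,j))"
      using ij pm by (intro sum.mono_neutral_cong_right) (auto simp: A'_def B'_def)
    also have "\<dots> = (A * B) $$ (i,j)"
      using ij A B by (subst index_mult_mat_sum) auto
    finally show "(A' * B') $$ (i,j) = (1\<^sub>m m) $$ (i,j)" using AB by simp
  qed (use c in auto)
  then have "B' * A' = 1\<^sub>m m" using c by (metis mat_mult_left_right_inverse)
  moreover have "(B' * A') $$ (p,p) = 0"
    using pm c by (subst index_mult_mat_sum) (auto simp: B'_def intro!: sum.neutral)
  ultimately show False using pm by simp
qed

lemma inverse_mats_dim_eq:
  fixes A B :: "'a::field mat"
  assumes "A \<in> carrier_mat m p" "B \<in> carrier_mat p m" "A * B = 1\<^sub>m m" "B * A = 1\<^sub>m p"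
  shows "m = p"
  using inverse_mats_dim_le[of A m p B] inverse_mats_dim_le[of B p m A] assms by auto

text \<open>One pointwise structure serves both coordinate vectors of bounded support and polynomial
  functions of a module structure.\<close>

interpretation fun_space: vector_space "\<lambda>(a::'a::field) (f::'x \<Rightarrow> 'a) x. a * f x"
  by unfold_locales (auto simp: fun_eq_iff algebra_simps)

lemma sum_fun_apply: "(\<Sum>x\<in>X. f x) y = (\<Sum>x\<in>X. f x y)"
  for f :: "'a \<Rightarrow> 'b \<Rightarrow> 'c::comm_monoid_add"
  by (induction X rule: infinite_finite_induct) auto

lemma finitely_supported_in_span:
  fixes v :: "nat \<Rightarrow> 'a::field"
  assumes "\<And>i. i \<ge> n \<Longrightarrow> v i = 0"
  shows "v \<in> fun_space.span ((\<lambda>i. kd i) ` {..<n})"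
proof -
  have "v = (\<Sum>i<n. (\<lambda>x. v i * kd i x))"
  proof
    fix x
    have "(\<Sum>i<n. v i * kd i x) = (\<Sum>i<n. if i = x then v i else 0)"
      by (intro sum.cong) (auto simp: kd_def)
    then show "v x = (\<Sum>i<n. (\<lambda>x. v i * kd i x)) x"
      using assms[of x] by (auto simp: sum_fun_apply)
  qed
  also have "\<dots> \<in> fun_space.span ((\<lambda>i. kd i) ` {..<n})"
    by (intro fun_space.span_sum fun_space.span_scale fun_space.span_base) auto
  finally show ?thesis .
qed

lemma independent_finitely_supported:
  fixes B :: "(nat \<Rightarrow> 'a::field) set"
  assumes "fun_space.independent B" "\<And>v i. v \<in> B \<Longrightarrow> i \<ge> n \<Longrightarrow> v i = 0"
  shows "finite B \<and> card B \<le> n"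
proof -
  have "finite B \<and> card B \<le> card ((\<lambda>i. kd i :: nat \<Rightarrow> 'a) ` {..<n})"
    using assms by (intro fun_space.independent_span_bound) (auto intro: finitely_supported_in_span)
  then show ?thesis using card_image_le[of "{..<n}" "\<lambda>i. kd i :: nat \<Rightarrow> 'a"] by auto
qed

text \<open>\<open>b * c\<close> is idempotent, so the space is the sum of the image of
  \<open>b\<close> and the kernel of \<open>c\<close>. The columns of \<open>w\<close> form a basis
  of that kernel, and \<open>w'\<close> reads off coordinates after the projection
  \<open>1 - b * c\<close>.\<close>

lemma split_complement:
  fixes b c :: "'a::field mat"
  assumes b: "b \<in> carrier_mat n k" and c: "c \<in> carrier_mat k n" and cb: "c * b = 1\<^sub>m k"
  obtains q w w' where "w \<in> carrier_mat n q" "w' \<in> carrier_mat q n"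
    "c * w = 0\<^sub>m k q" "w' * b = 0\<^sub>m q k" "w' * w = 1\<^sub>m q" "b * c + w * w' = 1\<^sub>m n"
proof -
  define K where "K = {v :: nat \<Rightarrow> 'a. (\<forall>i\<ge>n. v i = 0) \<and> (\<forall>a<k. (\<Sum>i<n. c $$ (a,i) * v i) = 0)}"
  obtain B where B: "B \<subseteq> K" "fun_space.independent B" "K \<subseteq> fun_space.span B"
    using fun_space.maximal_independent_subset[of K] by auto
  have fin: "finite B"
    using independent_finitely_supported[OF B(2), of n] B(1) by (auto simp: K_def)
  define q where "q = card B"
  obtain g where g: "bij_betw g {..<q} B"
    using fin ex_bij_betw_nat_finite[of B] by (auto simp: q_def lessThan_atLeast0)
  have gB: "g j \<in> B" if "j < q" for j using g that by (auto simp: bij_betw_def)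
  define w where "w = mat n q (\<lambda>(i,j). g j i)"
  have w: "w \<in> carrier_mat n q" by (simp add: w_def)
  \<comment> \<open>Independence of the columns makes \<open>w\<close> left cancellable; both
    \<open>w' * b = 0\<close> and \<open>w' * w = 1\<close> are obtained after multiplication by
    \<open>w\<close>.\<close>
  have inj: "X = 0\<^sub>m q r" if X: "X \<in> carrier_mat q r" and 0: "w * X = 0\<^sub>m n r" for X r
  proof (rule eq_matI)
    fix j t assume "j < dim_row (0\<^sub>m q r :: 'a mat)" "t < dim_col (0\<^sub>m q r :: 'a mat)"
    then have jt: "j < q" "t < r" by auto
    define u where "u v = X $$ (inv_into {..<q} g v, t)" for v
    have ug: "u (g j) = X $$ (j,t)" if "j < q" for j
      unfolding u_def using g that by (simp add: bij_betw_inv_into_left)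
    have "(\<Sum>v\<in>B. (\<lambda>x. u v * v x)) = 0"
    proof
      fix i
      have "(\<Sum>v\<in>B. u v * v i) = (\<Sum>j<q. u (g j) * g j i)"
        by (rule sum.reindex_bij_betw[OF g, symmetric])
      also have "\<dots> = 0"
      proof (cases "i < n")
        case True
        have "(\<Sum>j<q. u (g j) * g j i) = (w * X) $$ (i,t)"
          using True jt X by (subst index_mult_mat_sum) (auto simp: w_def ug mult.commute)
        then show ?thesis using 0 True jt by simp
      next
        case False
        then have "g j i = 0" if "j < q" for j using gB[OF that] B(1) by (auto simp: K_def)
        then show ?thesis by simp
      qed
      finally show "(\<Sum>v\<in>B. (\<lambda>x. u v * v x)) i = 0 i" by (simp add: sum_fun_apply)
    qed
    then have "u (g j) = 0"
      using fun_space.independentD[OF B(2) fin subset_refl] gB[OF jt(1)] by blast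
    then show "X $$ (j,t) = 0\<^sub>m q r $$ (j,t)" using ug jt by simp
  qed (use X in auto)
  define E where "E = 1\<^sub>m n - b * c"
  have E: "E \<in> carrier_mat n n" using b c by (auto simp: E_def intro!: carrier_matI)
  have cE: "c * E = 0\<^sub>m k n"
    using b c by (simp add: E_def mat_ring mat_cancel_mid[OF cb])
  have "\<exists>u. (\<lambda>i. if i < n then E $$ (i,t) else 0) = (\<Sum>v\<in>B. (\<lambda>x. u v * v x))"
    if t: "t \<in> {..<n}" for t
  proof -
    have "(\<Sum>i<n. c $$ (a,i) * (if i < n then E $$ (i,t) else 0)) = 0" if a: "a < k" for a
    proof -
      have "(\<Sum>i<n. c $$ (a,i) * (if i < n then E $$ (i,t) else 0)) = (c * E) $$ (a,t)"
        using c E a t by (subst index_mult_mat_sum) auto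
      then show ?thesis using cE a t by simp
    qed
    then have "(\<lambda>i. if i < n then E $$ (i,t) else 0) \<in> fun_space.span B"
      using B(3) by (auto simp: K_def)
    then show ?thesis unfolding fun_space.span_finite[OF fin] by (rule rangeE) (rule exI)
  qed
  then obtain f where f: "\<And>t. t \<in> {..<n} \<Longrightarrow>
      (\<lambda>i. if i < n then E $$ (i,t) else 0) = (\<Sum>v\<in>B. (\<lambda>x. f t v * v x))"
    using bchoice[of "{..<n}" "\<lambda>t u. (\<lambda>i. if i < n then E $$ (i,t) else 0)
      = (\<Sum>v\<in>B. (\<lambda>x. u v * v x))"] by blast
  define w' where "w' = mat q n (\<lambda>(j,t). f t (g j))"
  have w': "w' \<in> carrier_mat q n" by (simp add: w'_def)
  have ww': "w * w' = E"
  proof (rule eq_matI)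
    fix i t assume "i < dim_row E" "t < dim_col E"
    then have it: "i < n" "t < n" using E by auto
    have "E $$ (i,t) = (\<Sum>v\<in>B. (\<lambda>x. f t v * v x)) i"
      using fun_cong[OF f, of t i] it by simp
    also have "\<dots> = (\<Sum>v\<in>B. f t v * v i)" by (simp add: sum_fun_apply)
    also have "\<dots> = (\<Sum>j<q. f t (g j) * g j i)" by (rule sum.reindex_bij_betw[OF g, symmetric])
    also have "\<dots> = (w * w') $$ (i,t)"
      using it w w' by (subst index_mult_mat_sum) (auto simp: w_def w'_def mult.commute)
    finally show "(w * w') $$ (i,t) = E $$ (i,t)" by simp
  qed (use w w' E in auto)
  have cw: "c * w = 0\<^sub>m k q"
  proof (rule eq_matI)
    fix a j assume "a < dim_row (0\<^sub>m k q :: 'a mat)" "j < dim_col (0\<^sub>m k q :: 'a mat)"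
    then have aj: "a < k" "j < q" by auto
    have "(c * w) $$ (a,j) = (\<Sum>i<n. c $$ (a,i) * g j i)"
      using aj c w by (subst index_mult_mat_sum) (auto simp: w_def)
    also have "\<dots> = 0" using gB[OF aj(2)] B(1) aj by (auto simp: K_def)
    finally show "(c * w) $$ (a,j) = 0\<^sub>m k q $$ (a,j)" using aj by simp
  qed (use c w in auto)
  have "w * (w' * b) = E * b" using ww' w w' b by (simp flip: mat_assoc)
  also have "\<dots> = 0\<^sub>m n k" using b c by (simp add: E_def mat_ring cb)
  finally have w'b: "w' * b = 0\<^sub>m q k" using inj[of "w' * b" k] w' b by simp
  have "w * (w' * w - 1\<^sub>m q) = E * w - w"
    using w w' by (simp add: mat_ring ww'[symmetric])
  also have "\<dots> = 0\<^sub>m n q"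
  proof -
    have "E * w = w" using w b c mat_diff_zero[of w] by (simp add: E_def mat_ring cw)
    then show ?thesis using w by simp
  qed
  finally have z: "w' * w - 1\<^sub>m q = 0\<^sub>m q q" by (rule inj[rotated]) (use w w' in \<open>auto intro!: carrier_matI\<close>)
  have "w' * w = 1\<^sub>m q"
  proof (rule eq_matI)
    fix i j assume ij: "i < dim_row (1\<^sub>m q :: 'a mat)" "j < dim_col (1\<^sub>m q :: 'a mat)"
    have "(w' * w - 1\<^sub>m q) $$ (i,j) = 0" using z ij by simp
    then show "(w' * w) $$ (i,j) = 1\<^sub>m q $$ (i,j)" using ij w w' by simp
  qed (use w w' in auto)
  moreover have "b * c + w * w' = 1\<^sub>m n"
    unfolding ww' E_def by (rule eq_matI) (use b c in auto)
  ultimately show ?thesis using that w w' cw w'b by blast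
qed

section \<open>Representations and homomorphisms\<close>

context hopf_alg
begin

text \<open>Only matrix sizes are recorded, so that homomorphisms, sums and tensor products can be
  handled for arbitrary matrix families before any module axiom is checked.\<close>

definition rep :: "nat \<Rightarrow> (nat \<Rightarrow> 'k mat) \<Rightarrow> bool" where
  "rep n \<rho> \<longleftrightarrow> (\<forall>i<d. \<rho> i \<in> carrier_mat n n)"

definition mhom :: "nat \<Rightarrow> (nat \<Rightarrow> 'k mat) \<Rightarrow> nat \<Rightarrow> (nat \<Rightarrow> 'k mat) \<Rightarrow> 'k mat \<Rightarrow> bool" where
  "mhom n \<sigma> m \<tau> P \<longleftrightarrow> P \<in> carrier_mat m n \<and> (\<forall>i<d. P * \<sigma> i = \<tau> i * P)"

abbreviation iso where "iso n \<sigma> m \<tau> \<equiv> iso_mod H n \<sigma> m \<tau>"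

lemma repD: "rep n \<rho> \<Longrightarrow> i < d \<Longrightarrow> dim_row (\<rho> i) = n" "rep n \<rho> \<Longrightarrow> i < d \<Longrightarrow> dim_col (\<rho> i) = n"
  by (auto simp: rep_def)

lemma is_module_rep: "is_module H n \<rho> \<Longrightarrow> rep n \<rho>"
  by (simp add: is_module_def rep_def)

lemma mhom_dim: "mhom n \<sigma> m \<tau> P \<Longrightarrow> dim_row P = m" "mhom n \<sigma> m \<tau> P \<Longrightarrow> dim_col P = n"
  by (auto simp: mhom_def)

lemma mhom_carrier: "mhom n \<sigma> m \<tau> P \<Longrightarrow> P \<in> carrier_mat m n"
  by (simp add: mhom_def)

lemma mhom_comm: "mhom n \<sigma> m \<tau> P \<Longrightarrow> i < d \<Longrightarrow> P * \<sigma> i = \<tau> i * P"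
  by (simp add: mhom_def)

lemma mhom_mult:
  assumes "rep n \<rho>" "rep m \<sigma>" "rep l \<tau>" "mhom n \<rho> m \<sigma> P" "mhom m \<sigma> l \<tau> Q"
  shows "mhom n \<rho> l \<tau> (Q * P)"
  unfolding mhom_def
proof (intro conjI allI impI)
  show "Q * P \<in> carrier_mat l n" using assms by (auto simp: mhom_def)
  fix i assume i: "i < d"
  have "Q * P * \<rho> i = Q * (\<sigma> i * P)"
    using assms i by (simp add: mat_assoc repD mhom_dim mhom_comm)
  also have "\<dots> = \<tau> i * Q * P"
    using assms i by (simp add: repD mhom_dim mhom_comm flip: mat_assoc)
  also have "\<dots> = \<tau> i * (Q * P)" using assms i by (simp add: mat_assoc repD mhom_dim)
  finally show "Q * P * \<rho> i = \<tau> i * (Q * P)" .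
qed

lemma mhom_add:
  assumes "rep n \<rho>" "rep m \<sigma>" "mhom n \<rho> m \<sigma> P" "mhom n \<rho> m \<sigma> Q"
  shows "mhom n \<rho> m \<sigma> (P + Q)"
  using assms by (auto simp: mhom_def mat_distrib_left mat_distrib_right repD)

lemma mhom_diff:
  assumes "rep n \<rho>" "rep m \<sigma>" "mhom n \<rho> m \<sigma> P" "mhom n \<rho> m \<sigma> Q"
  shows "mhom n \<rho> m \<sigma> (P - Q)"
  using assms by (auto simp: mhom_def mat_distrib_left_minus mat_distrib_right_minus repD
      intro!: carrier_matI)

lemma mhom_one: "rep n \<rho> \<Longrightarrow> mhom n \<rho> n \<rho> (1\<^sub>m n)"
  by (auto simp: mhom_def rep_def)

lemma mhom_zero: "rep n \<rho> \<Longrightarrow> rep m \<sigma> \<Longrightarrow> mhom n \<rho> m \<sigma> (0\<^sub>m m n)"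
  unfolding mhom_def rep_def by (metis left_mult_zero_mat right_mult_zero_mat zero_carrier_mat)

lemma isoI:
  assumes r: "rep n \<sigma>" "rep m \<tau>" and P: "mhom n \<sigma> m \<tau> P" and Q: "Q \<in> carrier_mat n m"
    and PQ: "P * Q = 1\<^sub>m m" and nm: "n = m"
  shows "iso n \<sigma> m \<tau>"
proof -
  have "Q * P = 1\<^sub>m n"
    using mat_mult_left_right_inverse[of P n Q] PQ P Q nm by (auto simp: mhom_def)
  then have "invertible_mat P"
    using PQ P Q nm unfolding invertible_mat_def inverts_mat_def by (auto simp: mhom_def)
  then show ?thesis using P nm unfolding iso_mod_def mhom_def by auto
qed

lemma isoI':
  assumes r: "rep n \<sigma>" "rep m \<tau>" and P: "mhom n \<sigma> m \<tau> P" and Q: "Q \<in> carrier_mat n m"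
    and PQ: "P * Q = 1\<^sub>m m" and QP: "Q * P = 1\<^sub>m n"
  shows "iso n \<sigma> m \<tau>"
  using isoI[OF assms(1-5)] inverse_mats_dim_eq[of Q n m P] P Q PQ QP by (auto simp: mhom_def)

lemma mhom_inverse:
  assumes P: "mhom n \<sigma> m \<tau> P" and Q: "Q \<in> carrier_mat n m" and PQ: "P * Q = 1\<^sub>m m" and QP: "Q * P = 1\<^sub>m n"
    and r: "rep n \<sigma>" "rep m \<tau>"
  shows "mhom m \<tau> n \<sigma> Q"
  unfolding mhom_def
proof (intro conjI allI impI Q)
  fix i assume i: "i < d"
  note D = mhom_dim[OF P] carrier_matD[OF Q] repD[OF r(1) i] repD[OF r(2) i]
  have "Q * \<tau> i = Q * (\<tau> i * P) * Q" using D PQ by (simp add: mat_assoc)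
  also have "\<dots> = Q * P * (\<sigma> i * Q)" using D by (simp add: mat_assoc flip: mhom_comm[OF P i])
  finally show "Q * \<tau> i = \<sigma> i * Q" using D QP by simp
qed

lemma isoE:
  assumes "iso n \<sigma> m \<tau>" "rep n \<sigma>" "rep m \<tau>"
  obtains P Q where "mhom n \<sigma> m \<tau> P" "mhom m \<tau> n \<sigma> Q" "P * Q = 1\<^sub>m m" "Q * P = 1\<^sub>m n" "n = m"
proof -
  obtain P where nm: "n = m" and P: "P \<in> carrier_mat n n" "invertible_mat P"
    and c: "\<forall>i<d. P * \<sigma> i = \<tau> i * P" using assms(1) unfolding iso_mod_def by auto
  obtain Q where Q: "P * Q = 1\<^sub>m n" "Q * P = 1\<^sub>m (dim_row Q)"
    using P unfolding invertible_mat_def inverts_mat_def by auto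
  have "dim_row Q = n" using P(1) Q(2) by (metis carrier_matD(2) index_mult_mat(3) index_one_mat(3))
  moreover have "dim_col Q = n" using Q(1) by (metis index_mult_mat(3) index_one_mat(3))
  ultimately have Qc: "Q \<in> carrier_mat n n" by (auto intro: carrier_matI)
  have P': "mhom n \<sigma> m \<tau> P" using P nm c by (simp add: mhom_def)
  have PQ: "P * Q = 1\<^sub>m m" and QP: "Q * P = 1\<^sub>m n" using Q Qc nm by auto
  have "mhom m \<tau> n \<sigma> Q" using Qc nm by (intro mhom_inverse[OF P' _ PQ QP assms(2,3)]) simp
  then show ?thesis using that P' PQ QP nm by blast
qed

lemma iso_refl: "rep n \<rho> \<Longrightarrow> iso n \<rho> n \<rho>"
  by (rule isoI'[OF _ _ mhom_one, of n \<rho> "1\<^sub>m n"]) auto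

lemma iso_sym: "iso n \<sigma> m \<tau> \<Longrightarrow> rep n \<sigma> \<Longrightarrow> rep m \<tau> \<Longrightarrow> iso m \<tau> n \<sigma>"
  by (erule isoE, assumption, assumption) (rule isoI', auto simp: mhom_def)

lemma iso_trans:
  assumes "iso n \<rho> m \<sigma>" "iso m \<sigma> l \<tau>" and r: "rep n \<rho>" "rep m \<sigma>" "rep l \<tau>"
  shows "iso n \<rho> l \<tau>"
proof -
  obtain P Q where 1: "mhom n \<rho> m \<sigma> P" "mhom m \<sigma> n \<rho> Q" "P * Q = 1\<^sub>m m" "n = m"
    using isoE[OF assms(1)] r by metis
  obtain P' Q' where 2: "mhom m \<sigma> l \<tau> P'" "mhom l \<tau> m \<sigma> Q'" "P' * Q' = 1\<^sub>m l" "m = l"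
    using isoE[OF assms(2)] r by metis
  show ?thesis
  proof (rule isoI[of _ _ _ _ "P' * P" "Q * Q'"])
    show "P' * P * (Q * Q') = 1\<^sub>m l"
      using 1 2 by (simp add: mat_assoc mhom_dim mat_cancel_mid[OF 1(3)])
  qed (use 1 2 r mhom_mult in \<open>auto simp: mhom_def\<close>)
qed

lemma iso_cong: "iso n \<sigma> m \<tau> \<Longrightarrow> (\<And>i. i < d \<Longrightarrow> \<sigma> i = \<sigma>' i) \<Longrightarrow> (\<And>i. i < d \<Longrightarrow> \<tau> i = \<tau>' i) \<Longrightarrow> iso n \<sigma>' m \<tau>'"
  unfolding iso_mod_def by metis

lemma iso_eqI:
  assumes "rep n \<sigma>" "n = m" "\<And>i. i < d \<Longrightarrow> \<sigma> i = \<tau> i"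
  shows "iso n \<sigma> m \<tau>"
  using iso_cong[OF iso_refl[OF assms(1)], of \<sigma> \<tau>] assms by simp

section \<open>Biproduct maps of block sums\<close>

definition inj1 :: "nat \<Rightarrow> nat \<Rightarrow> 'k mat" where
  "inj1 n m = mat (n + m) n (\<lambda>(i,j). if i = j then 1 else 0)"
definition inj2 :: "nat \<Rightarrow> nat \<Rightarrow> 'k mat" where
  "inj2 n m = mat (n + m) m (\<lambda>(i,j). if i = n + j then 1 else 0)"
definition prj1 :: "nat \<Rightarrow> nat \<Rightarrow> 'k mat" where
  "prj1 n m = mat n (n + m) (\<lambda>(i,j). if i = j then 1 else 0)"
definition prj2 :: "nat \<Rightarrow> nat \<Rightarrow> 'k mat" where
  "prj2 n m = mat m (n + m) (\<lambda>(i,j). if j = n + i then 1 else 0)"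

lemma dsum_rep: "rep n \<sigma> \<Longrightarrow> rep m \<tau> \<Longrightarrow> rep (n + m) (dsum_mod n \<sigma> m \<tau>)"
  unfolding rep_def dsum_mod_def by (auto intro!: four_block_carrier_mat)

lemma sum_if_delta: "(\<Sum>k<n. (if k = a then 1 else 0) * f k) = (if a < n then f a else (0::'k))"
  "(\<Sum>k<n. (if a = k then 1 else 0) * f k) = (if a < n then f a else (0::'k))"
  "(\<Sum>k<n. f k * (if k = a then 1 else 0)) = (if a < n then f a else (0::'k))"
  "(\<Sum>k<n. f k * (if a = k then 1 else 0)) = (if a < n then f a else (0::'k))"
  for n a :: nat
  by (simp_all add: if_distrib[of "\<lambda>x. x * _"] if_distrib[of "(*) _"] sum.delta sum.delta' cong: if_cong)

lemma sum_if_delta_shift: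
  "(\<Sum>k<m. (if i = n + k then 1 else 0) * f k) = (if n \<le> i \<and> i < n + m then f (i - n) else (0::'k))"
  "(\<Sum>k<m. f k * (if i = n + k then 1 else 0)) = (if n \<le> i \<and> i < n + m then f (i - n) else (0::'k))"
  for n m i :: nat
proof -
  have "(\<Sum>k<m. (if i = n + k then 1 else 0) * f k) = (\<Sum>k<m. if k = i - n \<and> n \<le> i then f k else 0)"
    by (intro sum.cong) auto
  then show "(\<Sum>k<m. (if i = n + k then 1 else 0) * f k) = (if n \<le> i \<and> i < n + m then f (i - n) else 0)"
    by (auto split: if_splits simp: sum.delta cong: conj_cong)
  then show "(\<Sum>k<m. f k * (if i = n + k then 1 else 0)) = (if n \<le> i \<and> i < n + m then f (i - n) else 0)"
    by (simp add: mult.commute)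
qed

lemma biprod_inj_prj:
  "prj1 n m * inj1 n m = 1\<^sub>m n" "prj2 n m * inj2 n m = 1\<^sub>m m"
  "prj1 n m * inj2 n m = 0\<^sub>m n m" "prj2 n m * inj1 n m = 0\<^sub>m m n"
  "inj1 n m * prj1 n m + inj2 n m * prj2 n m = 1\<^sub>m (n + m)"
proof -
  show "prj1 n m * inj1 n m = 1\<^sub>m n" "prj2 n m * inj2 n m = 1\<^sub>m m"
  "prj1 n m * inj2 n m = 0\<^sub>m n m" "prj2 n m * inj1 n m = 0\<^sub>m m n"
    by (rule eq_matI; (subst index_mult_mat_sum)?; auto simp: prj1_def prj2_def inj1_def inj2_def sum_if_delta)+
  show "inj1 n m * prj1 n m + inj2 n m * prj2 n m = 1\<^sub>m (n + m)"
  proof (rule eq_matI)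
    fix i j assume "i < dim_row (1\<^sub>m (n + m) :: 'k mat)" "j < dim_col (1\<^sub>m (n + m) :: 'k mat)"
    then have ij: "i < n + m" "j < n + m" by auto
    have 1: "(inj1 n m * prj1 n m) $$ (i,j) = (if i = j \<and> i < n then 1 else 0)"
      using ij by (subst index_mult_mat_sum) (auto simp: prj1_def inj1_def sum_if_delta)
    have "(inj2 n m * prj2 n m) $$ (i,j)
        = (\<Sum>k<m. (if i = n + k then 1 else 0) * (if j = n + k then 1 else 0))"
      using ij by (subst index_mult_mat_sum) (auto simp: prj2_def inj2_def)
    also have "\<dots> = (\<Sum>k<m. if k = i - n then (if i = j \<and> n \<le> i then 1 else 0) else 0)"
      by (intro sum.cong refl) auto
    also have "\<dots> = (if i = j \<and> n \<le> i then 1 else 0)" using ij by auto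
    finally have 2: "(inj2 n m * prj2 n m) $$ (i,j) = (if i = j \<and> n \<le> i then 1 else 0)" .
    show "(inj1 n m * prj1 n m + inj2 n m * prj2 n m) $$ (i,j) = 1\<^sub>m (n + m) $$ (i,j)"
      using ij 1 2 by (auto simp: prj1_def prj2_def inj1_def inj2_def)
  qed (auto simp: prj1_def prj2_def inj1_def inj2_def)
qed

lemma biprod_mhom:
  assumes "rep n \<sigma>" "rep m \<tau>"
  shows "mhom n \<sigma> (n + m) (dsum_mod n \<sigma> m \<tau>) (inj1 n m)"
    "mhom m \<tau> (n + m) (dsum_mod n \<sigma> m \<tau>) (inj2 n m)"
    "mhom (n + m) (dsum_mod n \<sigma> m \<tau>) n \<sigma> (prj1 n m)"
    "mhom (n + m) (dsum_mod n \<sigma> m \<tau>) m \<tau> (prj2 n m)"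
proof -
  have z: "mhom n \<sigma> (n + m) (dsum_mod n \<sigma> m \<tau>) (inj1 n m) \<and>
    mhom m \<tau> (n + m) (dsum_mod n \<sigma> m \<tau>) (inj2 n m) \<and>
    mhom (n + m) (dsum_mod n \<sigma> m \<tau>) n \<sigma> (prj1 n m) \<and>
    mhom (n + m) (dsum_mod n \<sigma> m \<tau>) m \<tau> (prj2 n m)"
    unfolding mhom_def
  proof (intro conjI allI impI)
    fix i assume i: "i < d"
    have c: "\<sigma> i \<in> carrier_mat n n" "\<tau> i \<in> carrier_mat m m" using assms i by (auto simp: rep_def)
    show "inj1 n m * \<sigma> i = dsum_mod n \<sigma> m \<tau> i * inj1 n m"
     by (rule eq_matI; (subst (1 2) index_mult_mat_sum)?)
      (use c in \<open>auto simp: inj1_def dsum_mod_def sum_if_delta\<close>)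
    show "inj2 n m * \<tau> i = dsum_mod n \<sigma> m \<tau> i * inj2 n m"
     by (rule eq_matI; (subst (1 2) index_mult_mat_sum)?)
      (use c in \<open>auto simp: inj2_def dsum_mod_def sum_if_delta sum_if_delta_shift\<close>)
    show "prj1 n m * dsum_mod n \<sigma> m \<tau> i = \<sigma> i * prj1 n m"
     by (rule eq_matI; (subst (1 2) index_mult_mat_sum)?)
      (use c in \<open>auto simp: prj1_def dsum_mod_def sum_if_delta\<close>)
    show "prj2 n m * dsum_mod n \<sigma> m \<tau> i = \<tau> i * prj2 n m"
     by (rule eq_matI; (subst (1 2) index_mult_mat_sum)?)
      (use c in \<open>auto simp: prj2_def dsum_mod_def sum_if_delta sum_if_delta_shift\<close>)
  qed (auto simp: prj1_def prj2_def inj1_def inj2_def)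
  then show "mhom n \<sigma> (n + m) (dsum_mod n \<sigma> m \<tau>) (inj1 n m)"
    "mhom m \<tau> (n + m) (dsum_mod n \<sigma> m \<tau>) (inj2 n m)"
    "mhom (n + m) (dsum_mod n \<sigma> m \<tau>) n \<sigma> (prj1 n m)"
    "mhom (n + m) (dsum_mod n \<sigma> m \<tau>) m \<tau> (prj2 n m)" by auto
qed

end

text \<open>The premises speak of dimensions, which the simplifier can compute, and not of
  membership in \<open>carrier_mat\<close>.\<close>

lemma mat_zero_one [simp]:
  "dim_row A = n \<Longrightarrow> dim_col A = m \<Longrightarrow> 0\<^sub>m n m + A = A"
  "dim_row A = n \<Longrightarrow> dim_col A = m \<Longrightarrow> A + 0\<^sub>m n m = A"
  "dim_row A = n \<Longrightarrow> dim_col A = m \<Longrightarrow> A - 0\<^sub>m n m = A"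
  "dim_row A = n \<Longrightarrow> 0\<^sub>m l n * A = 0\<^sub>m l (dim_col A)"
  "dim_col A = m \<Longrightarrow> A * 0\<^sub>m m l = 0\<^sub>m (dim_row A) l"
  "dim_row A = n \<Longrightarrow> 1\<^sub>m n * A = A"
  "dim_col A = m \<Longrightarrow> A * 1\<^sub>m m = A"
  for A :: "'a::ring_1 mat"
  by (rule eq_matI; simp add: scalar_prod_def)+ 

context hopf_alg
begin

lemma biprod_dims [simp]:
  "dim_row (inj1 n m) = n + m" "dim_col (inj1 n m) = n"
  "dim_row (inj2 n m) = n + m" "dim_col (inj2 n m) = m"
  "dim_row (prj1 n m) = n" "dim_col (prj1 n m) = n + m"
  "dim_row (prj2 n m) = m" "dim_col (prj2 n m) = n + m"
  by (auto simp: inj1_def inj2_def prj1_def prj2_def)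

text \<open>The map with components \<open>c\<close>, \<open>w'\<close> and the map with components
  \<open>b\<close>, \<open>w\<close> are mutually inverse. Direct sum decompositions are afterwards
  obtained by exhibiting these four maps.\<close>

lemma biprod_iso:
  assumes r: "rep n \<rho>" "rep k \<sigma>" "rep q \<tau>"
    and b: "mhom k \<sigma> n \<rho> b" and c: "mhom n \<rho> k \<sigma> c"
    and w: "mhom q \<tau> n \<rho> w" and w': "mhom n \<rho> q \<tau> w'"
    and cb: "c * b = 1\<^sub>m k" and ww: "w' * w = 1\<^sub>m q" and cw: "c * w = 0\<^sub>m k q"
    and wb: "w' * b = 0\<^sub>m q k" and sum: "b * c + w * w' = 1\<^sub>m n"
  shows "iso n \<rho> (k + q) (dsum_mod k \<sigma> q \<tau>)"
proof -
  note D = mhom_dim[OF b] mhom_dim[OF c] mhom_dim[OF w] mhom_dim[OF w']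
  note rd = dsum_rep[OF r(2,3)]
  note bh = biprod_mhom[OF r(2,3)]
  note bp = biprod_inj_prj[of k q]
  define P where "P = inj1 k q * c + inj2 k q * w'"
  define Q where "Q = b * prj1 k q + w * prj2 k q"
  have P: "mhom n \<rho> (k + q) (dsum_mod k \<sigma> q \<tau>) P"
    unfolding P_def by (intro mhom_add r rd mhom_mult[OF _ _ _ c] mhom_mult[OF _ _ _ w'] bh)
  have Q: "mhom (k + q) (dsum_mod k \<sigma> q \<tau>) n \<rho> Q"
    unfolding Q_def by (intro mhom_add r rd mhom_mult[OF _ _ _ _ b] mhom_mult[OF _ _ _ _ w] bh)
  have "P * Q = inj1 k q * prj1 k q + inj2 k q * prj2 k q"
    unfolding P_def Q_def using D
    by (simp add: mat_ring mat_cancel_mid[OF cb] mat_cancel_mid[OF ww] mat_cancel_mid[OF cw] mat_cancel_mid[OF wb])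
  then have PQ: "P * Q = 1\<^sub>m (k + q)" using bp by simp
  have "Q * P = b * c + w * w'"
    unfolding P_def Q_def using D
    by (simp add: mat_ring mat_cancel_mid[OF bp(1)] mat_cancel_mid[OF bp(2)]
        mat_cancel_mid[OF bp(3)] mat_cancel_mid[OF bp(4)])
  then have QP: "Q * P = 1\<^sub>m n" using sum by simp
  show ?thesis by (rule isoI'[OF r(1) rd P mhom_carrier[OF Q] PQ QP])
qed

lemma dsum_iso_cong:
  assumes "iso n \<rho> n' \<rho>'" "iso m \<sigma> m' \<sigma>'" and r: "rep n \<rho>" "rep n' \<rho>'" "rep m \<sigma>" "rep m' \<sigma>'"
  shows "iso (n + m) (dsum_mod n \<rho> m \<sigma>) (n' + m') (dsum_mod n' \<rho>' m' \<sigma>')"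
proof -
  obtain P Q where 1: "mhom n \<rho> n' \<rho>' P" "mhom n' \<rho>' n \<rho> Q" "P * Q = 1\<^sub>m n'" "Q * P = 1\<^sub>m n"
    using isoE[OF assms(1)] r by metis
  obtain P' Q' where 2: "mhom m \<sigma> m' \<sigma>' P'" "mhom m' \<sigma>' m \<sigma> Q'" "P' * Q' = 1\<^sub>m m'" "Q' * P' = 1\<^sub>m m"
    using isoE[OF assms(2)] r by metis
  note D = mhom_dim[OF 1(1)] mhom_dim[OF 1(2)] mhom_dim[OF 2(1)] mhom_dim[OF 2(2)]
  note rd = dsum_rep[OF r(1,3)]
  note bh = biprod_mhom[OF r(1,3)]
  note bp = biprod_inj_prj[of n m]
  show ?thesis
  proof (rule biprod_iso[where b = "inj1 n m * Q" and c = "P * prj1 n m"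
        and w = "inj2 n m * Q'" and w' = "P' * prj2 n m"])
    show "P * prj1 n m * (inj1 n m * Q) = 1\<^sub>m n'"
      using D 1 by (simp add: mat_assoc mat_cancel_mid[OF bp(1)])
    show "P' * prj2 n m * (inj2 n m * Q') = 1\<^sub>m m'"
      using D 2 by (simp add: mat_assoc mat_cancel_mid[OF bp(2)])
    show "P * prj1 n m * (inj2 n m * Q') = 0\<^sub>m n' m'"
      using D by (simp add: mat_assoc mat_cancel_mid[OF bp(3)])
    show "P' * prj2 n m * (inj1 n m * Q) = 0\<^sub>m m' n'"
      using D by (simp add: mat_assoc mat_cancel_mid[OF bp(4)])
    show "inj1 n m * Q * (P * prj1 n m) + inj2 n m * Q' * (P' * prj2 n m) = 1\<^sub>m (n + m)"
      using D bp(5) by (simp add: mat_assoc mat_cancel_mid[OF 1(4)] mat_cancel_mid[OF 2(4)])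
  qed (rule rd r mhom_mult[OF _ _ _ 1(2)] mhom_mult[OF _ _ _ _ 1(1)] mhom_mult[OF _ _ _ 2(2)]
     mhom_mult[OF _ _ _ _ 2(1)] bh)+
qed

lemma dsum_comm:
  assumes r: "rep n \<rho>" "rep m \<sigma>"
  shows "iso (n + m) (dsum_mod n \<rho> m \<sigma>) (m + n) (dsum_mod m \<sigma> n \<rho>)"
proof (rule biprod_iso[where b = "inj2 n m" and c = "prj2 n m" and w = "inj1 n m" and w' = "prj1 n m"])
  have "inj2 n m * prj2 n m + inj1 n m * prj1 n m = inj1 n m * prj1 n m + inj2 n m * prj2 n m"
    by (rule comm_add_mat[of _ "n + m" "n + m"]) (auto intro!: carrier_matI)
  then show "inj2 n m * prj2 n m + inj1 n m * prj1 n m = 1\<^sub>m (n + m)"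
    by (simp add: biprod_inj_prj)
qed (rule biprod_inj_prj biprod_mhom dsum_rep r)+

text \<open>Both bracketings place the same blocks along the diagonal, hence equality and not merely
  isomorphism.\<close>

lemma dsum_assoc:
  assumes r: "rep a \<rho>" "rep b \<sigma>" "rep c \<tau>" and i: "i < d"
  shows "dsum_mod (a + b) (dsum_mod a \<rho> b \<sigma>) c \<tau> i = dsum_mod a \<rho> (b + c) (dsum_mod b \<sigma> c \<tau>) i"
  by (rule eq_matI) (use repD[OF r(1) i] repD[OF r(2) i] repD[OF r(3) i] in \<open>auto simp: dsum_mod_def\<close>)

section \<open>Splitting off and cancelling direct summands\<close>

lemma lincomb_conj:
  assumes A: "A \<in> carrier_mat q n" and B: "B \<in> carrier_mat n q" and r: "rep n \<rho>"
  shows "A * lincomb d n \<rho> x * B = lincomb d q (\<lambda>s. A * \<rho> s * B) x"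
proof (rule eq_matI)
  fix a b assume "a < dim_row (lincomb d q (\<lambda>s. A * \<rho> s * B) x)" "b < dim_col (lincomb d q (\<lambda>s. A * \<rho> s * B) x)"
  then have ab: "a < q" "b < q" by (auto simp: lincomb_def)
  have *: "(A * M * B) $$ (a,b) = (\<Sum>v<n. \<Sum>u<n. A $$ (a,u) * M $$ (u,v) * B $$ (v,b))"
    if "M \<in> carrier_mat n n" for M
  proof -
    have "(A * M) $$ (a,v) = (\<Sum>u<n. A $$ (a,u) * M $$ (u,v))" if "v < n" for v
      using that \<open>M \<in> _\<close> A ab by (subst index_mult_mat_sum) auto
    moreover have "(A * M * B) $$ (a,b) = (\<Sum>v<n. (A * M) $$ (a,v) * B $$ (v,b))"
      using that A B ab by (subst index_mult_mat_sum) auto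
    ultimately have "(A * M * B) $$ (a,b) = (\<Sum>v<n. (\<Sum>u<n. A $$ (a,u) * M $$ (u,v)) * B $$ (v,b))"
      by simp
    then show ?thesis by (simp add: sum_distrib_right)
  qed
  have "(A * lincomb d n \<rho> x * B) $$ (a,b)
      = (\<Sum>v<n. \<Sum>u<n. \<Sum>s<d. x s * (A $$ (a,u) * \<rho> s $$ (u,v) * B $$ (v,b)))"
    by (subst *) (auto simp: lincomb_def sum_distrib_left sum_distrib_right ac_simps)
  also have "\<dots> = (\<Sum>s<d. \<Sum>v<n. \<Sum>u<n. x s * (A $$ (a,u) * \<rho> s $$ (u,v) * B $$ (v,b)))"
    by (rule sum_rotate[symmetric])
  also have "\<dots> = (\<Sum>s<d. x s * (A * \<rho> s * B) $$ (a,b))"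
    using r by (intro sum.cong refl) (subst *, auto simp: rep_def sum_distrib_left)
  finally show "(A * lincomb d n \<rho> x * B) $$ (a,b) = lincomb d q (\<lambda>s. A * \<rho> s * B) x $$ (a,b)"
    using ab by (simp add: lincomb_def)
qed (use A B in \<open>auto simp: lincomb_def\<close>)

text \<open>The image of \<open>w\<close> is the kernel of the homomorphism \<open>c\<close>, hence
  a submodule, and the complement carries the compressed action \<open>w' * \<rho> i * w\<close>.
  The module laws survive the compression because \<open>w\<close> and \<open>w'\<close> intertwine
  the two actions.\<close>

lemma split_iso:
  assumes V: "is_module H n \<rho>" and U: "rep k \<sigma>"
    and b: "mhom k \<sigma> n \<rho> b" and c: "mhom n \<rho> k \<sigma> c" and cb: "c * b = 1\<^sub>m k"
  obtains q \<tau> where "is_module H q \<tau>" "iso n \<rho> (k + q) (dsum_mod k \<sigma> q \<tau>)" "n = k + q"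
proof -
  note r = is_module_rep[OF V]
  obtain q w w' where ww: "w \<in> carrier_mat n q" "w' \<in> carrier_mat q n"
    "c * w = 0\<^sub>m k q" "w' * b = 0\<^sub>m q k" "w' * w = 1\<^sub>m q" "b * c + w * w' = 1\<^sub>m n"
    by (rule split_complement[OF mhom_carrier[OF b] mhom_carrier[OF c] cb])
  note D = mhom_dim[OF b] mhom_dim[OF c] carrier_matD[OF ww(1)] carrier_matD[OF ww(2)]
  define \<tau> where "\<tau> i = w' * \<rho> i * w" for i
  have rt: "rep q \<tau>" using r ww(1,2) by (auto simp: rep_def \<tau>_def)
  have wtau: "w * \<tau> i = \<rho> i * w" if i: "i < d" for i
  proof -
    have "\<rho> i * w = (b * c + w * w') * (\<rho> i * w)" using D ww(6) repD[OF r i] by simp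
    also have "\<dots> = b * (c * (\<rho> i * w)) + w * \<tau> i"
      using D repD[OF r i] by (simp add: mat_ring \<tau>_def)
    also have "c * (\<rho> i * w) = \<sigma> i * (c * w)"
      using D repD[OF r i] repD[OF U i] mhom_comm[OF c i] by (simp flip: mat_assoc)
    also have "\<dots> = 0\<^sub>m k q" using U i ww(3) by (auto simp: rep_def)
    also have "b * 0\<^sub>m k q + w * \<tau> i = w * \<tau> i"
      using D repD[OF rt i] by simp
    finally show ?thesis by simp
  qed
  have tauw: "\<tau> i * w' = w' * \<rho> i" if i: "i < d" for i
  proof -
    have "w' * \<rho> i = (w' * \<rho> i) * (b * c + w * w')" using D ww(6) repD[OF r i] by simp
    also have "\<dots> = w' * (\<rho> i * b) * c + \<tau> i * w'"
      using D repD[OF r i] by (simp add: mat_ring \<tau>_def)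
    also have "w' * (\<rho> i * b) = (w' * b) * \<sigma> i"
      using D repD[OF r i] repD[OF U i] mhom_comm[OF b i] by (simp add: mat_assoc)
    also have "\<dots> = 0\<^sub>m q k" using U i ww(4) by (auto simp: rep_def)
    also have "0\<^sub>m q k * c + \<tau> i * w' = \<tau> i * w'"
      using D repD[OF rt i] by simp
    finally show ?thesis by simp
  qed
  have w: "mhom q \<tau> n \<rho> w" using ww wtau by (simp add: mhom_def)
  have w': "mhom n \<rho> q \<tau> w'" using ww tauw by (simp add: mhom_def)
  have "is_module H q \<tau>"
    unfolding is_module_def
  proof (intro conjI allI impI)
    show "i < d \<Longrightarrow> \<tau> i \<in> carrier_mat q q" for i using rt by (simp add: rep_def)
    have lin: "lincomb d q \<tau> x = w' * lincomb d n \<rho> x * w" for x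
      using lincomb_conj[OF ww(2,1) r] by (simp add: \<tau>_def[abs_def])
    fix i j assume ij: "i < d" "j < d"
    have "\<tau> i * \<tau> j = w' * (\<rho> i * (w * \<tau> j))"
      using D repD[OF r ij(1)] repD[OF rt ij(2)] by (simp add: \<tau>_def[of i] mat_assoc)
    also have "\<dots> = w' * (\<rho> i * \<rho> j) * w"
      using D repD[OF r ij(1)] repD[OF r ij(2)] wtau[OF ij(2)] by (simp add: mat_assoc)
    also have "\<rho> i * \<rho> j = lincomb d n \<rho> (hmul H i j)" using V ij by (simp add: is_module_def)
    finally show "\<tau> i * \<tau> j = lincomb d q \<tau> (hmul H i j)" by (simp add: lin)
  next
    have lin: "lincomb d q \<tau> x = w' * lincomb d n \<rho> x * w" for x
      using lincomb_conj[OF ww(2,1) r] by (simp add: \<tau>_def[abs_def])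
    have "lincomb d n \<rho> (hunit H) = 1\<^sub>m n" using V by (simp add: is_module_def)
    then show "lincomb d q \<tau> (hunit H) = 1\<^sub>m q" using D ww(5) by (simp add: lin)
  qed
  moreover have iso: "iso n \<rho> (k + q) (dsum_mod k \<sigma> q \<tau>)"
    by (rule biprod_iso[OF r U rt b c w w' cb ww(5,3,4,6)])
  moreover have "n = k + q" using iso by (simp add: iso_mod_def)
  ultimately show ?thesis using that by blast
qed

definition munit :: "nat \<Rightarrow> (nat \<Rightarrow> 'k mat) \<Rightarrow> 'k mat \<Rightarrow> bool" where
  "munit k \<sigma> f \<longleftrightarrow> mhom k \<sigma> k \<sigma> f \<and> (\<exists>g. mhom k \<sigma> k \<sigma> g \<and> f * g = 1\<^sub>m k \<and> g * f = 1\<^sub>m k)"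

text \<open>Locality of the endomorphism ring in the form that the exchange argument consumes: two
  endomorphisms with sum 1 are not both non-units.\<close>

definition local_end :: "nat \<Rightarrow> (nat \<Rightarrow> 'k mat) \<Rightarrow> bool" where
  "local_end k \<sigma> \<longleftrightarrow> rep k \<sigma> \<and> (\<forall>f g. mhom k \<sigma> k \<sigma> f \<longrightarrow> mhom k \<sigma> k \<sigma> g \<longrightarrow>
     f + g = 1\<^sub>m k \<longrightarrow> munit k \<sigma> f \<or> munit k \<sigma> g)"

text \<open>Composing with a transvection makes the lower right block of the isomorphism invertible, and then its
  Schur complement is an isomorphism between the remaining summands.\<close>

lemma dsum_cancel:
  assumes loc: "local_end k \<kappa>" and r: "rep n \<sigma>" "rep m \<tau>"
    and iso: "iso (n + k) (dsum_mod n \<sigma> k \<kappa>) (m + k) (dsum_mod m \<tau> k \<kappa>)"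
  shows "iso n \<sigma> m \<tau>"
proof -
  have rk: "rep k \<kappa>" using loc by (simp add: local_end_def)
  note rd1 = dsum_rep[OF r(1) rk] and rd2 = dsum_rep[OF r(2) rk]
  obtain F G where F: "mhom (n + k) (dsum_mod n \<sigma> k \<kappa>) (m + k) (dsum_mod m \<tau> k \<kappa>) F"
    and G: "mhom (m + k) (dsum_mod m \<tau> k \<kappa>) (n + k) (dsum_mod n \<sigma> k \<kappa>) G"
    and FG: "F * G = 1\<^sub>m (m + k)" and GF: "G * F = 1\<^sub>m (n + k)" and nm: "n + k = m + k"
    using isoE[OF iso rd1 rd2] by blast
  note bp = biprod_inj_prj[of n k] and bq = biprod_inj_prj[of m k]
  note bh = biprod_mhom[OF r(1) rk] and ch = biprod_mhom[OF r(2) rk]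
  \<comment> \<open>\<open>c\<close>, \<open>d0\<close> form the lower row of blocks of
    \<open>F\<close>, and \<open>b'\<close>, \<open>d'\<close> the right column of blocks of
    \<open>G\<close>; row times column is the lower right block of \<open>F * G = 1\<close>.\<close>
  define c where "c = prj2 m k * F * inj1 n k"
  define d0 where "d0 = prj2 m k * F * inj2 n k"
  define b' where "b' = prj1 n k * G * inj2 m k"
  define d' where "d' = prj2 n k * G * inj2 m k"
  have c: "mhom n \<sigma> k \<kappa> c" unfolding c_def
    by (rule mhom_mult[OF _ _ _ bh(1) mhom_mult[OF _ _ _ F ch(4)]]) (rule r rk rd1 rd2)+
  have d0: "mhom k \<kappa> k \<kappa> d0" unfolding d0_def
    by (rule mhom_mult[OF _ _ _ bh(2) mhom_mult[OF _ _ _ F ch(4)]]) (rule r rk rd1 rd2)+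
  have b': "mhom k \<kappa> n \<sigma> b'" unfolding b'_def
    by (rule mhom_mult[OF _ _ _ ch(2) mhom_mult[OF _ _ _ G bh(3)]]) (rule r rk rd1 rd2)+
  have d': "mhom k \<kappa> k \<kappa> d'" unfolding d'_def
    by (rule mhom_mult[OF _ _ _ ch(2) mhom_mult[OF _ _ _ G bh(4)]]) (rule r rk rd1 rd2)+
  note D = mhom_dim[OF F] mhom_dim[OF G] mhom_dim[OF c] mhom_dim[OF d0] mhom_dim[OF b'] mhom_dim[OF d']
  have "c * b' + d0 * d' = prj2 m k * F * (inj1 n k * prj1 n k + inj2 n k * prj2 n k) * G * inj2 m k"
    using D unfolding c_def d0_def b'_def d'_def by (simp add: mat_ring)
  also have "\<dots> = prj2 m k * (F * G) * inj2 m k" using D bp(5) by (simp add: mat_assoc)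
  also have "\<dots> = 1\<^sub>m k" by (simp add: FG bq(2))
  finally have "c * b' + d0 * d' = 1\<^sub>m k" .
  then have "munit k \<kappa> (c * b') \<or> munit k \<kappa> (d0 * d')"
    using loc mhom_mult[OF rk r(1) rk b' c] mhom_mult[OF rk rk rk d' d0] unfolding local_end_def by blast
  \<comment> \<open>Adding the first block column of \<open>F\<close>, multiplied by
    \<open>h\<close>, to the second one replaces the lower right block by
    \<open>d0 + c * h\<close>.\<close>
  then have "\<exists>h. mhom k \<kappa> n \<sigma> h \<and> munit k \<kappa> (d0 + c * h)"
  proof
    assume "munit k \<kappa> (c * b')"
    then obtain g where g: "mhom k \<kappa> k \<kappa> g" "c * b' * g = 1\<^sub>m k" unfolding munit_def by blast
    note D = D mhom_dim[OF g(1)]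
    \<comment> \<open>Chosen to give \<open>c * h = 1 - d0\<close>, so that the new block is the
      identity.\<close>
    define h where "h = b' * (g * (1\<^sub>m k - d0))"
    have "mhom k \<kappa> n \<sigma> h" unfolding h_def
      by (intro mhom_mult[OF _ _ _ _ b'] mhom_mult[OF _ _ _ _ g(1)] mhom_diff mhom_one rk r d0)
    moreover have "c * h = c * b' * g * (1\<^sub>m k - d0)" unfolding h_def using D by (simp add: mat_assoc)
    then have "c * h = 1\<^sub>m k - d0" using D g(2) by simp
    then have "d0 + c * h = 1\<^sub>m k" using D by (auto intro!: eq_matI)
    then have "munit k \<kappa> (d0 + c * h)" unfolding munit_def using mhom_one[OF rk] by auto
    ultimately show ?thesis by blast
  next
    assume "munit k \<kappa> (d0 * d')"
    then obtain g where g: "mhom k \<kappa> k \<kappa> g" "d0 * d' * g = 1\<^sub>m k" unfolding munit_def by blast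
    note D = D mhom_dim[OF g(1)]
    have dg: "mhom k \<kappa> k \<kappa> (d' * g)" by (rule mhom_mult[OF rk rk rk g(1) d'])
    have 1: "d0 * (d' * g) = 1\<^sub>m k" using D g(2) by (simp add: mat_assoc)
    then have "d' * g * d0 = 1\<^sub>m k"
      using mat_mult_left_right_inverse[OF mhom_carrier[OF d0] mhom_carrier[OF dg]] by simp
    then have "munit k \<kappa> d0" unfolding munit_def using d0 dg 1 by blast
    moreover have "c * 0\<^sub>m n k = 0\<^sub>m k k" using mhom_carrier[OF c] by simp
    then have "d0 + c * 0\<^sub>m n k = d0" using mhom_carrier[OF d0] by simp
    ultimately show ?thesis using mhom_zero[OF rk r(1)] by metis
  qed
  then obtain h E where h: "mhom k \<kappa> n \<sigma> h" and E: "mhom k \<kappa> k \<kappa> E"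
    and DE: "(d0 + c * h) * E = 1\<^sub>m k" unfolding munit_def by blast
  note D = D mhom_dim[OF h] mhom_dim[OF E]
  \<comment> \<open>The first inclusion, corrected so that \<open>F * v\<close> has no component in
    the second summand.\<close>
  define v where "v = inj1 n k - (inj2 n k + inj1 n k * h) * (E * c)"
  have v: "mhom n \<sigma> (n + k) (dsum_mod n \<sigma> k \<kappa>) v" unfolding v_def
    by (intro mhom_diff mhom_mult[OF _ _ _ mhom_mult[OF _ _ _ c E]] mhom_add mhom_mult[OF _ _ _ h] bh r rk rd1)
  note D = D mhom_dim[OF v]
  have "prj2 m k * F * v = c - (d0 + c * h) * (E * c)"
    using D unfolding v_def c_def d0_def by (simp add: mat_ring)
  also have "(d0 + c * h) * (E * c) = c" using D by (simp add: DE flip: mat_assoc)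
  also have "c - c = 0\<^sub>m k n" using mhom_carrier[OF c] by simp
  finally have z: "prj2 m k * F * v = 0\<^sub>m k n" .
  define S where "S = prj1 m k * F * v"
  have S: "mhom n \<sigma> m \<tau> S" unfolding S_def
    by (rule mhom_mult[OF _ _ _ v mhom_mult[OF _ _ _ F ch(3)]]) (rule r rk rd1 rd2)+
  have "F * v = (inj1 m k * prj1 m k + inj2 m k * prj2 m k) * (F * v)" using D bq(5) by simp
  also have "\<dots> = inj1 m k * S + inj2 m k * (prj2 m k * F * v)"
    using D unfolding S_def by (simp add: mat_ring)
  also have "\<dots> = inj1 m k * S" unfolding z using mhom_dim[OF S] 
    by (intro eq_matI) (auto simp: index_mult_mat_sum)
  finally have Fv: "F * v = inj1 m k * S" .
  \<comment> \<open>\<open>G\<close> undoes \<open>F\<close>, and \<open>prj1 - h * prj2\<close> is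
    a left inverse of \<open>v\<close>; together they give a left inverse of
    \<open>S\<close>.\<close>
  define L where "L = (prj1 n k - h * prj2 n k) * G * inj1 m k"
  have "L * S = (prj1 n k - h * prj2 n k) * (G * (F * v))"
    using D mhom_dim[OF S] unfolding L_def Fv by (simp add: mat_assoc)
  also have "G * (F * v) = v" using D by (simp add: GF flip: mat_assoc)
  also have "(prj1 n k - h * prj2 n k) * v = 1\<^sub>m n"
  proof -
    have "prj1 n k * v = 1\<^sub>m n - h * (E * c)"
      using D unfolding v_def
      by (simp add: mat_ring bp mat_cancel_mid[OF bp(1)] mat_cancel_mid[OF bp(3)]) 
    moreover have "prj2 n k * v = 0\<^sub>m k n - E * c"
      using D unfolding v_def
      by (simp add: mat_ring bp mat_cancel_mid[OF bp(2)] mat_cancel_mid[OF bp(4)]) 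
    ultimately have "(prj1 n k - h * prj2 n k) * v = 1\<^sub>m n - h * (E * c) - (0\<^sub>m n n - h * (E * c))"
      using D by (simp add: mat_ring)
    also have "\<dots> = 1\<^sub>m n" using D by (intro eq_matI) auto
    finally show ?thesis .
  qed
  finally have LS: "L * S = 1\<^sub>m n" .
  have Lc: "L \<in> carrier_mat n m" using D unfolding L_def by (auto intro!: carrier_matI)
  have "S * L = 1\<^sub>m n" using mat_mult_left_right_inverse[OF _ _ LS] Lc mhom_carrier[OF S] nm by simp
  then show ?thesis by (intro isoI[OF r S Lc]) (use nm in auto)
qed

end

section \<open>The regular representation and locality\<close>

lemma index_mult_mat_carrier:
  "A \<in> carrier_mat m n \<Longrightarrow> B \<in> carrier_mat n l \<Longrightarrow> i < m \<Longrightarrow> j < l \<Longrightarrow>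
   (A * B) $$ (i,j) = (\<Sum>k<n. A $$ (i,k) * B $$ (k,j))"
  by (simp add: scalar_prod_def lessThan_atLeast0)

context hopf_alg
begin

lemma mhomI:
  assumes r: "rep n \<sigma>" "rep m \<tau>" and P: "P \<in> carrier_mat m n"
    and eq: "\<And>i a b. i < d \<Longrightarrow> a < m \<Longrightarrow> b < n \<Longrightarrow>
       (\<Sum>c<n. P $$ (a,c) * \<sigma> i $$ (c,b)) = (\<Sum>c<m. \<tau> i $$ (a,c) * P $$ (c,b))"
  shows "mhom n \<sigma> m \<tau> P"
  unfolding mhom_def
proof (intro conjI allI impI)
  fix i assume i: "i < d"
  have c: "\<sigma> i \<in> carrier_mat n n" "\<tau> i \<in> carrier_mat m m" using r i by (auto simp: rep_def)
  show "P * \<sigma> i = \<tau> i * P"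
  proof (rule eq_matI)
    fix a b assume "a < dim_row (\<tau> i * P)" "b < dim_col (\<tau> i * P)"
    then have "a < m" "b < n" using c P by auto
    then show "(P * \<sigma> i) $$ (a,b) = (\<tau> i * P) $$ (a,b)"
      using eq[OF i] by (simp only: index_mult_mat_carrier[OF P c(1)] index_mult_mat_carrier[OF c(2) P])
  qed (use P c in auto)
qed (rule P)

lemma mhom_entry:
  assumes P: "mhom n \<sigma> m \<tau> P" and r: "rep n \<sigma>" "rep m \<tau>" and i: "i < d" and ab: "a < m" "b < n"
  shows "(\<Sum>c<n. P $$ (a,c) * \<sigma> i $$ (c,b)) = (\<Sum>c<m. \<tau> i $$ (a,c) * P $$ (c,b))"
proof -
  have c: "\<sigma> i \<in> carrier_mat n n" "\<tau> i \<in> carrier_mat m m" using r i by (auto simp: rep_def)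
  have "(P * \<sigma> i) $$ (a,b) = (\<tau> i * P) $$ (a,b)" using mhom_comm[OF P i] by simp
  then show ?thesis
    by (simp only: index_mult_mat_carrier[OF mhom_carrier[OF P] c(1) ab]
        index_mult_mat_carrier[OF c(2) mhom_carrier[OF P] ab])
qed

lemma mat_mult_oneI:
  assumes A: "A \<in> carrier_mat m n" and B: "B \<in> carrier_mat n m"
    and eq: "\<And>a b. a < m \<Longrightarrow> b < m \<Longrightarrow> (\<Sum>c<n. A $$ (a,c) * B $$ (c,b)) = (kd a b :: 'k)"
  shows "A * B = 1\<^sub>m m"
proof (rule eq_matI)
  fix a b assume "a < dim_row (1\<^sub>m m :: 'k mat)" "b < dim_col (1\<^sub>m m :: 'k mat)"
  then have ab: "a < m" "b < m" by auto
  then show "(A * B) $$ (a,b) = 1\<^sub>m m $$ (a,b)"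
    using eq[OF ab] by (simp only: index_mult_mat_carrier[OF A B ab]) (simp add: kd_def)
qed (use A B in auto)

text \<open>The bridge from matrices to the functional notation: an entry of \<open>lincomb\<close>
  is a value of \<open>ls\<close>, so the module laws can be combined with the Hopf
  identities.\<close>

lemma is_module_iff:
  "is_module H n \<rho> \<longleftrightarrow> rep n \<rho> \<and>
     (\<forall>i<d. \<forall>j<d. \<forall>a<n. \<forall>b<n. (\<Sum>c<n. \<rho> i $$ (a,c) * \<rho> j $$ (c,b)) = mu i j (\<lambda>s. \<rho> s $$ (a,b))) \<and>
     (\<forall>a<n. \<forall>b<n. un (\<lambda>s. \<rho> s $$ (a,b)) = kd a b)"
proof -
  have ext: "A = B \<longleftrightarrow> (\<forall>a<n. \<forall>b<n. A $$ (a,b) = B $$ (a,b))"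
    if "A \<in> carrier_mat n n" "B \<in> carrier_mat n n" for A B :: "'k mat"
    using that by (auto intro!: eq_matI)
  have lc: "lincomb d n \<rho> x \<in> carrier_mat n n" for x by (simp add: lincomb_def)
  have le: "lincomb d n \<rho> x $$ (a,b) = ls x (\<lambda>s. \<rho> s $$ (a,b))" if "a < n" "b < n" for x a b
    using that by (simp add: lincomb_def ls_def)
  have 1: "(\<rho> i * \<rho> j = lincomb d n \<rho> (hmul H i j)) \<longleftrightarrow>
     (\<forall>a<n. \<forall>b<n. (\<Sum>c<n. \<rho> i $$ (a,c) * \<rho> j $$ (c,b)) = mu i j (\<lambda>s. \<rho> s $$ (a,b)))"
    if "rep n \<rho>" "i < d" "j < d" for i j
  proof -
    have c: "\<rho> i \<in> carrier_mat n n" "\<rho> j \<in> carrier_mat n n" using that by (auto simp: rep_def)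
    show ?thesis
      unfolding ext[OF mult_carrier_mat[OF c] lc]
      by (simp add: le index_mult_mat_carrier[OF c] del: index_mult_mat(1) cong: conj_cong)
  qed
  have 2: "(lincomb d n \<rho> (hunit H) = 1\<^sub>m n) \<longleftrightarrow> (\<forall>a<n. \<forall>b<n. un (\<lambda>s. \<rho> s $$ (a,b)) = kd a b)"
    unfolding ext[OF lc one_carrier_mat] by (auto simp: le kd_def)
  show ?thesis
  proof (cases "rep n \<rho>")
    case True
    then show ?thesis unfolding is_module_def 2 by (simp add: 1) (simp add: rep_def)
  next
    case False
    then show ?thesis by (auto simp: is_module_rep)
  qed
qed

lemma is_module_mult:
  "is_module H n \<rho> \<Longrightarrow> i < d \<Longrightarrow> j < d \<Longrightarrow> a < n \<Longrightarrow> b < n \<Longrightarrow>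
    (\<Sum>c<n. \<rho> i $$ (a,c) * \<rho> j $$ (c,b)) = mu i j (\<lambda>s. \<rho> s $$ (a,b))"
  by (simp add: is_module_iff)

lemma is_module_unit: "is_module H n \<rho> \<Longrightarrow> a < n \<Longrightarrow> b < n \<Longrightarrow> un (\<lambda>s. \<rho> s $$ (a,b)) = kd a b"
  by (simp add: is_module_iff)

section \<open>Regular and free modules; algebra elements and left ideals\<close>

definition reg :: "nat \<Rightarrow> 'k mat" where
  "reg i = mat d d (\<lambda>(a,b). hmul H i b a)"

lemma reg_index [simp]: "a < d \<Longrightarrow> b < d \<Longrightarrow> reg i $$ (a,b) = hmul H i b a"
  by (simp add: reg_def)

lemma hmul_mu: "l < d \<Longrightarrow> hmul H i j l = mu i j (\<lambda>s. kd s l)"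
  by (simp add: ls_kd)

lemma rep_reg: "rep d reg" by (simp add: rep_def reg_def)

lemma rep_free: "rep (r * d) (free_mod H r)"
  by (simp add: rep_def free_mod_def)

text \<open>Drives the inductions on the rank: the last copy of the regular module splits off as a
  block.\<close>

lemma free_mod_Suc:
  assumes i: "i < d"
  shows "free_mod H (Suc r) i = dsum_mod (r * d) (free_mod H r) d reg i"
proof (rule eq_matI)
  note D = repD[OF dsum_rep[OF rep_free rep_reg, of r] i]
  fix a b assume "a < dim_row (dsum_mod (r * d) (free_mod H r) d reg i)"
    "b < dim_col (dsum_mod (r * d) (free_mod H r) d reg i)"
  then have ab: "a < r * d + d" "b < r * d + d" by (simp_all only: D)
  have dm: "x div d = r \<and> x mod d = x - r * d" if x: "r * d \<le> x" "x < r * d + d" for x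
  proof -
    obtain y where y: "x = r * d + y" using le_Suc_ex[OF x(1)] by blast
    then show ?thesis using x by simp
  qed
  have lt: "x div d < r" if "x < r * d" for x using that by (simp add: less_mult_imp_div_less)
  show "free_mod H (Suc r) i $$ (a,b) = dsum_mod (r * d) (free_mod H r) d reg i $$ (a,b)"
    using ab dm[of a] dm[of b] lt[of a] lt[of b]
    by (cases "a < r * d"; cases "b < r * d") (auto simp: free_mod_def dsum_mod_def reg_def add.commute)
qed (simp_all only: repD[OF dsum_rep[OF rep_free rep_reg, of r] i] repD[OF rep_free i] mult_Suc add.commute)

text \<open>The axioms leave \<open>hunit\<close> unconstrained from index \<open>d\<close> on,
  whereas \<open>helems\<close> asks for zeros there; hence the truncation.\<close>

definition hone :: "nat \<Rightarrow> 'k" where "hone l = (if l < d then hunit H l else 0)"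

lemma hone_helems: "hone \<in> helems H" by (simp add: hone_def helems_def)
lemma hprod_helems: "hprod H x y \<in> helems H" by (simp add: hprod_def helems_def)

lemma ls_hone: "ls hone f = un f" by (simp add: ls_def hone_def)

lemma hprod_index: "l < d \<Longrightarrow> hprod H x y l = ls x (\<lambda>i. ls y (\<lambda>j. hmul H i j l))"
  by (simp add: hprod_def ls_def sum_distrib_left mult.assoc)

lemma ls_hprod: "ls (hprod H x y) f = ls x (\<lambda>i. ls y (\<lambda>j. mu i j f))"
proof -
  have "ls (hprod H x y) f = (\<Sum>l<d. ls x (\<lambda>i. ls y (\<lambda>j. hmul H i j l * f l)))"
    unfolding ls_def[of "hprod H x y"] by (simp add: hprod_index ls_mult_right)
  then show ?thesis by (simp add: ls_sum[symmetric] ls_def[of "hmul H _ _"])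
qed

lemma helems_eqI:
  assumes "x \<in> helems H" "y \<in> helems H" "\<And>f. ls x f = ls y f"
  shows "x = y"
proof
  fix l show "x l = y l"
    using assms(1,2) assms(3)[of "\<lambda>s. kd s l"] by (cases "l < d") (auto simp: ls_kd helems_def)
qed

lemma hprod_assoc: "hprod H (hprod H x y) z = hprod H x (hprod H y z)"
proof (rule helems_eqI)
  fix f
  have "ls (hprod H (hprod H x y) z) f = ls x (\<lambda>i. ls y (\<lambda>j. mu i j (\<lambda>s. ls z (\<lambda>l. mu s l f))))"
    by (simp add: ls_hprod)
  also have "\<dots> = ls x (\<lambda>i. ls y (\<lambda>j. ls z (\<lambda>l. mu i j (\<lambda>s. mu s l f))))"
    by (subst (3) ls_swap, rule refl)
  also have "\<dots> = ls (hprod H x (hprod H y z)) f" by (simp add: ls_hprod mu_assoc)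
  finally show "ls (hprod H (hprod H x y) z) f = ls (hprod H x (hprod H y z)) f" .
qed (rule hprod_helems)+

lemma hprod_hone:
  assumes "x \<in> helems H"
  shows "hprod H hone x = x" "hprod H x hone = x"
proof -
  have "ls (hprod H hone x) f = ls x f" for f
  proof -
    have "ls (hprod H hone x) f = ls x (\<lambda>j. un (\<lambda>i. mu i j f))"
      unfolding ls_hprod ls_hone by (rule ls_swap)
    then show ?thesis by (simp add: un_mu)
  qed
  then show "hprod H hone x = x" using assms by (intro helems_eqI) (auto simp: hprod_helems)
  have "ls (hprod H x hone) f = ls x f" for f by (simp add: ls_hprod ls_hone un_mu)
  then show "hprod H x hone = x" using assms by (intro helems_eqI) (auto simp: hprod_helems)
qed

lemma hprod_add:
  "hprod H (\<lambda>l. x l + y l) z = (\<lambda>l. hprod H x z l + hprod H y z l)"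
  "hprod H z (\<lambda>l. x l + y l) = (\<lambda>l. hprod H z x l + hprod H z y l)"
  by (auto simp: hprod_def algebra_simps sum.distrib)

lemma hprod_scale_hone: "x \<in> helems H \<Longrightarrow> hprod H (\<lambda>l. a * hone l) x = (\<lambda>l. a * x l)"
proof -
  assume x: "x \<in> helems H"
  have "hprod H (\<lambda>l. a * hone l) x = (\<lambda>l. a * hprod H hone x l)"
    by (auto simp: hprod_def sum_distrib_left mult.assoc)
  then show ?thesis using hprod_hone[OF x] by simp
qed

lemma ls_scale: "ls (\<lambda>l. a * x l) f = a * ls x f"
  by (simp add: ls_def sum_distrib_left mult.assoc)

lemma ls_add_elem: "ls (\<lambda>l. x l + y l) f = ls x f + ls y f"
  by (simp add: ls_def algebra_simps sum.distrib)

lemma left_ideal_scale: "left_ideal H I \<Longrightarrow> x \<in> I \<Longrightarrow> (\<lambda>l. a * x l) \<in> I"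
proof -
  assume I: "left_ideal H I" "x \<in> I"
  then have x: "x \<in> helems H" by (auto simp: left_ideal_def)
  have "hprod H (\<lambda>l. a * hone l) x \<in> I"
    using I hone_helems unfolding left_ideal_def by (auto simp: helems_def)
  then show ?thesis by (simp add: hprod_scale_hone[OF x])
qed

lemma left_ideal_hone: "left_ideal H I \<Longrightarrow> hone \<in> I \<Longrightarrow> I = helems H"
  unfolding left_ideal_def using hprod_hone(2) by (metis subsetI subset_antisym)

text \<open>The kernel of a character has codimension one: a left ideal that contains it and one
  element outside it also contains the unit.\<close>

lemma character_kernel_maximal:
  assumes mult: "\<And>i j. i < d \<Longrightarrow> j < d \<Longrightarrow> mu i j \<chi> = \<chi> i * \<chi> j" and unit: "un \<chi> = 1"
  shows "maximal_left_ideal H {x \<in> helems H. ls x \<chi> = 0}" (is "maximal_left_ideal H ?I")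
proof -
  have prod: "ls (hprod H x y) \<chi> = ls x \<chi> * ls y \<chi>" for x y
    by (simp add: ls_hprod mult ls_mult_left ls_mult_right)
  have I: "left_ideal H ?I"
    unfolding left_ideal_def by (auto simp: prod hprod_helems ls_add_elem) (auto simp: helems_def ls_def)
  moreover have "hone \<notin> ?I" using unit by (simp add: ls_hone)
  then have "?I \<noteq> helems H" using hone_helems by blast
  moreover have "J = ?I" if J: "left_ideal H J" "?I \<subseteq> J" "J \<noteq> helems H" for J
  proof (rule ccontr)
    assume "J \<noteq> ?I"
    then obtain y where y: "y \<in> J" "ls y \<chi> \<noteq> 0" using J by (auto simp: left_ideal_def)
    then have yh: "y \<in> helems H" using J by (auto simp: left_ideal_def)
    define a where "a = 1 / ls y \<chi>"
    \<comment> \<open>The multiple of \<open>y\<close> is chosen so that \<open>z\<close> lies in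
      the kernel; then the unit is a sum of two members of \<open>J\<close>.\<close>
    define z where "z l = hone l + (- a) * y l" for l
    have "z \<in> helems H" using hone_helems yh by (auto simp: z_def helems_def)
    moreover have "ls z \<chi> = 0"
      unfolding z_def ls_add_elem ls_scale using y(2) by (simp add: ls_hone unit a_def)
    ultimately have "z \<in> J" using J by auto
    moreover have "(\<lambda>l. a * y l) \<in> J" using left_ideal_scale[OF J(1) y(1)] .
    ultimately have "(\<lambda>l. z l + a * y l) \<in> J" using J(1) by (auto simp: left_ideal_def)
    then have "hone \<in> J" by (simp add: z_def[abs_def])
    then show False using left_ideal_hone J by blast
  qed
  ultimately show ?thesis unfolding maximal_left_ideal_def by blast
qed

text \<open>Zorn's lemma, with properness expressed as not containing the unit, a condition that
  passes to unions of chains.\<close>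

lemma proper_left_ideal_in_maximal:
  assumes I: "left_ideal H I" "hone \<notin> I"
  shows "\<exists>J. maximal_left_ideal H J \<and> I \<subseteq> J"
proof -
  let ?A = "{J. left_ideal H J \<and> I \<subseteq> J \<and> hone \<notin> J}"
  have "\<exists>M\<in>?A. \<forall>X\<in>?A. M \<subseteq> X \<longrightarrow> X = M"
  proof (rule subset_Zorn_nonempty)
    show "?A \<noteq> {}" using I by auto
    fix C assume C: "C \<noteq> {}" "subset.chain ?A C"
    then have CA: "\<And>J. J \<in> C \<Longrightarrow> left_ideal H J \<and> I \<subseteq> J \<and> hone \<notin> J"
      and tot: "\<And>J K. J \<in> C \<Longrightarrow> K \<in> C \<Longrightarrow> J \<subseteq> K \<or> K \<subseteq> J"
      by (auto simp: subset_chain_def)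
    have "left_ideal H (\<Union>C)"
      unfolding left_ideal_def
    proof (intro conjI ballI)
      show "\<Union>C \<subseteq> helems H" using CA unfolding left_ideal_def by blast
      show "(\<lambda>_. 0) \<in> \<Union>C" using CA C(1) unfolding left_ideal_def by blast
      show "(\<lambda>l. x l + y l) \<in> \<Union>C" if xy: "x \<in> \<Union>C" "y \<in> \<Union>C" for x y
      proof -
        obtain K1 K2 where "K1 \<in> C" "x \<in> K1" "K2 \<in> C" "y \<in> K2" using xy by blast
        then obtain K where "K \<in> C" "x \<in> K" "y \<in> K" using tot[of K1 K2] by blast
        then show ?thesis using CA unfolding left_ideal_def by blast
      qed
      show "hprod H a x \<in> \<Union>C" if "a \<in> helems H" "x \<in> \<Union>C" for a x
        using that CA unfolding left_ideal_def by blast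
    qed
    then show "\<Union>C \<in> ?A" using CA C(1) by auto
  qed
  then obtain M where M: "M \<in> ?A" and max: "\<forall>X\<in>?A. M \<subseteq> X \<longrightarrow> X = M" by (rule bexE)
  have "maximal_left_ideal H M"
    unfolding maximal_left_ideal_def
  proof (intro conjI allI impI)
    show "left_ideal H M" using M by simp
    show "M \<noteq> helems H" using M hone_helems by auto
    fix J assume J: "left_ideal H J \<and> M \<subseteq> J \<and> J \<noteq> helems H"
    then have "hone \<notin> J" using left_ideal_hone by blast
    moreover have "I \<subseteq> J" using J M by auto
    ultimately show "J = M" using J max by simp
  qed
  then show ?thesis using M by blast
qed

lemma is_module_triv: "is_module H 1 (triv_mod H)"
  using mu_e un_e by (simp add: is_module_iff rep_def triv_mod_def kd_def)

end

section \<open>Units and characters of a local Hopf algebra\<close>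

locale local_hopf_alg = hopf_alg H for H :: "'k::field hopf" +
  assumes local: "local_alg H"
begin

text \<open>The counit is a character, so its kernel is maximal and must be the only maximal left
  ideal.\<close>

lemma maximal_unique: "maximal_left_ideal H I \<Longrightarrow> I = {x \<in> helems H. ls x e = 0}"
  using local character_kernel_maximal[of e] mu_e un_e unfolding local_alg_def by auto

text \<open>Otherwise the left ideal generated by \<open>y\<close> is proper and lies in the kernel
  of the counit, although it contains \<open>y\<close>.\<close>

lemma left_inverse:
  assumes y: "y \<in> helems H" "ls y e \<noteq> 0"
  shows "\<exists>a\<in>helems H. hprod H a y = hone"
proof (rule ccontr)
  assume no: "\<not> ?thesis"
  let ?I = "(\<lambda>a. hprod H a y) ` helems H"
  have "left_ideal H ?I"
    unfolding left_ideal_def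
  proof (intro conjI ballI)
    show "?I \<subseteq> helems H" by (auto simp: hprod_helems)
    have "hprod H (\<lambda>_. 0) y = (\<lambda>_. 0)" by (auto simp: hprod_def)
    moreover have "(\<lambda>_. 0) \<in> helems H" by (simp add: helems_def)
    ultimately show "(\<lambda>_. 0) \<in> ?I" by force
    show "(\<lambda>l. x l + x' l) \<in> ?I" if x: "x \<in> ?I" "x' \<in> ?I" for x x'
    proof -
      obtain a a' where a: "a \<in> helems H" "a' \<in> helems H" "x = hprod H a y" "x' = hprod H a' y"
        using x by blast
      then have "(\<lambda>l. x l + x' l) = hprod H (\<lambda>l. a l + a' l) y" by (simp add: hprod_add)
      moreover have "(\<lambda>l. a l + a' l) \<in> helems H" using a by (auto simp: helems_def)
      ultimately show ?thesis by blast
    qed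
    show "hprod H b x \<in> ?I" if "b \<in> helems H" "x \<in> ?I" for b x
      using that hprod_helems by (auto simp flip: hprod_assoc)
  qed
  moreover have "hone \<notin> ?I" using no by auto
  ultimately obtain J where J: "maximal_left_ideal H J" "?I \<subseteq> J"
    using proper_left_ideal_in_maximal by blast
  have "y \<in> ?I" using hprod_hone(1)[OF y(1)] hone_helems by force
  then show False using J maximal_unique[OF J(1)] y(2) by auto
qed

text \<open>A left inverse \<open>a\<close> of \<open>y\<close> also has nonzero augmentation, so it
  has a left inverse \<open>b\<close> itself; associativity forces \<open>b = y\<close>.\<close>

lemma two_sided_inverse:
  assumes y: "y \<in> helems H" "ls y e \<noteq> 0"
  obtains a where "a \<in> helems H" "hprod H a y = hone" "hprod H y a = hone"
proof -
  obtain a where a: "a \<in> helems H" "hprod H a y = hone" using left_inverse[OF y] by blast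
  have "ls a e * ls y e = 1"
    using arg_cong[OF a(2), of "\<lambda>x. ls x e"] by (simp add: ls_hprod mu_e ls_mult_left ls_mult_right ls_hone un_e)
  then have "ls a e \<noteq> 0" by auto
  then obtain b where b: "b \<in> helems H" "hprod H b a = hone" using left_inverse[OF a(1)] by blast
  have "b = hprod H b (hprod H a y)" using a(2) hprod_hone(2)[OF b(1)] by simp
  also have "\<dots> = y" using b(2) hprod_hone(1)[OF y(1)] by (simp flip: hprod_assoc)
  finally have "b = y" .
  then show ?thesis using that a b by blast
qed

text \<open>The action is a character, whose kernel is a maximal left ideal and hence equals the
  kernel of the counit. Two characters with the same kernel agree, since both are 1 on the
  unit.\<close>

lemma one_dim_module_trivial:
  assumes V: "is_module H 1 \<rho>"
  shows "iso 1 \<rho> 1 (triv_mod H)"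
proof (rule iso_eqI)
  define \<chi> where "\<chi> i = \<rho> i $$ (0,0)" for i
  have mult: "mu i j \<chi> = \<chi> i * \<chi> j" if "i < d" "j < d" for i j
    using is_module_mult[OF V that, of 0 0] by (simp add: \<chi>_def[abs_def])
  have unit: "un \<chi> = 1" using is_module_unit[OF V, of 0 0] by (simp add: \<chi>_def[abs_def] kd_def)
  have ker: "{x \<in> helems H. ls x \<chi> = 0} = {x \<in> helems H. ls x e = 0}"
    using maximal_unique[OF character_kernel_maximal[OF mult unit]] by blast
  fix i assume i: "i < d"
  \<comment> \<open>The element e_i - eps(e_i) 1 of the augmentation ideal; the vanishing of the
    character on it is the claim for index \<open>i\<close>.\<close>
  define z where "z l = kd l i + (- e i) * hone l" for l
  have z: "ls z f = f i - e i * un f" for f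
  proof -
    have "ls (\<lambda>l. kd l i) f = f i" using ls_kd'[OF i, of f] by (simp add: ls_def kd_def eq_commute)
    then show ?thesis unfolding z_def ls_add_elem ls_scale by (simp add: ls_hone)
  qed
  have "z \<in> helems H" using i hone_helems by (auto simp: z_def helems_def kd_def)
  moreover have "ls z e = 0" by (simp add: z un_e)
  ultimately have "ls z \<chi> = 0" using ker by blast
  then have "\<chi> i = e i" by (simp add: z unit)
  then show "\<rho> i = triv_mod H i"
    using is_module_rep[OF V] i by (intro eq_matI) (auto simp: triv_mod_def \<chi>_def rep_def)
qed (use is_module_rep[OF V] in auto)

end

section \<open>Endomorphisms of the regular module\<close>

context hopf_alg
begin

text \<open>Matrix of right multiplication by \<open>x\<close>, which commutes with the left
  action.\<close>

definition rmul :: "(nat \<Rightarrow> 'k) \<Rightarrow> 'k mat" where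
  "rmul x = mat d d (\<lambda>(l,b). ls x (\<lambda>j. hmul H b j l))"

lemma rmul_carrier: "rmul x \<in> carrier_mat d d" by (simp add: rmul_def)

lemma rmul_index: "l < d \<Longrightarrow> b < d \<Longrightarrow> rmul x $$ (l,b) = ls x (\<lambda>j. mu b j (\<lambda>s. kd s l))"
  by (simp add: rmul_def hmul_mu)

lemma sum_reg: "b < d \<Longrightarrow> (\<Sum>c<d. f c * reg i $$ (c,b)) = mu i b f"
  by (simp add: ls_def mult.commute)

lemma rmul_mhom: "mhom d reg d reg (rmul x)"
proof (rule mhomI[OF rep_reg rep_reg rmul_carrier])
  fix i a b assume *: "i < d" "a < d" "b < d"
  have "(\<Sum>c<d. rmul x $$ (a,c) * reg i $$ (c,b)) = mu i b (\<lambda>c. ls x (\<lambda>j. mu c j (\<lambda>s. kd s a)))"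
    using * by (simp add: sum_reg rmul_index del: reg_index)
  also have "\<dots> = ls x (\<lambda>j. mu i b (\<lambda>c. mu c j (\<lambda>s. kd s a)))" by (rule ls_swap)
  also have "\<dots> = ls x (\<lambda>j. mu b j (\<lambda>c. mu i c (\<lambda>s. kd s a)))" using * by (simp add: mu_assoc)
  also have "\<dots> = ls x (\<lambda>j. mu b j (\<lambda>c. reg i $$ (a,c)))" using * by (simp add: hmul_mu)
  also have "\<dots> = (\<Sum>c<d. reg i $$ (a,c) * rmul x $$ (c,b))"
    using * by (simp add: rmul_def ls_def[of "hmul H _ _"] ls_sum ls_mult_right mult.commute)
  finally show "(\<Sum>c<d. rmul x $$ (a,c) * reg i $$ (c,b)) = (\<Sum>c<d. reg i $$ (a,c) * rmul x $$ (c,b))" .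
qed

text \<open>The order is reversed: composing right multiplications gives the opposite
  algebra.\<close>

lemma rmul_mult: "rmul x * rmul z = rmul (hprod H z x)"
proof (rule eq_matI)
  fix a b assume "a < dim_row (rmul (hprod H z x))" "b < dim_col (rmul (hprod H z x))"
  then have ab: "a < d" "b < d" by (auto simp: rmul_def)
  have "(rmul x * rmul z) $$ (a,b) = (\<Sum>c<d. rmul x $$ (a,c) * rmul z $$ (c,b))"
    by (rule index_mult_mat_carrier[OF rmul_carrier rmul_carrier ab])
  also have "\<dots> = ls z (\<lambda>i. mu b i (\<lambda>c. rmul x $$ (a,c)))"
    using ab by (simp add: rmul_def ls_def[of "hmul H _ _"] ls_sum ls_mult_right mult.commute)
  also have "\<dots> = ls z (\<lambda>i. mu b i (\<lambda>c. ls x (\<lambda>j. mu c j (\<lambda>s. kd s a))))"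
    using ab by (simp add: rmul_index)
  also have "\<dots> = ls z (\<lambda>i. ls x (\<lambda>j. mu b i (\<lambda>c. mu c j (\<lambda>s. kd s a))))"
    by (subst (2) ls_swap, rule refl)
  also have "\<dots> = rmul (hprod H z x) $$ (a,b)"
    using ab by (simp add: rmul_index ls_hprod mu_assoc)
  finally show "(rmul x * rmul z) $$ (a,b) = rmul (hprod H z x) $$ (a,b)" .
qed (auto simp: rmul_def)

lemma rmul_hone: "rmul hone = 1\<^sub>m d"
  by (rule eq_matI) (auto simp: rmul_index ls_hone un_mu kd_def, auto simp: rmul_def)

text \<open>A linear map on the regular module is determined by its value at 1; the vector on the
  right holds the coordinates of that value.\<close>

lemma mhom_reg_eq_rmul:
  assumes f: "mhom d reg d reg f"
  shows "f = rmul (\<lambda>l. if l < d then un (\<lambda>a. f $$ (l,a)) else 0)" (is "f = rmul ?x")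
proof (rule eq_matI)
  fix l b assume "l < dim_row (rmul ?x)" "b < dim_col (rmul ?x)"
  then have lb: "l < d" "b < d" by (auto simp: rmul_def)
  have "f $$ (l,b) = un (\<lambda>a. mu b a (\<lambda>c. f $$ (l,c)))" using lb by (simp add: un_mu)
  also have "\<dots> = un (\<lambda>a. \<Sum>c<d. f $$ (l,c) * reg b $$ (c,a))"
    by (simp add: sum_reg del: reg_index)
  also have "\<dots> = un (\<lambda>a. \<Sum>c<d. reg b $$ (l,c) * f $$ (c,a))"
    using mhom_entry[OF f rep_reg rep_reg lb(2) lb(1)] by simp
  also have "\<dots> = rmul ?x $$ (l,b)"
    using lb by (simp add: rmul_def ls_sum ls_mult_left ls_def[of ?x] mult.commute)
  finally show "f $$ (l,b) = rmul ?x $$ (l,b)" .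
qed (use mhom_dim[OF f] in \<open>auto simp: rmul_def\<close>)

end

section \<open>Projective modules over a local algebra are free\<close>

context local_hopf_alg
begin

text \<open>An endomorphism is right multiplication by its value at 1 and is a unit as soon as that
  value has nonzero augmentation. If f + g = 1, the two augmentations add up to eps(1) = 1, so they
  cannot both vanish.\<close>

lemma local_end_reg: "local_end d reg"
proof -
  let ?v = "\<lambda>f :: 'k mat. \<lambda>l. if l < d then un (\<lambda>a. f $$ (l,a)) else 0"
  have unit: "munit d reg f" if f: "mhom d reg d reg f" and nz: "ls (?v f) e \<noteq> 0" for f
  proof -
    have "?v f \<in> helems H" by (simp add: helems_def)
    then obtain z where "hprod H z (?v f) = hone" "hprod H (?v f) z = hone"
      using two_sided_inverse[OF _ nz] by blast
    then have "f * rmul z = 1\<^sub>m d" "rmul z * f = 1\<^sub>m d"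
      by (subst mhom_reg_eq_rmul[OF f], simp add: rmul_mult rmul_hone)+
    then show ?thesis unfolding munit_def using f rmul_mhom by blast
  qed
  have "munit d reg f \<or> munit d reg g"
    if f: "mhom d reg d reg f" and g: "mhom d reg d reg g" and fg: "f + g = 1\<^sub>m d" for f g
  proof (rule ccontr)
    assume "\<not> ?thesis"
    then have "ls (?v f) e = 0" "ls (?v g) e = 0" using unit f g by blast+
    then have "0 = (\<Sum>l<d. (un (\<lambda>a. f $$ (l,a)) + un (\<lambda>a. g $$ (l,a))) * e l)"
      by (simp add: ls_def[of "?v _"] algebra_simps sum.distrib)
    also have "\<dots> = (\<Sum>l<d. un (\<lambda>a. (f + g) $$ (l,a)) * e l)"
      using mhom_dim[OF f] mhom_dim[OF g] by (simp add: ls_add)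
    also have "\<dots> = (\<Sum>l<d. hunit H l * e l)"
      unfolding fg by (intro sum.cong refl) (simp add: ls_def if_distrib sum.delta' cong: if_cong)
    also have "\<dots> = 1" using un_e by (simp add: ls_def)
    finally show False by simp
  qed
  then show ?thesis unfolding local_end_def using rep_reg by blast
qed

text \<open>Rearranging the summands brings a copy of the regular module to the end on both sides,
  where \<open>dsum_cancel\<close> removes it.\<close>

lemma projective_peel:
  assumes m: "rep n \<sigma>" "rep n' \<tau>" "rep q \<sigma>'" "rep l \<phi>"
    and iso: "iso (n + n') (dsum_mod n \<sigma> n' \<tau>) (l + d) (dsum_mod l \<phi> d reg)"
    and s: "iso n \<sigma> (d + q) (dsum_mod d reg q \<sigma>')"
  shows "iso (q + n') (dsum_mod q \<sigma>' n' \<tau>) l \<phi>"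
proof (rule dsum_cancel[OF local_end_reg])
  note R = m rep_reg dsum_rep
  have 1: "iso (q + n' + d) (dsum_mod (q + n') (dsum_mod q \<sigma>' n' \<tau>) d reg)
     (d + (q + n')) (dsum_mod d reg (q + n') (dsum_mod q \<sigma>' n' \<tau>))"
    by (intro dsum_comm R)
  have 2: "iso (d + (q + n')) (dsum_mod d reg (q + n') (dsum_mod q \<sigma>' n' \<tau>))
     (d + q + n') (dsum_mod (d + q) (dsum_mod d reg q \<sigma>') n' \<tau>)"
    by (rule iso_eqI) (simp_all add: R dsum_assoc)
  have 3: "iso (d + q + n') (dsum_mod (d + q) (dsum_mod d reg q \<sigma>') n' \<tau>) (n + n') (dsum_mod n \<sigma> n' \<tau>)"
    by (intro dsum_iso_cong iso_sym[OF s] iso_refl R)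
  show "iso (q + n' + d) (dsum_mod (q + n') (dsum_mod q \<sigma>' n' \<tau>) d reg) (l + d) (dsum_mod l \<phi> d reg)"
    by (rule iso_trans[OF iso_trans[OF iso_trans[OF 1 2] 3] iso]) (intro R)+
qed (intro assms dsum_rep)+

text \<open>Exchange argument. The identity of the last copy of A is the sum of its factorisations
  through the two summands; locality makes one of these a unit, so A splits off that summand.
  Peeling it off lowers \<open>r\<close>. Both summands vary in the induction because either one may
  be the one that shrinks.\<close>

lemma projective_free:
  assumes "is_module H n \<sigma>" "is_module H n' \<tau>"
    and "iso (n + n') (dsum_mod n \<sigma> n' \<tau>) (r * d) (free_mod H r)"
  shows "\<exists>s. iso n \<sigma> (s * d) (free_mod H s)"
  using assms
proof (induction r arbitrary: n n' \<sigma> \<tau>)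
  case 0
  then have n: "n = 0" by (simp add: iso_mod_def)
  have "iso n \<sigma> (0 * d) (free_mod H 0)"
    using is_module_rep[OF 0(1)] n
    by (intro iso_eqI) (auto simp: rep_def free_mod_def intro!: eq_matI)
  then show ?case by blast
next
  case (Suc r)
  note m = Suc.prems(1,2)
  note R = is_module_rep[OF m(1)] is_module_rep[OF m(2)] rep_reg rep_free dsum_rep
  have iso: "iso (n + n') (dsum_mod n \<sigma> n' \<tau>) (r * d + d) (dsum_mod (r * d) (free_mod H r) d reg)"
    using iso_cong[OF Suc.prems(3) refl free_mod_Suc] by (simp add: add.commute)
  obtain F G where F: "mhom (n + n') (dsum_mod n \<sigma> n' \<tau>) (r * d + d) (dsum_mod (r * d) (free_mod H r) d reg) F"
    and G: "mhom (r * d + d) (dsum_mod (r * d) (free_mod H r) d reg) (n + n') (dsum_mod n \<sigma> n' \<tau>) G"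
    and FG: "F * G = 1\<^sub>m (r * d + d)" and GF: "G * F = 1\<^sub>m (n + n')"
    by (rule isoE[OF iso]) (intro R)+
  note bp = biprod_inj_prj[of n n'] and bq = biprod_inj_prj[of "r * d" d]
  note bh = biprod_mhom[OF R(1,2)] and ch = biprod_mhom[OF rep_free rep_reg, of r]
  let ?c1 = "prj2 (r * d) d * F * inj1 n n'" and ?b1 = "prj1 n n' * G * inj2 (r * d) d"
  let ?c2 = "prj2 (r * d) d * F * inj2 n n'" and ?b2 = "prj2 n n' * G * inj2 (r * d) d"
  have c1: "mhom n \<sigma> d reg ?c1"
    by (rule mhom_mult[OF _ _ _ bh(1) mhom_mult[OF _ _ _ F ch(4)]]) (intro R)+
  have c2: "mhom n' \<tau> d reg ?c2"
    by (rule mhom_mult[OF _ _ _ bh(2) mhom_mult[OF _ _ _ F ch(4)]]) (intro R)+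
  have b1: "mhom d reg n \<sigma> ?b1"
    by (rule mhom_mult[OF _ _ _ ch(2) mhom_mult[OF _ _ _ G bh(3)]]) (intro R)+
  have b2: "mhom d reg n' \<tau> ?b2"
    by (rule mhom_mult[OF _ _ _ ch(2) mhom_mult[OF _ _ _ G bh(4)]]) (intro R)+
  note D = mhom_dim[OF F] mhom_dim[OF G]
  have "?c1 * ?b1 + ?c2 * ?b2
      = prj2 (r * d) d * F * (inj1 n n' * prj1 n n' + inj2 n n' * prj2 n n') * G * inj2 (r * d) d"
    using D by (simp add: mat_ring)
  also have "\<dots> = prj2 (r * d) d * (F * G) * inj2 (r * d) d" using D bp(5) by (simp add: mat_assoc)
  also have "\<dots> = 1\<^sub>m d" by (simp add: FG bq(2))
  finally have "munit d reg (?c1 * ?b1) \<or> munit d reg (?c2 * ?b2)"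
    using local_end_reg mhom_mult[OF rep_reg R(1) rep_reg b1 c1] mhom_mult[OF rep_reg R(2) rep_reg b2 c2]
    unfolding local_end_def by blast
  then show ?case
  proof
    assume "munit d reg (?c1 * ?b1)"
    then obtain g where g: "mhom d reg d reg g" "g * (?c1 * ?b1) = 1\<^sub>m d" unfolding munit_def by blast
    have c: "mhom n \<sigma> d reg (g * ?c1)" by (rule mhom_mult[OF R(1) rep_reg rep_reg c1 g(1)])
    have cb: "g * ?c1 * ?b1 = 1\<^sub>m d"
      using g(2) mhom_dim[OF g(1)] D by (simp add: mat_assoc)
    obtain q \<sigma>' where s: "is_module H q \<sigma>'" "iso n \<sigma> (d + q) (dsum_mod d reg q \<sigma>')"
      using split_iso[OF m(1) rep_reg b1 c cb] by metis
    note Q = is_module_rep[OF s(1)]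
    have "iso (q + n') (dsum_mod q \<sigma>' n' \<tau>) (r * d) (free_mod H r)"
      by (rule projective_peel[OF R(1,2) Q rep_free iso s(2)])
    then obtain t where t: "iso q \<sigma>' (t * d) (free_mod H t)" using Suc.IH[OF s(1) m(2)] by blast
    have 1: "iso (d + q) (dsum_mod d reg q \<sigma>') (q + d) (dsum_mod q \<sigma>' d reg)"
      by (intro dsum_comm R Q)
    have 2: "iso (q + d) (dsum_mod q \<sigma>' d reg) (t * d + d) (dsum_mod (t * d) (free_mod H t) d reg)"
      by (intro dsum_iso_cong t iso_refl R Q)
    have 3: "iso n \<sigma> (t * d + d) (dsum_mod (t * d) (free_mod H t) d reg)"
      by (rule iso_trans[OF iso_trans[OF s(2) 1] 2]) (intro R Q)+
    have "iso n \<sigma> (Suc t * d) (free_mod H (Suc t))"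
      using iso_cong[OF 3 refl free_mod_Suc[symmetric]] by (simp add: add.commute)
    then show ?thesis by blast
  next
    assume "munit d reg (?c2 * ?b2)"
    then obtain g where g: "mhom d reg d reg g" "g * (?c2 * ?b2) = 1\<^sub>m d" unfolding munit_def by blast
    have c: "mhom n' \<tau> d reg (g * ?c2)" by (rule mhom_mult[OF R(2) rep_reg rep_reg c2 g(1)])
    have cb: "g * ?c2 * ?b2 = 1\<^sub>m d"
      using g(2) mhom_dim[OF g(1)] D by (simp add: mat_assoc)
    obtain q \<tau>' where s: "is_module H q \<tau>'" "iso n' \<tau> (d + q) (dsum_mod d reg q \<tau>')"
      using split_iso[OF m(2) rep_reg b2 c cb] by metis
    note Q = is_module_rep[OF s(1)]
    have 1: "iso (n' + n) (dsum_mod n' \<tau> n \<sigma>) (r * d + d) (dsum_mod (r * d) (free_mod H r) d reg)"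
      by (rule iso_trans[OF dsum_comm iso]) (intro R)+
    have 2: "iso (q + n) (dsum_mod q \<tau>' n \<sigma>) (r * d) (free_mod H r)"
      by (rule projective_peel[OF R(2,1) Q rep_free 1 s(2)])
    have "iso (n + q) (dsum_mod n \<sigma> q \<tau>') (r * d) (free_mod H r)"
      by (rule iso_trans[OF dsum_comm 2]) (intro R Q)+
    then show ?thesis using Suc.IH[OF m(1) s(1)] by blast
  qed
qed

end

section \<open>Tensor products and duals\<close>

text \<open>Tensor products encode the index pair (a,b) as \<open>a * n + b\<close>; this turns sums
  over encoded indices into double sums.\<close>

lemma sum_divmod:
  fixes f :: "nat \<Rightarrow> nat \<Rightarrow> 'a::comm_monoid_add"
  shows "(\<Sum>q<m * n. f (q div n) (q mod n)) = (\<Sum>a<m. \<Sum>b<n. f a b)"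
proof (cases "n = 0")
  case False
  have "(\<Sum>q<m * n. f (q div n) (q mod n)) = (\<Sum>(a,b)\<in>{..<m} \<times> {..<n}. f a b)"
  proof (rule sum.reindex_bij_witness[where i = "\<lambda>(a,b). a * n + b" and j = "\<lambda>q. (q div n, q mod n)"])
    fix x assume "x \<in> {..<m} \<times> {..<n}"
    then obtain a b where x: "x = (a,b)" "a < m" "b < n" by auto
    have "a * n + b < Suc a * n" using x by simp
    also have "\<dots> \<le> m * n" using x by (intro mult_right_mono) auto
    finally show "(case x of (a,b) \<Rightarrow> a * n + b) \<in> {..<m * n}" using x by simp
  qed (use False in \<open>auto simp: less_mult_imp_div_less\<close>)
  then show ?thesis by (simp add: sum.cartesian_product)
qed simp

lemma divmod_less: "r < m * n \<Longrightarrow> r div n < m" "r < m * n \<Longrightarrow> r mod n < n" for r m n :: nat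
  by (simp add: less_mult_imp_div_less, cases "n = 0", auto)

lemma sum_kd:
  fixes f :: "nat \<Rightarrow> 'a::field"
  shows "(\<Sum>q<n. kd a q * f q) = (if a < n then f a else 0)"
    "(\<Sum>q<n. kd q a * f q) = (if a < n then f a else 0)"
    "(\<Sum>q<n. f q * kd a q) = (if a < n then f a else 0)"
    "(\<Sum>q<n. f q * kd q a) = (if a < n then f a else 0)"
  by (simp_all add: kd_def if_distrib[of "\<lambda>x. x * _"] if_distrib[of "(*) _"] cong: if_cong)

lemma kd_divmod: "kd (r div n) (s div n) * kd (r mod n) (s mod n) = (kd r s :: 'a::field)" for r s n :: nat
  by (metis (full_types) kd_def div_mod_decomp mult.right_neutral mult_zero_left mult_zero_right)

context hopf_alg
begin

lemma tensor_index:
  assumes "r < n1 * n2" "s < n1 * n2"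
  shows "tensor_mod H n1 \<sigma> n2 \<tau> i $$ (r,s) =
    co i (\<lambda>j l. \<sigma> j $$ (r div n2, s div n2) * \<tau> l $$ (r mod n2, s mod n2))"
  using assms by (simp add: tensor_mod_def co_def mult.assoc)

lemma rep_tensor: "rep (n1 * n2) (tensor_mod H n1 \<sigma> n2 \<tau>)"
  by (simp add: rep_def tensor_mod_def)

lemma co_mult_co: "co i F * co j G = co i (\<lambda>p q. co j (\<lambda>r v. F p q * G r v))"
  by (simp add: co_mult_left co_mult_right)

lemma tensor_sum_mult:
  "(\<Sum>a<n1. \<Sum>b<n2. co i (\<lambda>p q. F p a * G q b) * co j (\<lambda>r v. F' r a * G' v b))
   = co i (\<lambda>p q. co j (\<lambda>r v. (\<Sum>a<n1. F p a * F' r a) * (\<Sum>b<n2. G q b * G' v b)))"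
  unfolding co_mult_co sum_product
  by (simp add: co_sum ac_simps)

text \<open>The module laws of the two factors are combined through the compatibility of Delta with
  product and unit.\<close>

lemma is_module_tensor:
  assumes "is_module H n1 \<sigma>" "is_module H n2 \<tau>"
  shows "is_module H (n1 * n2) (tensor_mod H n1 \<sigma> n2 \<tau>)"
  unfolding is_module_iff
proof (intro conjI allI impI)
  fix i j r s assume *: "i < d" "j < d" "r < n1 * n2" "s < n1 * n2"
  let ?T = "tensor_mod H n1 \<sigma> n2 \<tau>"
  note L = divmod_less[OF *(3)] divmod_less[OF *(4)]
  have "(\<Sum>c<n1 * n2. ?T i $$ (r,c) * ?T j $$ (c,s)) =
    (\<Sum>c<n1 * n2. co i (\<lambda>p q. \<sigma> p $$ (r div n2, c div n2) * \<tau> q $$ (r mod n2, c mod n2)) *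
       co j (\<lambda>p q. \<sigma> p $$ (c div n2, s div n2) * \<tau> q $$ (c mod n2, s mod n2)))"
    using * by (simp add: tensor_index)
  also have "\<dots> = (\<Sum>a<n1. \<Sum>b<n2. co i (\<lambda>p q. \<sigma> p $$ (r div n2, a) * \<tau> q $$ (r mod n2, b)) *
       co j (\<lambda>p q. \<sigma> p $$ (a, s div n2) * \<tau> q $$ (b, s mod n2)))"
    by (rule sum_divmod)
  also have "\<dots> = co i (\<lambda>p q. co j (\<lambda>u v. mu p u (\<lambda>x. \<sigma> x $$ (r div n2, s div n2)) *
       mu q v (\<lambda>x. \<tau> x $$ (r mod n2, s mod n2))))"
    unfolding tensor_sum_mult using L by (simp add: is_module_mult[OF assms(1)] is_module_mult[OF assms(2)])
  also have "\<dots> = co i (\<lambda>p q. co j (\<lambda>u v. mu p u (\<lambda>x. mu q v (\<lambda>y.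
       \<sigma> x $$ (r div n2, s div n2) * \<tau> y $$ (r mod n2, s mod n2)))))"
    by (simp add: ls_mult_left ls_mult_right)
  also have "\<dots> = mu i j (\<lambda>t. ?T t $$ (r,s))"
    using * by (simp add: mu_co tensor_index)
  finally show "(\<Sum>c<n1 * n2. ?T i $$ (r,c) * ?T j $$ (c,s)) = mu i j (\<lambda>t. ?T t $$ (r,s))" .
next
  fix r s assume *: "r < n1 * n2" "s < n1 * n2"
  note L = divmod_less[OF *(1)] divmod_less[OF *(2)]
  show "un (\<lambda>t. tensor_mod H n1 \<sigma> n2 \<tau> t $$ (r,s)) = kd r s"
    using * L by (simp add: tensor_index un_co ls_mult_left ls_mult_right
        is_module_unit[OF assms(1)] is_module_unit[OF assms(2)] kd_divmod)
qed (rule rep_tensor)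

text \<open>The pair encoding of indices is itself associative, so coassociativity yields equal
  matrices and no associativity isomorphism has to be carried along.\<close>

lemma tensor_assoc:
  assumes i: "i < d"
  shows "tensor_mod H (n1 * n2) (tensor_mod H n1 \<rho> n2 \<sigma>) n3 \<tau> i
       = tensor_mod H n1 \<rho> (n2 * n3) (tensor_mod H n2 \<sigma> n3 \<tau>) i"
proof (rule eq_matI)
  fix r s assume "r < dim_row (tensor_mod H n1 \<rho> (n2 * n3) (tensor_mod H n2 \<sigma> n3 \<tau>) i)"
    "s < dim_col (tensor_mod H n1 \<rho> (n2 * n3) (tensor_mod H n2 \<sigma> n3 \<tau>) i)"
  then have *: "r < n1 * n2 * n3" "s < n1 * n2 * n3" "r < n1 * (n2 * n3)" "s < n1 * (n2 * n3)"
    by (auto simp: tensor_mod_def mult.assoc)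
  have ix: "x div n3 div n2 = x div (n2 * n3)" "x div n3 mod n2 = x mod (n2 * n3) div n3"
    "x mod (n2 * n3) mod n3 = x mod n3" for x
  proof -
    show "x div n3 div n2 = x div (n2 * n3)" by (simp add: div_mult2_eq mult.commute[of n2])
    have m: "x mod (n2 * n3) = n3 * (x div n3 mod n2) + x mod n3"
      by (simp add: mod_mult2_eq mult.commute[of n2])
    show "x div n3 mod n2 = x mod (n2 * n3) div n3" unfolding m by (cases "n3 = 0") simp_all
    show "x mod (n2 * n3) mod n3 = x mod n3" unfolding m by simp
  qed
  show "tensor_mod H (n1 * n2) (tensor_mod H n1 \<rho> n2 \<sigma>) n3 \<tau> i $$ (r,s)
      = tensor_mod H n1 \<rho> (n2 * n3) (tensor_mod H n2 \<sigma> n3 \<tau>) i $$ (r,s)"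
    using * divmod_less[OF *(1)] divmod_less[OF *(2)] divmod_less[OF *(3)] divmod_less[OF *(4)]
    by (simp add: tensor_index ix co_mult_right[symmetric] co_mult_left[symmetric] mult.assoc coassoc[OF i])
qed (simp_all add: tensor_mod_def mult.assoc)

lemma tensor_iso_cong_left:
  assumes iso: "iso n \<sigma> n' \<sigma>'" and r: "rep n \<sigma>" "rep n' \<sigma>'"
  shows "iso (n * m) (tensor_mod H n \<sigma> m \<tau>) (n' * m) (tensor_mod H n' \<sigma>' m \<tau>)"
proof -
  obtain P Q where P: "mhom n \<sigma> n' \<sigma>' P" and Q: "mhom n' \<sigma>' n \<sigma> Q"
    and PQ: "P * Q = 1\<^sub>m n'" and nn: "n = n'"
    by (rule isoE[OF iso r]) blast
  \<comment> \<open>Kronecker product of the given map with the identity on the second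
    factor.\<close>
  define K where "K (P :: 'k mat) = mat (n * m) (n * m) (\<lambda>(r,s). P $$ (r div m, s div m) * kd (r mod m) (s mod m))" for P
  have Kc: "K P \<in> carrier_mat (n * m) (n * m)" for P by (simp add: K_def)
  have "mhom (n * m) (tensor_mod H n \<sigma> m \<tau>) (n * m) (tensor_mod H n \<sigma>' m \<tau>) (K P)"
  proof (rule mhomI[OF rep_tensor rep_tensor Kc])
    fix i a b assume *: "i < d" "a < n * m" "b < n * m"
    note L = divmod_less[OF *(2)] divmod_less[OF *(3)]
    have "(\<Sum>c<n * m. K P $$ (a,c) * tensor_mod H n \<sigma> m \<tau> i $$ (c,b))
      = (\<Sum>c<n * m. P $$ (a div m, c div m) * kd (a mod m) (c mod m) *
          co i (\<lambda>j l. \<sigma> j $$ (c div m, b div m) * \<tau> l $$ (c mod m, b mod m)))"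
      using * by (simp add: tensor_index K_def)
    also have "\<dots> = (\<Sum>x<n. \<Sum>y<m. P $$ (a div m, x) * kd (a mod m) y *
          co i (\<lambda>j l. \<sigma> j $$ (x, b div m) * \<tau> l $$ (y, b mod m)))"
      by (rule sum_divmod)
    also have "\<dots> = (\<Sum>x<n. P $$ (a div m, x) * co i (\<lambda>j l. \<sigma> j $$ (x, b div m) * \<tau> l $$ (a mod m, b mod m)))"
      using L by (simp add: mult.assoc sum_kd flip: sum_distrib_left)
    also have "\<dots> = co i (\<lambda>j l. (\<Sum>x<n. P $$ (a div m, x) * \<sigma> j $$ (x, b div m)) * \<tau> l $$ (a mod m, b mod m))"
      by (simp add: co_sum sum_distrib_right mult.assoc co_mult_left)
    also have "\<dots> = co i (\<lambda>j l. (\<Sum>x<n. \<sigma>' j $$ (a div m, x) * P $$ (x, b div m)) * \<tau> l $$ (a mod m, b mod m))"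
      using L mhom_entry[OF P r] nn by simp
    also have "\<dots> = (\<Sum>x<n. co i (\<lambda>j l. \<sigma>' j $$ (a div m, x) * \<tau> l $$ (a mod m, b mod m)) * P $$ (x, b div m))"
      by (simp add: co_sum sum_distrib_right flip: co_mult_right) (simp add: ac_simps)
    also have "\<dots> = (\<Sum>x<n. \<Sum>y<m. co i (\<lambda>j l. \<sigma>' j $$ (a div m, x) * \<tau> l $$ (a mod m, y)) *
        (P $$ (x, b div m) * kd y (b mod m)))"
      using L by (simp add: sum_kd flip: mult.assoc)
    also have "\<dots> = (\<Sum>c<n * m. co i (\<lambda>j l. \<sigma>' j $$ (a div m, c div m) * \<tau> l $$ (a mod m, c mod m)) *
        (P $$ (c div m, b div m) * kd (c mod m) (b mod m)))"
      by (rule sum_divmod[symmetric])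
    also have "\<dots> = (\<Sum>c<n * m. tensor_mod H n \<sigma>' m \<tau> i $$ (a,c) * K P $$ (c,b))"
      using * by (simp add: tensor_index K_def)
    finally show "(\<Sum>c<n * m. K P $$ (a,c) * tensor_mod H n \<sigma> m \<tau> i $$ (c,b))
      = (\<Sum>c<n * m. tensor_mod H n \<sigma>' m \<tau> i $$ (a,c) * K P $$ (c,b))" .
  qed
  moreover have "K P * K Q = 1\<^sub>m (n * m)"
  proof (rule mat_mult_oneI[OF Kc Kc])
    fix a b assume *: "a < n * m" "b < n * m"
    note L = divmod_less[OF *(1)] divmod_less[OF *(2)]
    have "(\<Sum>c<n * m. K P $$ (a,c) * K Q $$ (c,b)) = (\<Sum>c<n * m. P $$ (a div m, c div m) * kd (a mod m) (c mod m) *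
        (Q $$ (c div m, b div m) * kd (c mod m) (b mod m)))"
      using * by (simp add: K_def)
    also have "\<dots> = (\<Sum>x<n. \<Sum>y<m. P $$ (a div m, x) * kd (a mod m) y * (Q $$ (x, b div m) * kd y (b mod m)))"
      by (rule sum_divmod)
    also have "\<dots> = (\<Sum>x<n. P $$ (a div m, x) * Q $$ (x, b div m)) * kd (a mod m) (b mod m)"
      using L by (simp add: sum_kd sum_distrib_right flip: mult.assoc) (simp add: ac_simps)
    also have "(\<Sum>x<n. P $$ (a div m, x) * Q $$ (x, b div m)) = (P * Q) $$ (a div m, b div m)"
      using L nn index_mult_mat_carrier[OF mhom_carrier[OF P] mhom_carrier[OF Q]] by simp
    also have "\<dots> = kd (a div m) (b div m)" using L nn by (simp add: PQ kd_def)
    finally show "(\<Sum>c<n * m. K P $$ (a,c) * K Q $$ (c,b)) = kd a b" by (simp add: kd_divmod)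
  qed
  ultimately show ?thesis using isoI[OF rep_tensor rep_tensor _ Kc] nn by metis
qed

text \<open>The flip, given by a permutation matrix, is linear because cocommutativity allows the
  two coproduct factors to be exchanged.\<close>

lemma tensor_swap:
  assumes cc: "cocommutative H"
  shows "iso (n * m) (tensor_mod H n \<sigma> m \<tau>) (m * n) (tensor_mod H m \<tau> n \<sigma>)"
proof -
  define K where "K n m = (mat (m * n) (n * m) (\<lambda>(r,s). kd (r div n) (s mod m) * kd (r mod n) (s div m)) :: 'k mat)" for n m
  have Kc: "K n m \<in> carrier_mat (m * n) (n * m)" for n m by (simp add: K_def)
  have "mhom (n * m) (tensor_mod H n \<sigma> m \<tau>) (m * n) (tensor_mod H m \<tau> n \<sigma>) (K n m)"
  proof (rule mhomI[OF rep_tensor rep_tensor Kc])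
    fix i a b assume *: "i < d" "a < m * n" "b < n * m"
    note L = divmod_less[OF *(2)] divmod_less[OF *(3)]
    have "(\<Sum>c<n * m. K n m $$ (a,c) * tensor_mod H n \<sigma> m \<tau> i $$ (c,b))
      = (\<Sum>c<n * m. kd (a div n) (c mod m) * kd (a mod n) (c div m) *
          co i (\<lambda>j l. \<sigma> j $$ (c div m, b div m) * \<tau> l $$ (c mod m, b mod m)))"
      using * by (simp add: tensor_index K_def)
    also have "\<dots> = (\<Sum>x<n. \<Sum>y<m. kd (a div n) y * kd (a mod n) x *
          co i (\<lambda>j l. \<sigma> j $$ (x, b div m) * \<tau> l $$ (y, b mod m)))"
      by (rule sum_divmod)
    also have "\<dots> = co i (\<lambda>j l. \<sigma> j $$ (a mod n, b div m) * \<tau> l $$ (a div n, b mod m))"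
      using L by (simp add: mult.assoc sum_kd)
    also have "\<dots> = co i (\<lambda>j l. \<tau> j $$ (a div n, b mod m) * \<sigma> l $$ (a mod n, b div m))"
      by (subst co_swap[OF cc *(1), symmetric]) (simp add: mult.commute)
    also have "\<dots> = (\<Sum>x<m. \<Sum>y<n. co i (\<lambda>j l. \<tau> j $$ (a div n, x) * \<sigma> l $$ (a mod n, y)) *
          (kd x (b mod m) * kd y (b div m)))"
      using L by (simp add: sum_kd flip: mult.assoc)
    also have "\<dots> = (\<Sum>c<m * n. co i (\<lambda>j l. \<tau> j $$ (a div n, c div n) * \<sigma> l $$ (a mod n, c mod n)) *
          (kd (c div n) (b mod m) * kd (c mod n) (b div m)))"
      by (rule sum_divmod[symmetric])
    also have "\<dots> = (\<Sum>c<m * n. tensor_mod H m \<tau> n \<sigma> i $$ (a,c) * K n m $$ (c,b))"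
      using * by (simp add: tensor_index K_def)
    finally show "(\<Sum>c<n * m. K n m $$ (a,c) * tensor_mod H n \<sigma> m \<tau> i $$ (c,b))
      = (\<Sum>c<m * n. tensor_mod H m \<tau> n \<sigma> i $$ (a,c) * K n m $$ (c,b))" .
  qed
  moreover have "K n m * K m n = 1\<^sub>m (m * n)"
  proof (rule mat_mult_oneI[OF Kc Kc])
    fix a b assume *: "a < m * n" "b < m * n"
    note L = divmod_less[OF *(1)] divmod_less[OF *(2)]
    have "(\<Sum>c<n * m. K n m $$ (a,c) * K m n $$ (c,b)) = (\<Sum>c<n * m. kd (a div n) (c mod m) * kd (a mod n) (c div m) *
        (kd (c div m) (b mod n) * kd (c mod m) (b div n)))"
      using * by (simp add: K_def)
    also have "\<dots> = (\<Sum>x<n. \<Sum>y<m. kd (a div n) y * kd (a mod n) x * (kd x (b mod n) * kd y (b div n)))"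
      by (rule sum_divmod)
    also have "\<dots> = kd (a div n) (b div n) * kd (a mod n) (b mod n)"
      using L by (simp add: mult.assoc sum_kd)
    finally show "(\<Sum>c<n * m. K n m $$ (a,c) * K m n $$ (c,b)) = kd a b" by (simp add: kd_divmod)
  qed
  ultimately show ?thesis by (intro isoI[OF rep_tensor rep_tensor _ Kc]) (auto simp: mult.commute)
qed

text \<open>The first tensor factor supplies the outer index, so its blocks remain blocks of the
  tensor product.\<close>

lemma tensor_dsum_left:
  assumes r: "rep n \<sigma>" "rep n' \<sigma>'" and i: "i < d"
  shows "tensor_mod H (n + n') (dsum_mod n \<sigma> n' \<sigma>') m \<tau> i
    = dsum_mod (n * m) (tensor_mod H n \<sigma> m \<tau>) (n' * m) (tensor_mod H n' \<sigma>' m \<tau>) i"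
proof (rule eq_matI)
  note D = repD[OF dsum_rep[OF rep_tensor rep_tensor] i]
  fix a b assume "a < dim_row (dsum_mod (n * m) (tensor_mod H n \<sigma> m \<tau>) (n' * m) (tensor_mod H n' \<sigma>' m \<tau>) i)"
    "b < dim_col (dsum_mod (n * m) (tensor_mod H n \<sigma> m \<tau>) (n' * m) (tensor_mod H n' \<sigma>' m \<tau>) i)"
  then have ab: "a < n * m + n' * m" "b < n * m + n' * m" by (simp_all only: D)
  then have ab': "a < (n + n') * m" "b < (n + n') * m" by (simp_all add: algebra_simps)
  have ent: "dsum_mod k \<alpha> k' \<beta> j $$ (x,y) = (if x < k then if y < k then \<alpha> j $$ (x,y) else 0
      else if y < k then 0 else \<beta> j $$ (x - k, y - k))"
    if "j < d" "x < k + k'" "y < k + k'" "rep k \<alpha>" "rep k' \<beta>" for j x y k k' \<alpha> \<beta>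
    using that(1-3) repD[OF that(4) that(1)] repD[OF that(5) that(1)] by (auto simp: dsum_mod_def)
  have m: "m > 0" using ab' by (cases "m = 0") auto
  have dv: "x div m < n \<longleftrightarrow> x < n * m" for x by (rule div_less_iff_less_mult[OF m])
  have sb: "x div m - n = (x - n * m) div m" "x mod m = (x - n * m) mod m" if x: "\<not> x < n * m" for x
  proof -
    obtain y where "x = n * m + y" using x le_Suc_ex[of "n * m" x] by auto
    then show "x div m - n = (x - n * m) div m" "x mod m = (x - n * m) mod m" using m by simp_all
  qed
  have co0: "co i (\<lambda>j l. 0) = 0" by (simp add: co_def)
  show "tensor_mod H (n + n') (dsum_mod n \<sigma> n' \<sigma>') m \<tau> i $$ (a,b)
    = dsum_mod (n * m) (tensor_mod H n \<sigma> m \<tau>) (n' * m) (tensor_mod H n' \<sigma>' m \<tau>) i $$ (a,b)"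
    using ab ab' dv[of a] dv[of b] sb[of a] sb[of b] divmod_less[OF ab'(1)] divmod_less[OF ab'(2)]
    by (cases "a < n * m"; cases "b < n * m")
       (simp_all add: tensor_index ent[OF _ _ _ r] ent[OF i ab rep_tensor rep_tensor] co0)
qed (simp_all only: repD[OF dsum_rep[OF rep_tensor rep_tensor] i] repD[OF rep_tensor i] distrib_right)

section \<open>Tensor products with trivial and free modules\<close>

lemma tensor_triv_left:
  assumes r: "rep n \<tau>" and i: "i < d"
  shows "tensor_mod H 1 (triv_mod H) n \<tau> i = \<tau> i"
proof (rule eq_matI)
  fix a b assume "a < dim_row (\<tau> i)" "b < dim_col (\<tau> i)"
  then have "a < n" "b < n" using repD[OF r i] by auto
  then show "tensor_mod H 1 (triv_mod H) n \<tau> i $$ (a,b) = \<tau> i $$ (a,b)"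
    using tensor_index[of a 1 n b "triv_mod H" \<tau> i] by (simp add: triv_mod_def counit(1)[OF i])
qed (simp_all add: repD[OF r i], simp_all add: tensor_mod_def)

text \<open>The trivial module k^r, introduced so that the free module of rank r becomes its tensor
  product with the regular one.\<close>

definition triv_pow :: "nat \<Rightarrow> nat \<Rightarrow> 'k mat" where
  "triv_pow r i = mat r r (\<lambda>(a,b). e i * kd a b)"

lemma is_module_triv_pow: "is_module H r (triv_pow r)"
  unfolding is_module_iff
proof (intro conjI allI impI)
  fix i j a b assume *: "i < d" "j < d" "a < r" "b < r"
  have "(\<Sum>c<r. triv_pow r i $$ (a,c) * triv_pow r j $$ (c,b)) = (\<Sum>c<r. kd a c * (e i * e j * kd c b))"
    using * by (simp add: triv_pow_def ac_simps)
  also have "\<dots> = e i * e j * kd a b" using * by (simp add: sum_kd)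
  finally show "(\<Sum>c<r. triv_pow r i $$ (a,c) * triv_pow r j $$ (c,b)) = mu i j (\<lambda>s. triv_pow r s $$ (a,b))"
    using * by (simp add: triv_pow_def ls_mult_right mu_e)
next
  fix a b assume "a < r" "b < r"
  then show "un (\<lambda>s. triv_pow r s $$ (a,b)) = kd a b" by (simp add: triv_pow_def ls_mult_right un_e)
qed (simp add: rep_def triv_pow_def)

lemma free_index:
  assumes "a < r * d" "b < r * d"
  shows "free_mod H r i $$ (a,b) = kd (a div d) (b div d) * hmul H i (b mod d) (a mod d)"
  using assms by (simp add: free_mod_def kd_def)

lemma tensor_triv_pow_reg:
  assumes i: "i < d"
  shows "tensor_mod H r (triv_pow r) d reg i = free_mod H r i"
proof (rule eq_matI)
  fix a b assume "a < dim_row (free_mod H r i)" "b < dim_col (free_mod H r i)"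
  then have *: "a < r * d" "b < r * d" by (simp_all add: free_mod_def)
  note L = divmod_less[OF *(1)] divmod_less[OF *(2)]
  have "tensor_mod H r (triv_pow r) d reg i $$ (a,b)
     = co i (\<lambda>j l. e j * (kd (a div d) (b div d) * hmul H l (b mod d) (a mod d)))"
    using * L by (simp add: tensor_index triv_pow_def mult.assoc)
  then show "tensor_mod H r (triv_pow r) d reg i $$ (a,b) = free_mod H r i $$ (a,b)"
    using * by (simp add: counit(1)[OF i] free_index)
qed (simp_all add: tensor_mod_def free_mod_def)

text \<open>The map x (x) a -> a_1 x (x) a_2 trades the trivial action on the first factor for the
  given one; its inverse is x (x) a -> S(a_1) x (x) a_2.\<close>

lemma tensor_reg_free:
  assumes cc: "cocommutative H" and X: "is_module H n \<rho>"
  shows "iso (n * d) (free_mod H n) (n * d) (tensor_mod H n \<rho> d reg)"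
proof -
  define \<Theta> where "\<Theta> = mat (n * d) (n * d) (\<lambda>(r,s). co (s mod d) (\<lambda>j l. \<rho> j $$ (r div d, s div d) * kd l (r mod d)))"
  define \<Theta>' where "\<Theta>' = mat (n * d) (n * d) (\<lambda>(r,s). co (s mod d) (\<lambda>j l. an j (\<lambda>q. \<rho> q $$ (r div d, s div d)) * kd l (r mod d)))"
  have c: "\<Theta> \<in> carrier_mat (n * d) (n * d)" "\<Theta>' \<in> carrier_mat (n * d) (n * d)"
    by (simp_all add: \<Theta>_def \<Theta>'_def)
  have hom: "mhom (n * d) (free_mod H n) (n * d) (tensor_mod H n \<rho> d reg) \<Theta>"
  proof (rule mhomI[OF rep_free rep_tensor c(1)])
    fix i r s assume *: "i < d" "r < n * d" "s < n * d"
    note L = divmod_less[OF *(2)] divmod_less[OF *(3)]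
    let ?F = "\<lambda>j l. \<rho> j $$ (r div d, s div d) * kd l (r mod d)"
    have "(\<Sum>c<n * d. \<Theta> $$ (r,c) * free_mod H n i $$ (c,s)) =
      (\<Sum>c<n * d. co (c mod d) (\<lambda>j l. \<rho> j $$ (r div d, c div d) * kd l (r mod d)) *
          (kd (c div d) (s div d) * hmul H i (s mod d) (c mod d)))"
      using * by (simp add: \<Theta>_def free_index)
    also have "\<dots> = (\<Sum>x<n. \<Sum>a<d. co a (\<lambda>j l. \<rho> j $$ (r div d, x) * kd l (r mod d)) *
          (kd x (s div d) * hmul H i (s mod d) a))"
      by (rule sum_divmod)
    also have "\<dots> = (\<Sum>x<n. kd x (s div d) * (\<Sum>a<d. co a (\<lambda>j l. \<rho> j $$ (r div d, x) * kd l (r mod d)) * hmul H i (s mod d) a))"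
      by (simp add: sum_distrib_left ac_simps)
    also have "\<dots> = mu i (s mod d) (\<lambda>a. co a ?F)"
      using L by (simp add: sum_kd ls_def mult.commute)
    also have "\<dots> = co i (\<lambda>p q. co (s mod d) (\<lambda>u v. mu p u (\<lambda>a. \<rho> a $$ (r div d, s div d)) * hmul H q v (r mod d)))"
      using * L by (simp add: mu_co ls_mult_left ls_mult_right hmul_mu)
    also have "\<dots> = co i (\<lambda>p q. co (s mod d) (\<lambda>u v. (\<Sum>y<n. \<rho> p $$ (r div d, y) * \<rho> u $$ (y, s div d)) *
          (\<Sum>b<d. reg q $$ (r mod d, b) * kd v b)))"
      using L by (simp add: is_module_mult[OF X] sum_kd)
    also have "\<dots> = (\<Sum>y<n. \<Sum>b<d. co i (\<lambda>p q. \<rho> p $$ (r div d, y) * reg q $$ (r mod d, b)) *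
         co (s mod d) (\<lambda>u v. \<rho> u $$ (y, s div d) * kd v b))"
      by (rule tensor_sum_mult[symmetric])
    also have "\<dots> = (\<Sum>c<n * d. co i (\<lambda>p q. \<rho> p $$ (r div d, c div d) * reg q $$ (r mod d, c mod d)) *
         co (s mod d) (\<lambda>u v. \<rho> u $$ (c div d, s div d) * kd v (c mod d)))"
      by (rule sum_divmod[symmetric])
    also have "\<dots> = (\<Sum>c<n * d. tensor_mod H n \<rho> d reg i $$ (r,c) * \<Theta> $$ (c,s))"
      using * by (simp add: tensor_index \<Theta>_def)
    finally show "(\<Sum>c<n * d. \<Theta> $$ (r,c) * free_mod H n i $$ (c,s))
       = (\<Sum>c<n * d. tensor_mod H n \<rho> d reg i $$ (r,c) * \<Theta> $$ (c,s))" .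
  qed
  have "\<Theta>' * \<Theta> = 1\<^sub>m (n * d)"
  proof (rule mat_mult_oneI[OF c(2,1)])
    fix r s assume *: "r < n * d" "s < n * d"
    note L = divmod_less[OF *(1)] divmod_less[OF *(2)]
    have "(\<Sum>c<n * d. \<Theta>' $$ (r,c) * \<Theta> $$ (c,s)) =
      (\<Sum>c<n * d. co (c mod d) (\<lambda>j l. an j (\<lambda>q. \<rho> q $$ (r div d, c div d)) * kd l (r mod d)) *
         co (s mod d) (\<lambda>j' l'. \<rho> j' $$ (c div d, s div d) * kd l' (c mod d)))"
      using * by (simp add: \<Theta>_def \<Theta>'_def)
    also have "\<dots> = (\<Sum>y<n. \<Sum>b<d. co b (\<lambda>j l. an j (\<lambda>q. \<rho> q $$ (r div d, y)) * kd l (r mod d)) *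
         co (s mod d) (\<lambda>j' l'. \<rho> j' $$ (y, s div d) * kd l' b))"
      by (rule sum_divmod)
    also have "\<dots> = co (s mod d) (\<lambda>j' l'. \<Sum>y<n. \<Sum>b<d. kd l' b *
         (co b (\<lambda>j l. an j (\<lambda>q. \<rho> q $$ (r div d, y)) * kd l (r mod d)) * \<rho> j' $$ (y, s div d)))"
      by (simp add: co_sum flip: co_mult_left) (simp add: ac_simps)
    also have "\<dots> = co (s mod d) (\<lambda>j' l'. \<Sum>y<n. co l' (\<lambda>j l. an j (\<lambda>q. \<rho> q $$ (r div d, y)) * kd l (r mod d)) * \<rho> j' $$ (y, s div d))"
      by (simp add: sum_kd)
    also have "\<dots> = co (s mod d) (\<lambda>j' l'. co l' (\<lambda>j l. an j (\<lambda>q. \<Sum>y<n. \<rho> q $$ (r div d, y) * \<rho> j' $$ (y, s div d)) * kd l (r mod d)))"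
      by (simp add: co_sum ls_sum sum_distrib_right flip: co_mult_right ls_mult_right) (simp add: ac_simps)
    also have "\<dots> = co (s mod d) (\<lambda>j' l'. co l' (\<lambda>j l. an j (\<lambda>q. mu q j' (\<lambda>t. \<rho> t $$ (r div d, s div d))) * kd l (r mod d)))"
      using L by (simp add: is_module_mult[OF X])
    also have "\<dots> = co (s mod d) (\<lambda>m l. co m (\<lambda>j' j. an j (\<lambda>q. mu q j' (\<lambda>t. \<rho> t $$ (r div d, s div d)))) * kd l (r mod d))"
      using L by (simp add: coassoc[symmetric] co_mult_right)
    \<comment> \<open>The composite produces S(a_2) a_1; cocommutativity turns this into S(a_1) a_2,
      the order of the antipode axiom.\<close>
    also have "\<dots> = co (s mod d) (\<lambda>m l. co m (\<lambda>j j'. an j (\<lambda>q. mu q j' (\<lambda>t. \<rho> t $$ (r div d, s div d)))) * kd l (r mod d))"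
      by (intro co_cong refl arg_cong2[of _ _ _ _ "(*)"] co_swap[OF cc])
    also have "\<dots> = co (s mod d) (\<lambda>m l. e m * (kd (r div d) (s div d) * kd l (r mod d)))"
      using L by (simp add: antip is_module_unit[OF X] mult.assoc)
    also have "\<dots> = kd (r div d) (s div d) * kd (s mod d) (r mod d)"
      by (rule counit(1)[OF L(4)])
    also have "\<dots> = kd r s" using kd_divmod[of r d s] by (simp add: kd_def eq_commute)
    finally show "(\<Sum>c<n * d. \<Theta>' $$ (r,c) * \<Theta> $$ (c,s)) = kd r s" .
  qed
  then have "\<Theta> * \<Theta>' = 1\<^sub>m (n * d)" using c by (metis mat_mult_left_right_inverse)
  then show ?thesis by (intro isoI[OF rep_free rep_tensor hom c(2)]) auto
qed

text \<open>Flip the factors, write A^r as k^r (x) A, rebracket, and apply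
  \<open>tensor_reg_free\<close> to V (x) k^r.\<close>

lemma tensor_free_left:
  assumes cc: "cocommutative H" and X: "is_module H n \<rho>"
  shows "iso (r * d * n) (tensor_mod H (r * d) (free_mod H r) n \<rho>) (n * r * d) (free_mod H (n * r))"
proof -
  have 1: "iso (r * d * n) (tensor_mod H (r * d) (free_mod H r) n \<rho>) (n * (r * d)) (tensor_mod H n \<rho> (r * d) (free_mod H r))"
    by (rule tensor_swap[OF cc])
  have "tensor_mod H n \<rho> (r * d) (free_mod H r) i = tensor_mod H n \<rho> (r * d) (tensor_mod H r (triv_pow r) d reg) i" if "i < d" for i
    unfolding tensor_mod_def[of H n] by (intro cong_mat refl) (auto simp: tensor_triv_pow_reg)
  then have 2: "iso (n * (r * d)) (tensor_mod H n \<rho> (r * d) (free_mod H r)) (n * r * d) (tensor_mod H (n * r) (tensor_mod H n \<rho> r (triv_pow r)) d reg)"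
    by (intro iso_eqI rep_tensor) (simp_all add: tensor_assoc mult.assoc)
  have 3: "iso (n * r * d) (tensor_mod H (n * r) (tensor_mod H n \<rho> r (triv_pow r)) d reg) (n * r * d) (free_mod H (n * r))"
    by (intro iso_sym[OF tensor_reg_free] cc is_module_tensor X is_module_triv_pow rep_free rep_tensor)
  show ?thesis by (rule iso_trans[OF iso_trans[OF 1 2] 3]) (intro rep_free rep_tensor)+
qed

section \<open>Dual modules\<close>

lemma dual_index:
  assumes "a < n" "b < n"
  shows "dual_mod H n \<rho> i $$ (a,b) = an i (\<lambda>s. \<rho> s $$ (b,a))"
  using assms by (simp add: dual_mod_def lincomb_def ls_def)

lemma rep_dual: "rep n (dual_mod H n \<rho>)"
  by (simp add: rep_def dual_mod_def lincomb_def)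

text \<open>Transposition and the antipode both reverse products, and the two reversals
  cancel.\<close>

lemma is_module_dual:
  assumes X: "is_module H n \<rho>"
  shows "is_module H n (dual_mod H n \<rho>)"
  unfolding is_module_iff
proof (intro conjI allI impI)
  fix i j a b assume *: "i < d" "j < d" "a < n" "b < n"
  have "(\<Sum>c<n. dual_mod H n \<rho> i $$ (a,c) * dual_mod H n \<rho> j $$ (c,b))
     = (\<Sum>c<n. an j (\<lambda>q. \<rho> q $$ (b,c)) * an i (\<lambda>p. \<rho> p $$ (c,a)))"
    using * by (simp add: dual_index mult.commute)
  also have "\<dots> = an j (\<lambda>q. an i (\<lambda>p. \<Sum>c<n. \<rho> q $$ (b,c) * \<rho> p $$ (c,a)))"
    by (simp add: ls_sum ls_mult_left ls_mult_right)
  also have "\<dots> = mu i j (\<lambda>s. dual_mod H n \<rho> s $$ (a,b))"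
    using * by (simp add: is_module_mult[OF X] an_mu dual_index)
  finally show "(\<Sum>c<n. dual_mod H n \<rho> i $$ (a,c) * dual_mod H n \<rho> j $$ (c,b))
     = mu i j (\<lambda>s. dual_mod H n \<rho> s $$ (a,b))" .
next
  fix a b assume "a < n" "b < n"
  then show "un (\<lambda>s. dual_mod H n \<rho> s $$ (a,b)) = kd a b"
    by (simp add: dual_index un_an is_module_unit[OF X]) (simp add: kd_def)
qed (rule rep_dual)

end

section \<open>Integrals\<close>

text \<open>The common bound on supports keeps all bases finite; a basis of \<open>K\<close> can
  then be enlarged by a vector of \<open>I\<close> outside \<open>K\<close>.\<close>

lemma fun_subspace_dim_less:
  fixes K I :: "(nat \<Rightarrow> 'a::field) set"
  assumes K: "fun_space.subspace K" and KI: "K \<subset> I" and supp: "\<And>v i. v \<in> I \<Longrightarrow> i \<ge> n \<Longrightarrow> v i = 0"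
  shows "fun_space.dim K < fun_space.dim I"
proof -
  obtain B where B: "B \<subseteq> K" "fun_space.independent B" "K \<subseteq> fun_space.span B" "card B = fun_space.dim K"
    by (rule fun_space.basis_exists)
  obtain C where C: "C \<subseteq> I" "fun_space.independent C" "I \<subseteq> fun_space.span C" "card C = fun_space.dim I"
    by (rule fun_space.basis_exists)
  have fin: "finite B" "finite C"
    using independent_finitely_supported[OF B(2), of n] independent_finitely_supported[OF C(2), of n] B(1) C(1) KI supp by blast+
  obtain v where v: "v \<in> I" "v \<notin> K" using KI by blast
  then have nv: "v \<notin> fun_space.span B" using fun_space.span_minimal[OF B(1) K] by blast
  then have "v \<notin> B" using fun_space.span_base by blast
  moreover have "fun_space.independent (insert v B)"
    using B(2) nv by (simp add: fun_space.independent_insert)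
  moreover have "insert v B \<subseteq> fun_space.span C" using v B(1) KI C(3) by blast
  ultimately have "Suc (card B) \<le> card C"
    using fun_space.independent_span_bound[OF fin(2), of "insert v B"] fin by simp
  then show ?thesis using B(4) C(4) by simp
qed

context local_hopf_alg
begin

text \<open>Right ideals, required to be subspaces so that their dimensions can be compared.\<close>

definition right_stable :: "(nat \<Rightarrow> 'k) set \<Rightarrow> bool" where
  "right_stable I \<longleftrightarrow> I \<subseteq> helems H \<and> fun_space.subspace I \<and> (\<forall>x\<in>I. \<forall>a\<in>helems H. hprod H x a \<in> I)"

lemma ls_diff_elem: "ls (\<lambda>l. x l - y l) f = ls x f - ls y f"
  by (simp add: ls_def algebra_simps sum_subtractf)

text \<open>A nonzero vector $v$ in a minimal right ideal satisfies $vJ = 0$ for the augmentation ideal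
  $J$: otherwise $vJ$ would be the whole ideal, so $v = vj$ with $1 - j$ a unit.\<close>

lemma right_integral_exists:
  obtains sg where "sg \<in> helems H" "sg \<noteq> (\<lambda>_. 0)"
    "\<And>h f. h < d \<Longrightarrow> ls sg (\<lambda>s. mu s h f) = e h * ls sg f"
proof -
  let ?P = "\<lambda>I. right_stable I \<and> (\<exists>x\<in>I. x \<noteq> (\<lambda>_. 0))"
  have "hone \<noteq> (\<lambda>_. 0)" using un_e ls_hone[of e] by (auto simp: ls_def)
  moreover have "right_stable (helems H)"
    unfolding right_stable_def fun_space.subspace_def using hprod_helems by (auto simp: helems_def)
  ultimately have "?P (helems H)" using hone_helems by blast
  \<comment> \<open>Minimality is measured by dimension, so a right ideal properly contained in
    \<open>I\<close> has to vanish.\<close>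
  then obtain I where I: "?P I" and min: "\<And>K. ?P K \<Longrightarrow> fun_space.dim I \<le> fun_space.dim K"
    using ex_has_least_nat[of ?P "helems H" fun_space.dim] by blast
  then obtain v where v: "v \<in> I" "v \<noteq> (\<lambda>_. 0)" by blast
  have Ih: "I \<subseteq> helems H" and vh: "v \<in> helems H" using I v unfolding right_stable_def by auto
  let ?J = "{j \<in> helems H. ls j e = 0}"
  let ?K = "hprod H v ` ?J"
  have Jz: "(\<lambda>_. 0) \<in> ?J" by (simp add: helems_def ls_def)
  have Ks: "right_stable ?K"
    unfolding right_stable_def fun_space.subspace_def
  proof (intro conjI ballI allI)
    show "?K \<subseteq> helems H" using hprod_helems by auto
    have "hprod H v (\<lambda>_. 0) = 0" by (auto simp: hprod_def)
    then show "0 \<in> ?K" using Jz by force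
    show "x + y \<in> ?K" if xy: "x \<in> ?K" "y \<in> ?K" for x y
    proof -
      obtain i j where ij: "i \<in> ?J" "j \<in> ?J" "x = hprod H v i" "y = hprod H v j" using xy by blast
      have "x + y = hprod H v (\<lambda>l. i l + j l)" using ij by (auto simp: hprod_add)
      moreover have "(\<lambda>l. i l + j l) \<in> ?J" using ij by (auto simp: ls_add_elem helems_def)
      ultimately show ?thesis by blast
    qed
    show "(\<lambda>l. c * x l) \<in> ?K" if x: "x \<in> ?K" for c x
    proof -
      obtain i where i: "i \<in> ?J" "x = hprod H v i" using x by blast
      have "(\<lambda>l. c * x l) = hprod H v (\<lambda>l. c * i l)"
        unfolding i by (auto simp: hprod_def sum_distrib_left ac_simps)
      moreover have "(\<lambda>l. c * i l) \<in> ?J" using i by (auto simp: ls_scale helems_def)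
      ultimately show ?thesis by blast
    qed
    show "hprod H x a \<in> ?K" if x: "x \<in> ?K" and a: "a \<in> helems H" for x a
    proof -
      obtain i where i: "i \<in> ?J" "x = hprod H v i" using x by blast
      have "ls (hprod H i a) e = ls i e * ls a e" by (simp add: ls_hprod mu_e ls_mult_left ls_mult_right)
      then have "hprod H i a \<in> ?J" using i hprod_helems by simp
      then show ?thesis unfolding i hprod_assoc by blast
    qed
  qed
  have KI: "?K \<subseteq> I" using I v(1) unfolding right_stable_def by auto
  have ne: "?K \<noteq> I"
  proof
    assume "?K = I"
    then obtain j where j: "j \<in> helems H" "ls j e = 0" "v = hprod H v j" using v by blast
    let ?u = "\<lambda>l. hone l - j l"
    have "?u \<in> helems H" using j hone_helems by (auto simp: helems_def)
    moreover have "ls ?u e \<noteq> 0" using j by (simp add: ls_diff_elem ls_hone un_e)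
    ultimately obtain a where a: "hprod H ?u a = hone" using two_sided_inverse by blast
    have "hprod H v ?u = (\<lambda>l. hprod H v hone l - hprod H v j l)"
      by (auto simp: hprod_def algebra_simps sum_subtractf)
    then have "hprod H v ?u = (\<lambda>_. 0)" using j(3) hprod_hone(2)[OF vh] by simp
    then have "hprod H v (hprod H ?u a) = (\<lambda>_. 0)" unfolding hprod_assoc[symmetric] by (auto simp: hprod_def)
    then show False using v(2) a hprod_hone(2)[OF vh] by simp
  qed
  have "fun_space.dim ?K < fun_space.dim I"
  proof (rule fun_subspace_dim_less[where n = d])
    show "fun_space.subspace ?K" using Ks unfolding right_stable_def by blast
    show "?K \<subset> I" using KI ne by blast
    show "\<And>w i. w \<in> I \<Longrightarrow> i \<ge> d \<Longrightarrow> w i = 0" using Ih unfolding helems_def by blast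
  qed
  then have "\<not> (\<exists>x\<in>?K. x \<noteq> (\<lambda>_. 0))" using min[of ?K] Ks by force
  then have vj: "hprod H v j = (\<lambda>_. 0)" if "j \<in> ?J" for j using that by blast
  have "ls v (\<lambda>s. mu s h f) = e h * ls v f" if h: "h < d" for h f
  proof -
    \<comment> \<open>The element e_h - eps(e_h) 1 of the augmentation ideal; that \<open>v\<close>
      annihilates it is the integral property at \<open>h\<close>.\<close>
    let ?j = "\<lambda>l. kd h l - e h * hone l"
    have k: "ls (kd h) g = g h" for g using ls_kd'[OF h] by (simp add: ls_def)
    have "?j \<in> helems H" using h hone_helems by (auto simp: helems_def kd_def)
    then have "?j \<in> ?J" by (simp add: ls_diff_elem ls_scale k ls_hone un_e)
    then have "0 = ls (hprod H v ?j) f" by (simp add: vj ls_def)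
    also have "\<dots> = ls v (\<lambda>s. mu s h f - e h * un (\<lambda>t. mu s t f))"
      by (simp add: ls_hprod ls_diff_elem ls_scale k ls_hone)
    also have "\<dots> = ls v (\<lambda>s. mu s h f) - e h * ls v f"
      by (simp add: un_mu) (simp add: ls_def algebra_simps sum_subtractf sum_distrib_left)
    finally show ?thesis by simp
  qed
  then show ?thesis using that vh v(2) by blast
qed

text \<open>Normalised so that $\sum S(s_1)\, x_0(s_2) = 1$.\<close>

lemma integral_functional_exists:
  obtains sg x0 where "\<And>h f. h < d \<Longrightarrow> ls sg (\<lambda>s. mu s h f) = e h * ls sg f"
    "\<And>f. ls sg (\<lambda>s. co s (\<lambda>p q. an p f * x0 q)) = un f"
proof -
  obtain sg where sg: "sg \<in> helems H" "sg \<noteq> (\<lambda>_. 0)"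
    and int: "\<And>h f. h < d \<Longrightarrow> ls sg (\<lambda>s. mu s h f) = e h * ls sg f"
    using right_integral_exists by blast
  obtain l0 where l0: "l0 < d" "sg l0 \<noteq> 0"
    using sg unfolding helems_def by (metis (mono_tags) mem_Collect_eq not_less ext)
  \<comment> \<open>With the coordinate functional at \<open>l0\<close>, the element u = sum S(s_1)
    x(s_2) has augmentation x(s) = \<open>sg l0\<close>, which is nonzero, so u is a unit by
    locality.\<close>
  define x :: "nat \<Rightarrow> 'k" where "x q = kd q l0" for q
  define u where "u l = (if l < d then ls sg (\<lambda>s. co s (\<lambda>p q. an p (\<lambda>t. kd t l) * x q)) else 0)" for l
  have u: "ls u f = ls sg (\<lambda>s. co s (\<lambda>p q. an p f * x q))" for f
  proof -
    have "ls u f = (\<Sum>l<d. ls sg (\<lambda>s. co s (\<lambda>p q. an p (\<lambda>t. kd t l * f l) * x q)))"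
      unfolding ls_def[of u] u_def
    proof (intro sum.cong refl)
      fix l assume l: "l \<in> {..<d}"
      have r: "a * f l * c = a * c * f l" for a c by simp
      show "(if l < d then ls sg (\<lambda>s. co s (\<lambda>p q. an p (\<lambda>t. kd t l) * x q)) else 0) * f l
        = ls sg (\<lambda>s. co s (\<lambda>p q. an p (\<lambda>t. kd t l * f l) * x q))"
        using l by (simp add: ls_mult_right r) (simp only: co_mult_right ls_mult_right)
    qed
    also have "\<dots> = ls sg (\<lambda>s. co s (\<lambda>p q. an p (\<lambda>t. \<Sum>l<d. kd t l * f l) * x q))"
      by (simp add: ls_sum co_sum sum_distrib_right)
    also have "\<dots> = ls sg (\<lambda>s. co s (\<lambda>p q. an p f * x q))" by (simp add: ls_kd')
    finally show ?thesis .
  qed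
  have "ls u e = ls sg (\<lambda>s. co s (\<lambda>p q. e p * x q))" by (simp add: u an_e)
  also have "\<dots> = sg l0" using l0 by (simp add: counit(1) x_def ls_kd)
  finally have "ls u e \<noteq> 0" using l0 by simp
  moreover have "u \<in> helems H" by (simp add: u_def helems_def)
  ultimately obtain y where y: "hprod H y u = hone" using two_sided_inverse by blast
  \<comment> \<open>The functional q -> x(q y), where y u = 1: the shift identity moves y in front
    of S(s_1), which turns u into y u = 1.\<close>
  define x0 where "x0 q = ls y (\<lambda>j. mu q j x)" for q
  have "ls sg (\<lambda>s. co s (\<lambda>p q. an p f * x0 q)) = un f" for f
  proof -
    have "ls sg (\<lambda>s. co s (\<lambda>p q. an p f * x0 q)) = 
       ls y (\<lambda>h. ls sg (\<lambda>s. co s (\<lambda>p q. an p (\<lambda>a. mu q h (\<lambda>b. f a * x b)))))"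
      unfolding x0_def
      by (subst ls_swap) (simp add: ls_co ls_mult_left ls_mult_right)
    also have "\<dots> = ls y (\<lambda>h. ls sg (\<lambda>s. co s (\<lambda>p q. an p (\<lambda>a. mu h a (\<lambda>b. f b * x q)))))"
      by (simp add: right_integral_shift[OF int, symmetric])
    also have "\<dots> = ls y (\<lambda>h. ls u (\<lambda>a. mu h a f))" by (simp add: u ls_mult_right)
    also have "\<dots> = ls (hprod H y u) f" by (simp add: ls_hprod)
    finally show ?thesis by (simp add: y ls_hone)
  qed
  then show ?thesis using that int by blast
qed

end

section \<open>Module maps into and out of free modules\<close>

context hopf_alg
begin

lemma block_less: "j < r \<Longrightarrow> l < m \<Longrightarrow> j * m + l < r * m" for j r l m :: nat
proof -
  assume "j < r" "l < m"
  then have "j * m + l < Suc j * m" by simp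
  also have "\<dots> \<le> r * m" using \<open>j < r\<close> by (intro mult_right_mono) auto
  finally show ?thesis .
qed

lemma free_row:
  assumes "R < r * d"
  shows "(\<Sum>C<r * d. free_mod H r i $$ (R,C) * f C) = (\<Sum>l<d. hmul H i l (R mod d) * f (R div d * d + l))"
proof -
  have "(\<Sum>C<r * d. free_mod H r i $$ (R,C) * f C) = (\<Sum>C<r * d. kd (R div d) (C div d) *
      (hmul H i (C mod d) (R mod d) * f (C div d * d + C mod d)))"
    using assms by (simp add: free_index mult.assoc)
  also have "\<dots> = (\<Sum>x<r. \<Sum>l<d. kd (R div d) x * (hmul H i l (R mod d) * f (x * d + l)))"
    by (rule sum_divmod)
  also have "\<dots> = (\<Sum>l<d. hmul H i l (R mod d) * f (R div d * d + l))"
    using divmod_less[OF assms] by (simp add: sum_kd flip: sum_distrib_left)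
  finally show ?thesis .
qed

lemma free_col:
  assumes "S < r * d"
  shows "(\<Sum>C<r * d. f C * free_mod H r i $$ (C,S)) = mu i (S mod d) (\<lambda>l. f (S div d * d + l))"
proof -
  have "(\<Sum>C<r * d. f C * free_mod H r i $$ (C,S)) = (\<Sum>C<r * d. kd (C div d) (S div d) *
      (hmul H i (S mod d) (C mod d) * f (C div d * d + C mod d)))"
    using assms by (simp add: free_index ac_simps)
  also have "\<dots> = (\<Sum>x<r. \<Sum>l<d. kd x (S div d) * (hmul H i (S mod d) l * f (x * d + l)))"
    by (rule sum_divmod)
  also have "\<dots> = mu i (S mod d) (\<lambda>l. f (S div d * d + l))"
    using divmod_less[OF assms] by (simp add: sum_kd ls_def flip: sum_distrib_left)
  finally show ?thesis .
qed

text \<open>For a right integral $s$, the rows $X_j$ and the columns $Y_j$ give the module maps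
  $v \mapsto \big(\sum S(s_1)\, X_j(s_2 v)\big)_j$ into, and $e_j \mapsto Y_j$ out of, the free module $A^r$.\<close>

definition to_free :: "(nat \<Rightarrow> 'k) \<Rightarrow> nat \<Rightarrow> nat \<Rightarrow> (nat \<Rightarrow> nat \<Rightarrow> 'k) \<Rightarrow> (nat \<Rightarrow> 'k mat) \<Rightarrow> 'k mat" where
  "to_free sg r n X \<rho> = mat (r * d) n (\<lambda>(R,b). ls sg (\<lambda>s. co s (\<lambda>p q.
     an p (\<lambda>t. kd t (R mod d)) * (\<Sum>c<n. X (R div d) c * \<rho> q $$ (c,b)))))"

definition from_free :: "nat \<Rightarrow> nat \<Rightarrow> (nat \<Rightarrow> nat \<Rightarrow> 'k) \<Rightarrow> (nat \<Rightarrow> 'k mat) \<Rightarrow> 'k mat" where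
  "from_free r n Y \<rho> = mat n (r * d) (\<lambda>(a,C). \<Sum>c<n. \<rho> (C mod d) $$ (a,c) * Y (C div d) c)"

lemma to_free_carrier: "to_free sg r n X \<rho> \<in> carrier_mat (r * d) n"
  by (simp add: to_free_def)

lemma from_free_carrier: "from_free r n Y \<rho> \<in> carrier_mat n (r * d)"
  by (simp add: from_free_def)

text \<open>Linearity is the shift identity of the integral: acting with h on v multiplies s_2 by h
  on the right, and h reappears in front of S(s_1).\<close>

lemma to_free_mhom:
  assumes int: "\<And>h f. h < d \<Longrightarrow> ls sg (\<lambda>s. mu s h f) = e h * ls sg f" and V: "is_module H n \<rho>"
  shows "mhom n \<rho> (r * d) (free_mod H r) (to_free sg r n X \<rho>)"
proof (rule mhomI[OF is_module_rep[OF V] rep_free to_free_carrier])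
  fix i R b assume *: "i < d" "R < r * d" "b < n"
  note L = divmod_less[OF *(2)]
  let ?l = "R mod d"
  define g where "g c q = (\<Sum>c'<n. X (R div d) c' * \<rho> q $$ (c',c))" for c q
  have tf: "to_free sg r n X \<rho> $$ (R,c) = ls sg (\<lambda>s. co s (\<lambda>p q. an p (\<lambda>t. kd t ?l) * g c q))" if "c < n" for c
    using that * by (simp add: to_free_def g_def)
  have g: "(\<Sum>c<n. g c q * \<rho> i $$ (c,b)) = mu q i (g b)" if "q < d" for q
  proof -
    have "(\<Sum>c<n. g c q * \<rho> i $$ (c,b)) = (\<Sum>c'<n. X (R div d) c' * (\<Sum>c<n. \<rho> q $$ (c',c) * \<rho> i $$ (c,b)))"
      unfolding g_def sum_distrib_left sum_distrib_right by (subst sum.swap) (simp add: mult.assoc)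
    also have "\<dots> = mu q i (g b)"
      using that * by (simp add: is_module_mult[OF V] g_def[abs_def] ls_sum ls_mult_left)
    finally show ?thesis .
  qed
  have "(\<Sum>c<n. to_free sg r n X \<rho> $$ (R,c) * \<rho> i $$ (c,b))
    = ls sg (\<lambda>s. co s (\<lambda>p q. an p (\<lambda>t. kd t ?l) * (\<Sum>c<n. g c q * \<rho> i $$ (c,b))))"
    by (simp add: tf sum_distrib_left co_sum ls_sum co_mult_right ls_mult_right flip: mult.assoc)
  also have "\<dots> = ls sg (\<lambda>s. co s (\<lambda>p q. an p (\<lambda>a. mu q i (\<lambda>y. kd a ?l * g b y))))"
    by (simp add: g ls_mult_left ls_mult_right)
  also have "\<dots> = ls sg (\<lambda>s. co s (\<lambda>p q. an p (\<lambda>a. mu i a (\<lambda>y. kd y ?l * g b q))))"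
    by (rule right_integral_shift[OF int *(1), symmetric])
  also have "\<dots> = ls sg (\<lambda>s. co s (\<lambda>p q. an p (\<lambda>a. \<Sum>c<d. hmul H i c ?l * kd a c) * g b q))"
    using L by (simp add: ls_mult_right sum_kd hmul_mu)
  also have "\<dots> = (\<Sum>c<d. hmul H i c ?l * ls sg (\<lambda>s. co s (\<lambda>p q. an p (\<lambda>t. kd t c) * g b q)))"
    by (simp add: ls_sum ls_mult_left sum_distrib_right co_sum co_mult_left mult.assoc)
  also have "\<dots> = (\<Sum>c<d. hmul H i c ?l * to_free sg r n X \<rho> $$ (R div d * d + c, b))"
  proof (intro sum.cong refl)
    fix c assume "c \<in> {..<d}"
    moreover from this L have "R div d * d + c < r * d"
      by (intro block_less) auto
    ultimately show "hmul H i c ?l * ls sg (\<lambda>s. co s (\<lambda>p q. an p (\<lambda>t. kd t c) * g b q))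
       = hmul H i c ?l * to_free sg r n X \<rho> $$ (R div d * d + c, b)"
      using * by (simp add: to_free_def g_def)
  qed
  also have "\<dots> = (\<Sum>C<r * d. free_mod H r i $$ (R,C) * to_free sg r n X \<rho> $$ (C,b))"
    by (rule free_row[OF *(2), symmetric])
  finally show "(\<Sum>c<n. to_free sg r n X \<rho> $$ (R,c) * \<rho> i $$ (c,b))
     = (\<Sum>C<r * d. free_mod H r i $$ (R,C) * to_free sg r n X \<rho> $$ (C,b))" .
qed

text \<open>The column with index (j, l) is e_l applied to Y_j, so left multiplication on the free
  module matches the action.\<close>

lemma from_free_mhom:
  assumes V: "is_module H n \<rho>"
  shows "mhom (r * d) (free_mod H r) n \<rho> (from_free r n Y \<rho>)"
proof (rule mhomI[OF rep_free is_module_rep[OF V] from_free_carrier])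
  fix i a S assume *: "i < d" "a < n" "S < r * d"
  note L = divmod_less[OF *(3)]
  have "(\<Sum>C<r * d. from_free r n Y \<rho> $$ (a,C) * free_mod H r i $$ (C,S))
     = mu i (S mod d) (\<lambda>l. from_free r n Y \<rho> $$ (a, S div d * d + l))"
    by (rule free_col[OF *(3)])
  also have "\<dots> = mu i (S mod d) (\<lambda>l. \<Sum>c<n. \<rho> l $$ (a,c) * Y (S div d) c)"
    using * L by (simp add: from_free_def block_less)
  also have "\<dots> = (\<Sum>c<n. (\<Sum>x<n. \<rho> i $$ (a,x) * \<rho> (S mod d) $$ (x,c)) * Y (S div d) c)"
    using * L by (simp add: is_module_mult[OF V] ls_sum ls_mult_right)
  also have "\<dots> = (\<Sum>x<n. \<rho> i $$ (a,x) * from_free r n Y \<rho> $$ (x,S))"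
    using * unfolding sum_distrib_right by (subst sum.swap) (simp add: from_free_def sum_distrib_left mult.assoc)
  finally show "(\<Sum>C<r * d. from_free r n Y \<rho> $$ (a,C) * free_mod H r i $$ (C,S))
     = (\<Sum>x<n. \<rho> i $$ (a,x) * from_free r n Y \<rho> $$ (x,S))" .
qed

text \<open>The encoding functionals are x0 composed with the components of the map. By the shift
  identity and the normalisation, sum S(s_1) x0(s_2 y) = y sum S(s_1) x0(s_2) = y, which is applied
  with y a component of the image vector.\<close>

lemma mhom_to_free_eq:
  assumes int: "\<And>h f. h < d \<Longrightarrow> ls sg (\<lambda>s. mu s h f) = e h * ls sg f"
    and x0: "\<And>f. ls sg (\<lambda>s. co s (\<lambda>p q. an p f * x0 q)) = un f"
    and V: "is_module H n \<rho>" and hom: "mhom n \<rho> (r * d) (free_mod H r) \<Psi>"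
  shows "to_free sg r n (\<lambda>j b. \<Sum>c<d. x0 c * \<Psi> $$ (j * d + c, b)) \<rho> = \<Psi>"
proof (rule eq_matI)
  fix R b assume "R < dim_row \<Psi>" "b < dim_col \<Psi>"
  then have *: "R < r * d" "b < n" using mhom_dim[OF hom] by auto
  note L = divmod_less[OF *(1)]
  let ?l = "R mod d" and ?j = "R div d"
  have row: "(\<Sum>c<n. \<Psi> $$ (?j * d + l, c) * \<rho> q $$ (c,b)) = (\<Sum>l'<d. hmul H q l' l * \<Psi> $$ (?j * d + l', b))"
    if "q < d" "l < d" for q l
  proof -
    have lt: "?j * d + l < r * d" using L that by (intro block_less)
    show ?thesis
      using mhom_entry[OF hom is_module_rep[OF V] rep_free that(1) lt *(2)] free_row[OF lt, of q "\<lambda>C. \<Psi> $$ (C,b)"] that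
      by simp
  qed
  have sum: "(\<Sum>c<n. (\<Sum>l<d. x0 l * \<Psi> $$ (?j * d + l, c)) * \<rho> q $$ (c,b))
     = (\<Sum>l'<d. \<Psi> $$ (?j * d + l', b) * mu q l' x0)" if q: "q < d" for q
  proof -
    have "(\<Sum>c<n. (\<Sum>l<d. x0 l * \<Psi> $$ (?j * d + l, c)) * \<rho> q $$ (c,b))
      = (\<Sum>l<d. x0 l * (\<Sum>c<n. \<Psi> $$ (?j * d + l, c) * \<rho> q $$ (c,b)))"
      unfolding sum_distrib_right sum_distrib_left by (subst sum.swap) (simp add: mult.assoc)
    also have "\<dots> = (\<Sum>l<d. \<Sum>l'<d. x0 l * (hmul H q l' l * \<Psi> $$ (?j * d + l', b)))"
      using q by (simp add: row sum_distrib_left)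
    also have "\<dots> = (\<Sum>l'<d. \<Psi> $$ (?j * d + l', b) * mu q l' x0)"
      by (subst sum.swap) (simp add: ls_def sum_distrib_left sum_distrib_right mult.assoc mult.left_commute mult.commute)
    finally show ?thesis .
  qed
  have unit: "ls sg (\<lambda>s. co s (\<lambda>p q. an p (\<lambda>t. kd t ?l) * mu q l' x0)) = kd l' ?l" if l': "l' < d" for l'
  proof -
    have "ls sg (\<lambda>s. co s (\<lambda>p q. an p (\<lambda>t. kd t ?l) * mu q l' x0))
      = ls sg (\<lambda>s. co s (\<lambda>p q. an p (\<lambda>a. mu q l' (\<lambda>y. kd a ?l * x0 y))))"
      by (simp add: ls_mult_left ls_mult_right)
    also have "\<dots> = ls sg (\<lambda>s. co s (\<lambda>p q. an p (\<lambda>a. mu l' a (\<lambda>y. kd y ?l * x0 q))))"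
      by (rule right_integral_shift[OF int l', symmetric])
    also have "\<dots> = un (\<lambda>a. mu l' a (\<lambda>y. kd y ?l))" by (simp add: ls_mult_right x0)
    finally show ?thesis using l' by (simp add: un_mu)
  qed
  have "to_free sg r n (\<lambda>j b. \<Sum>c<d. x0 c * \<Psi> $$ (j * d + c, b)) \<rho> $$ (R,b)
    = ls sg (\<lambda>s. co s (\<lambda>p q. an p (\<lambda>t. kd t ?l) * (\<Sum>l'<d. \<Psi> $$ (?j * d + l', b) * mu q l' x0)))"
    using * by (simp add: to_free_def sum)
  also have "\<dots> = (\<Sum>l'<d. \<Psi> $$ (?j * d + l', b) * ls sg (\<lambda>s. co s (\<lambda>p q. an p (\<lambda>t. kd t ?l) * mu q l' x0)))"
    by (simp add: sum_distrib_left co_sum ls_sum mult.left_commute[of _ "\<Psi> $$ _"] co_mult_left ls_mult_left)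
  also have "\<dots> = \<Psi> $$ (R,b)" using L by (simp add: unit sum_kd)
  finally show "to_free sg r n (\<lambda>j b. \<Sum>c<d. x0 c * \<Psi> $$ (j * d + c, b)) \<rho> $$ (R,b) = \<Psi> $$ (R,b)" .
qed (use mhom_dim[OF hom] in \<open>auto simp: to_free_def\<close>)

text \<open>The encoding vectors are the images of the free generators, the unit of each copy of
  A.\<close>

lemma mhom_from_free_eq:
  assumes V: "is_module H n \<rho>" and hom: "mhom (r * d) (free_mod H r) n \<rho> \<Phi>"
  shows "from_free r n (\<lambda>j c. un (\<lambda>t. \<Phi> $$ (c, j * d + t))) \<rho> = \<Phi>"
proof (rule eq_matI)
  fix a C assume "a < dim_row \<Phi>" "C < dim_col \<Phi>"
  then have *: "a < n" "C < r * d" using mhom_dim[OF hom] by auto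
  note L = divmod_less[OF *(2)]
  let ?l = "C mod d" and ?j = "C div d"
  have col: "(\<Sum>c<n. \<rho> ?l $$ (a,c) * \<Phi> $$ (c, ?j * d + t)) = mu ?l t (\<lambda>l. \<Phi> $$ (a, ?j * d + l))" if "t < d" for t
  proof -
    have lt: "?j * d + t < r * d" using L that by (intro block_less)
    show ?thesis
      using mhom_entry[OF hom rep_free is_module_rep[OF V] L(2) *(1) lt] free_col[OF lt, of "\<lambda>C. \<Phi> $$ (a,C)" ?l] that
      by simp
  qed
  have "from_free r n (\<lambda>j c. un (\<lambda>t. \<Phi> $$ (c, j * d + t))) \<rho> $$ (a,C)
     = un (\<lambda>t. \<Sum>c<n. \<rho> ?l $$ (a,c) * \<Phi> $$ (c, ?j * d + t))"
    using * by (simp add: from_free_def ls_sum ls_mult_left)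
  also have "\<dots> = \<Phi> $$ (a,C)" using L by (simp add: col un_mu)
  finally show "from_free r n (\<lambda>j c. un (\<lambda>t. \<Phi> $$ (c, j * d + t))) \<rho> $$ (a,C) = \<Phi> $$ (a,C)" .
qed (use mhom_dim[OF hom] in \<open>auto simp: from_free_def\<close>)

end

section \<open>Polynomial functions of bounded degree\<close>

text \<open>Products of exactly \<open>m\<close> members of \<open>C\<close>, so \<open>pol\<close>
  is the homogeneous part of degree \<open>m\<close>. This suffices because the entries of the maps
  used later have no constant term.\<close>

fun monomials :: "('x \<Rightarrow> 'a::field) set \<Rightarrow> nat \<Rightarrow> ('x \<Rightarrow> 'a) set" where
  "monomials C 0 = {\<lambda>_. 1}"
| "monomials C (Suc m) = (\<lambda>(g,h) x. g x * h x) ` (C \<times> monomials C m)"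

definition pol :: "('x \<Rightarrow> 'a::field) set \<Rightarrow> nat \<Rightarrow> ('x \<Rightarrow> 'a) set" where
  "pol C m = fun_space.span (monomials C m)"

lemma finite_monomials: "finite C \<Longrightarrow> finite (monomials C m)"
  by (induction m) auto

lemma pol_0: "(\<lambda>x. 0) \<in> pol C m"
  using fun_space.span_zero[of "monomials C m"] by (simp add: pol_def zero_fun_def)

lemma pol_add: "f \<in> pol C m \<Longrightarrow> g \<in> pol C m \<Longrightarrow> (\<lambda>x. f x + g x) \<in> pol C m"
  using fun_space.span_add[of f "monomials C m" g] by (simp add: pol_def plus_fun_def)

lemma pol_scale: "f \<in> pol C m \<Longrightarrow> (\<lambda>x. a * f x) \<in> pol C m"
  unfolding pol_def by (rule fun_space.span_scale)

lemma pol_scale_right: "f \<in> pol C m \<Longrightarrow> (\<lambda>x. f x * a) \<in> pol C m"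
  using pol_scale[of f C m a] by (simp add: mult.commute)

lemma pol_sum:
  assumes "\<And>s. s \<in> S \<Longrightarrow> (\<lambda>x. f s x) \<in> pol C m"
  shows "(\<lambda>x. \<Sum>s\<in>S. f s x) \<in> pol C m"
  using assms by (induction S rule: infinite_finite_induct) (auto intro: pol_0 pol_add)

lemma pol_coord: "f \<in> C \<Longrightarrow> f \<in> pol C 1"
proof -
  assume "f \<in> C"
  then have "(\<lambda>x. f x * 1) \<in> monomials C 1" by force
  then show ?thesis unfolding pol_def by (simp add: fun_space.span_base)
qed

lemma monomials_mult: "f \<in> monomials C m \<Longrightarrow> g \<in> monomials C k \<Longrightarrow> (\<lambda>x. f x * g x) \<in> monomials C (m + k)"
proof (induction m arbitrary: f)
  case (Suc m)
  then obtain c h where ch: "c \<in> C" "h \<in> monomials C m" "f = (\<lambda>x. c x * h x)" by auto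
  have "(\<lambda>x. h x * g x) \<in> monomials C (m + k)" using Suc.IH[OF ch(2) Suc.prems(2)] .
  then have "(\<lambda>x. c x * (h x * g x)) \<in> monomials C (Suc m + k)" using ch(1) by force
  then show ?case unfolding ch(3) by (simp add: mult.assoc)
qed auto

lemma pol_mult:
  assumes f: "f \<in> pol C m" and g: "g \<in> pol C k"
  shows "(\<lambda>x. f x * g x) \<in> pol C (m + k)"
proof -
  have 1: "(\<lambda>x. h x * g x) \<in> pol C (m + k)" if h: "h \<in> monomials C m" for h
    using g unfolding pol_def[of C k]
  proof (induction rule: fun_space.span_induct_alt)
    case base
    then show ?case by (simp add: pol_0 zero_fun_def)
  next
    case (step c u v)
    have "(\<lambda>x. c * (h x * u x) + h x * v x) \<in> pol C (m + k)"
      by (intro pol_add pol_scale step(2)) (simp add: pol_def fun_space.span_base monomials_mult[OF h step(1)])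
    then show ?case by (simp add: algebra_simps)
  qed
  show ?thesis
    using f unfolding pol_def[of C m]
  proof (induction rule: fun_space.span_induct_alt)
    case base
    then show ?case by (simp add: pol_0 zero_fun_def)
  next
    case (step c u v)
    have "(\<lambda>x. c * (u x * g x) + v x * g x) \<in> pol C (m + k)"
      by (intro pol_add pol_scale step(2) 1 step(1))
    then show ?case by (simp add: algebra_simps)
  qed
qed

lemma pol_prod:
  assumes "finite S" "\<And>s. s \<in> S \<Longrightarrow> (\<lambda>x. f s x) \<in> pol C m"
  shows "(\<lambda>x. \<Prod>s\<in>S. f s x) \<in> pol C (card S * m)"
  using assms
proof (induction S rule: finite_induct)
  case empty
  then show ?case by (simp add: pol_def fun_space.span_base)
next
  case (insert s S)
  then have "(\<lambda>x. f s x * (\<Prod>s\<in>S. f s x)) \<in> pol C (m + card S * m)" by (intro pol_mult) auto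
  then show ?case using insert by simp
qed

lemma pol_det:
  assumes A: "\<And>x. A x \<in> carrier_mat k k" and e: "\<And>i j. i < k \<Longrightarrow> j < k \<Longrightarrow> (\<lambda>x. A x $$ (i,j)) \<in> pol C m"
  shows "(\<lambda>x. det (A x)) \<in> pol C (k * m)"
proof -
  have "(\<lambda>x. \<Sum>p | p permutes {0..<k}. signof p * (\<Prod>i = 0..<k. A x $$ (i, p i))) \<in> pol C (card {0..<k} * m)"
  proof (intro pol_sum pol_scale pol_prod)
    fix p i assume "p \<in> {p. p permutes {0..<k}}" "i \<in> {0..<k}"
    then have "i < k" "p i < k" using permutes_in_image[of p "{0..<k}" i] by auto
    then show "(\<lambda>x. A x $$ (i, p i)) \<in> pol C m" by (rule e)
  qed simp
  then show ?thesis by (simp add: det_def'[OF A])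
qed

text \<open>If $f_M(N) = 0$ for all distinct $M, N$ in a set, then evaluation at the members shows that its $f_M$ are
  linearly independent; a set of this kind of maximal size is the required $F$.\<close>

lemma finitely_many_classes:
  fixes f :: "'x \<Rightarrow> 'x \<Rightarrow> 'a::field"
  assumes B: "finite B" "\<And>M. M \<in> E \<Longrightarrow> f M \<in> fun_space.span B"
    and diag: "\<And>M. M \<in> E \<Longrightarrow> f M M \<noteq> 0"
  shows "\<exists>F\<subseteq>E. finite F \<and> (\<forall>M\<in>E. \<exists>N\<in>F. f M N \<noteq> 0 \<or> f N M \<noteq> 0)"
proof -
  let ?P = "\<lambda>F. F \<subseteq> E \<and> finite F \<and> (\<forall>M\<in>F. \<forall>N\<in>F. M \<noteq> N \<longrightarrow> f M N = 0)"
  have bound: "card F < Suc (card B)" if F: "?P F" for F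
  proof -
    \<comment> \<open>Equal functions at distinct members would vanish and not vanish at the same
      point.\<close>
    have inj: "inj_on f F" using F diag by (metis inj_onI subsetD)
    have "fun_space.independent (f ` F)"
    proof
      assume "fun_space.dependent (f ` F)"
      then obtain u v where u: "v \<in> f ` F" "u v \<noteq> 0" "(\<Sum>v\<in>f ` F. (\<lambda>x. u v * v x)) = 0"
        using F fun_space.dependent_finite[of "f ` F"] by auto
      then obtain N where N: "N \<in> F" "v = f N" by blast
      \<comment> \<open>Evaluation of the relation at \<open>N\<close> removes every term except
        that of \<open>f N\<close>.\<close>
      have "0 = (\<Sum>v\<in>f ` F. u v * v N)" using fun_cong[OF u(3), of N] by (simp add: sum_fun_apply)
      also have "\<dots> = (\<Sum>M\<in>F. u (f M) * f M N)" by (simp add: sum.reindex[OF inj])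
      also have "\<dots> = u (f N) * f N N"
        using F N by (subst sum.remove[of F N]) (auto intro!: sum.neutral)
      finally show False using u(2) N diag F by auto
    qed
    then have "card (f ` F) \<le> card B"
      using fun_space.independent_span_bound[OF B(1), of "f ` F"] B(2) F by blast
    then show ?thesis using card_image[OF inj] by simp
  qed
  have "?P {}" by simp
  moreover have "\<forall>F. ?P F \<longrightarrow> card F < Suc (card B)" using bound by blast
  ultimately have "\<exists>F. ?P F \<and> (\<forall>G. ?P G \<longrightarrow> card G \<le> card F)"
    by (rule ex_has_greatest_nat)
  then obtain F where "?P F \<and> (\<forall>G. ?P G \<longrightarrow> card G \<le> card F)" by (rule exE)
  then have F: "?P F" and max: "\<forall>G. ?P G \<longrightarrow> card G \<le> card F"
    by (rule conjunct1, rule conjunct2)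
  have "\<exists>N\<in>F. f M N \<noteq> 0 \<or> f N M \<noteq> 0" if M: "M \<in> E" for M
  proof (rule ccontr)
    assume no: "\<not> ?thesis"
    then have "M \<notin> F" using diag M by blast
    moreover have "?P (insert M F)" using F M no by auto
    ultimately show False using max[rule_format, of "insert M F"] F by simp
  qed
  then show ?thesis using F by blast
qed

section \<open>Detecting and cancelling free summands; finiteness\<close>

context local_hopf_alg
begin

text \<open>A nonzero determinant makes the composite an automorphism of A^r, so A^r splits off. The
  complement has dimension 1 by the count and is therefore the trivial module.\<close>

lemma split_free_of_det:
  assumes int: "\<And>h f. h < d \<Longrightarrow> ls sg (\<lambda>s. mu s h f) = e h * ls sg f"
    and V: "is_module H n \<rho>" and nz: "det (to_free sg r n X \<rho> * from_free r n Y \<rho>) \<noteq> 0" and n: "n = 1 + r * d"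
  shows "iso n \<rho> (1 + r * d) (dsum_mod 1 (triv_mod H) (r * d) (free_mod H r))"
proof -
  let ?A = "to_free sg r n X \<rho>" and ?B = "from_free r n Y \<rho>"
  note R = is_module_rep[OF V] rep_free
  note A = to_free_mhom[OF int V, of r X] and B = from_free_mhom[OF V, of r Y]
  note AB = mhom_mult[OF R(2,1,2) B A]
  have ABc: "?A * ?B \<in> carrier_mat (r * d) (r * d)" by (rule mhom_carrier[OF AB])
  obtain G where G: "G \<in> carrier_mat (r * d) (r * d)" "?A * ?B * G = 1\<^sub>m (r * d)"
    using det_non_zero_imp_unit[OF ABc nz, of "()"] unfolding Units_def by (auto simp: ring_mat_simps)
  then have GAB: "G * (?A * ?B) = 1\<^sub>m (r * d)" using mat_mult_left_right_inverse[OF ABc] by blast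
  have Gh: "mhom (r * d) (free_mod H r) (r * d) (free_mod H r) G"
    by (rule mhom_inverse[OF AB G(1) G(2) GAB R(2,2)])
  have BG: "mhom (r * d) (free_mod H r) n \<rho> (?B * G)" by (rule mhom_mult[OF R(2,2,1) Gh B])
  have one: "?A * (?B * G) = 1\<^sub>m (r * d)"
    using G mhom_dim[OF A] mhom_dim[OF B] by (simp add: mat_assoc)
  obtain q \<tau> where s: "is_module H q \<tau>" "iso n \<rho> (r * d + q) (dsum_mod (r * d) (free_mod H r) q \<tau>)" "n = r * d + q"
    by (rule split_iso[OF V R(2) BG A one])
  then have q: "q = 1" using n by simp
  note T = is_module_rep[OF is_module_triv] is_module_rep[OF s(1)]
  have 1: "iso (r * d + q) (dsum_mod (r * d) (free_mod H r) q \<tau>) (q + r * d) (dsum_mod q \<tau> (r * d) (free_mod H r))"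
    by (rule dsum_comm[OF R(2) T(2)])
  have 2: "iso (q + r * d) (dsum_mod q \<tau> (r * d) (free_mod H r)) (1 + r * d) (dsum_mod 1 (triv_mod H) (r * d) (free_mod H r))"
    using s(1) T(2) one_dim_module_trivial unfolding q by (intro dsum_iso_cong iso_refl R T(1)) auto
  show ?thesis by (rule iso_trans[OF iso_trans[OF s(2) 1] 2]) (intro R T dsum_rep)+
qed

text \<open>The rank is written as \<open>(n * n - 1) div d\<close>, a function of \<open>n\<close>
  alone, so that one polynomial space serves all modules. It comes from comparing dimensions once
  the projective summand is known to be free.\<close>

lemma endotrivial_free:
  assumes "endotrivial H n \<rho>"
  shows "iso (n * n) (tensor_mod H n (dual_mod H n \<rho>) n \<rho>) (1 + (n * n - 1) div d * d)
      (dsum_mod 1 (triv_mod H) ((n * n - 1) div d * d) (free_mod H ((n * n - 1) div d)))"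
    "n * n = 1 + (n * n - 1) div d * d"
proof -
  obtain m P where P: "projective_mod H m P"
    and iso: "iso (n * n) (tensor_mod H n (dual_mod H n \<rho>) n \<rho>) (1 + m) (dsum_mod 1 (triv_mod H) m P)"
    using assms unfolding endotrivial_def by blast
  obtain r m' \<tau> where r: "is_module H m P" "is_module H m' \<tau>"
    "iso (m + m') (dsum_mod m P m' \<tau>) (r * d) (free_mod H r)"
    using P unfolding projective_mod_def by blast
  obtain s where s: "iso m P (s * d) (free_mod H s)" using projective_free[OF r] by blast
  then have m: "m = s * d" by (simp add: iso_mod_def)
  have nn: "n * n = 1 + s * d" using iso m by (simp add: iso_mod_def)
  then have sd: "(n * n - 1) div d = s" using d_pos by simp
  note T = is_module_rep[OF is_module_triv] is_module_rep[OF r(1)] rep_free rep_tensor dsum_rep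
  have "iso (1 + m) (dsum_mod 1 (triv_mod H) m P) (1 + s * d) (dsum_mod 1 (triv_mod H) (s * d) (free_mod H s))"
    by (intro dsum_iso_cong s iso_refl T)
  then have "iso (n * n) (tensor_mod H n (dual_mod H n \<rho>) n \<rho>) (1 + s * d) (dsum_mod 1 (triv_mod H) (s * d) (free_mod H s))"
    by (rule iso_trans[OF iso]) (intro T)+
  then show "iso (n * n) (tensor_mod H n (dual_mod H n \<rho>) n \<rho>) (1 + (n * n - 1) div d * d)
      (dsum_mod 1 (triv_mod H) ((n * n - 1) div d * d) (free_mod H ((n * n - 1) div d)))"
    "n * n = 1 + (n * n - 1) div d * d"
    unfolding sd using nn by auto
qed

text \<open>One copy of the regular module is cancelled at a time, which only needs locality of its
  own endomorphism ring.\<close>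

lemma free_cancel:
  assumes r: "rep n \<sigma>" "rep m \<tau>"
    and iso: "iso (n + k * d) (dsum_mod n \<sigma> (k * d) (free_mod H k)) (m + k * d) (dsum_mod m \<tau> (k * d) (free_mod H k))"
  shows "iso n \<sigma> m \<tau>"
  using iso
proof (induction k)
  case 0
  have "dsum_mod l \<upsilon> (0 * d) (free_mod H 0) i = \<upsilon> i" if "rep l \<upsilon>" "i < d" for l \<upsilon> i
    by (rule eq_matI) (use repD[OF that] in \<open>auto simp: dsum_mod_def free_mod_def\<close>)
  then show ?case using iso_cong[OF 0] r by simp
next
  case (Suc k)
  have eq: "dsum_mod l \<upsilon> (Suc k * d) (free_mod H (Suc k)) i
      = dsum_mod (l + k * d) (dsum_mod l \<upsilon> (k * d) (free_mod H k)) d reg i" if "rep l \<upsilon>" "i < d" for l \<upsilon> i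
  proof -
    have "dsum_mod l \<upsilon> (Suc k * d) (free_mod H (Suc k)) i
      = dsum_mod l \<upsilon> (k * d + d) (dsum_mod (k * d) (free_mod H k) d reg) i"
      using that by (simp add: dsum_mod_def[of l] free_mod_Suc add.commute)
    then show ?thesis using that by (simp add: dsum_assoc rep_free rep_reg)
  qed
  have "iso (n + k * d + d) (dsum_mod (n + k * d) (dsum_mod n \<sigma> (k * d) (free_mod H k)) d reg)
     (m + k * d + d) (dsum_mod (m + k * d) (dsum_mod m \<tau> (k * d) (free_mod H k)) d reg)"
    using iso_cong[OF Suc.prems eq[OF r(1)] eq[OF r(2)]] by (simp add: ac_simps)
  then show ?case
    by (rule Suc.IH[OF dsum_cancel[OF local_end_reg dsum_rep[OF r(1) rep_free] dsum_rep[OF r(2) rep_free]]])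
qed

text \<open>Distribute over the sum: k (x) V gives V, and A^r (x) V is free of rank
  \<open>n * r\<close> whatever the action on V.\<close>

lemma tensor_triv_free:
  assumes cc: "cocommutative H" and V: "is_module H n \<rho>"
  shows "iso ((1 + r * d) * n) (tensor_mod H (1 + r * d) (dsum_mod 1 (triv_mod H) (r * d) (free_mod H r)) n \<rho>)
     (n + n * r * d) (dsum_mod n \<rho> (n * r * d) (free_mod H (n * r)))"
proof -
  note R = is_module_rep[OF V] is_module_rep[OF is_module_triv] rep_free rep_tensor dsum_rep
  have 1: "iso ((1 + r * d) * n) (tensor_mod H (1 + r * d) (dsum_mod 1 (triv_mod H) (r * d) (free_mod H r)) n \<rho>)
     (1 * n + r * d * n) (dsum_mod (1 * n) (tensor_mod H 1 (triv_mod H) n \<rho>) (r * d * n) (tensor_mod H (r * d) (free_mod H r) n \<rho>))"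
    by (rule iso_eqI[OF rep_tensor]) (simp_all only: tensor_dsum_left[OF R(2,3)] distrib_right)
  have "iso (1 * n) (tensor_mod H 1 (triv_mod H) n \<rho>) n \<rho>"
    by (rule iso_eqI[OF rep_tensor]) (simp_all add: tensor_triv_left[OF R(1), simplified])
  then have 2: "iso (1 * n + r * d * n) (dsum_mod (1 * n) (tensor_mod H 1 (triv_mod H) n \<rho>) (r * d * n) (tensor_mod H (r * d) (free_mod H r) n \<rho>))
     (n + n * r * d) (dsum_mod n \<rho> (n * r * d) (free_mod H (n * r)))"
    by (intro dsum_iso_cong tensor_free_left[OF cc V] R)
  show ?thesis by (rule iso_trans[OF 1 2]) (intro R)+
qed

text \<open>Both sides are read off from $\delta \otimes \sigma \otimes \rho \cong \delta \otimes \rho \otimes \sigma$ by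
  cancelling free summands.\<close>

lemma endotrivial_iso:
  assumes cc: "cocommutative H" and V: "is_module H n \<rho>" and W: "is_module H n \<sigma>"
    and D\<rho>: "iso (n * n) (tensor_mod H n \<delta> n \<rho>) (1 + r * d) (dsum_mod 1 (triv_mod H) (r * d) (free_mod H r))"
    and D\<sigma>: "iso (n * n) (tensor_mod H n \<delta> n \<sigma>) (1 + r * d) (dsum_mod 1 (triv_mod H) (r * d) (free_mod H r))"
  shows "iso n \<rho> n \<sigma>"
proof (rule free_cancel[of _ _ _ _ "n * r"])
  note R = is_module_rep[OF V] is_module_rep[OF W] is_module_rep[OF is_module_triv] rep_free rep_tensor dsum_rep
  let ?U = "dsum_mod 1 (triv_mod H) (r * d) (free_mod H r)"
  have 1: "iso (n * n * n) (tensor_mod H (n * n) (tensor_mod H n \<delta> n \<sigma>) n \<rho>) (n + n * r * d) (dsum_mod n \<rho> (n * r * d) (free_mod H (n * r)))"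
    by (rule iso_trans[OF tensor_iso_cong_left[OF D\<sigma>] tensor_triv_free[OF cc V]]) (intro R)+
  have 2: "iso (n * n * n) (tensor_mod H (n * n) (tensor_mod H n \<delta> n \<rho>) n \<sigma>) (n + n * r * d) (dsum_mod n \<sigma> (n * r * d) (free_mod H (n * r)))"
    by (rule iso_trans[OF tensor_iso_cong_left[OF D\<rho>] tensor_triv_free[OF cc W]]) (intro R)+
  \<comment> \<open>The outer factor \<open>\<rho>\<close> is moved to the front, rebracketed next
    to \<open>\<delta>\<close> and exchanged with it, which leaves \<open>\<sigma>\<close>
    outside.\<close>
  have 3: "iso (n * n * n) (tensor_mod H (n * n) (tensor_mod H n \<delta> n \<sigma>) n \<rho>)
     (n * (n * n)) (tensor_mod H n \<rho> (n * n) (tensor_mod H n \<delta> n \<sigma>))"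
    by (rule tensor_swap[OF cc])
  have 4: "iso (n * (n * n)) (tensor_mod H n \<rho> (n * n) (tensor_mod H n \<delta> n \<sigma>))
     (n * n * n) (tensor_mod H (n * n) (tensor_mod H n \<rho> n \<delta>) n \<sigma>)"
    by (rule iso_eqI[OF rep_tensor]) (simp_all add: tensor_assoc mult.assoc)
  have 5: "iso (n * n * n) (tensor_mod H (n * n) (tensor_mod H n \<rho> n \<delta>) n \<sigma>)
     (n * n * n) (tensor_mod H (n * n) (tensor_mod H n \<delta> n \<rho>) n \<sigma>)"
    by (intro tensor_iso_cong_left tensor_swap cc R)
  have 6: "iso (n + n * r * d) (dsum_mod n \<rho> (n * r * d) (free_mod H (n * r)))
     (n * n * n) (tensor_mod H (n * n) (tensor_mod H n \<delta> n \<sigma>) n \<rho>)"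
    by (rule iso_sym[OF 1]) (intro R)+
  show "iso (n + n * r * d) (dsum_mod n \<rho> (n * r * d) (free_mod H (n * r))) (n + n * r * d) (dsum_mod n \<sigma> (n * r * d) (free_mod H (n * r)))"
    by (rule iso_trans[OF iso_trans[OF iso_trans[OF iso_trans[OF 6 3] 4] 5] 2]) (intro R)+
qed (intro is_module_rep V W)+

definition coords :: "nat \<Rightarrow> ((nat \<Rightarrow> 'k mat) \<Rightarrow> 'k) set" where
  "coords n = (\<lambda>(i,a,b) \<sigma>. \<sigma> i $$ (a,b)) ` ({..<d} \<times> {..<n} \<times> {..<n})"

text \<open>With \<open>\<delta>\<close> fixed, the tensor product is linear in
  \<open>\<sigma>\<close>, and so are both maps. Each entry of the composite is thus quadratic,
  which is the factor 2; the matrix has size \<open>r * d\<close>.\<close>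

lemma detector_pol:
  "(\<lambda>\<sigma>. det (to_free sg r (n * n) X (tensor_mod H n \<delta> n \<sigma>) * from_free r (n * n) Y (tensor_mod H n \<delta> n \<sigma>)))
    \<in> pol (coords n) (r * d * 2)"
proof (rule pol_det)
  let ?T = "\<lambda>\<sigma>. tensor_mod H n \<delta> n \<sigma>"
  have T: "(\<lambda>\<sigma>. ?T \<sigma> q $$ (a,b)) \<in> pol (coords n) 1" if q: "q < d" and ab: "a < n * n" "b < n * n" for q a b
  proof -
    have "(\<lambda>\<sigma>. \<sigma> l $$ (a mod n, b mod n)) \<in> pol (coords n) 1" if "l < d" for l
      using that divmod_less[OF ab(1)] divmod_less[OF ab(2)] by (intro pol_coord) (force simp: coords_def)
    then show ?thesis
      unfolding tensor_index[OF ab] co_def by (intro pol_sum pol_scale) auto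
  qed
  fix i j assume ij: "i < r * d" "j < r * d"
  have 1: "(\<lambda>\<sigma>. to_free sg r (n * n) X (?T \<sigma>) $$ (i,k)) \<in> pol (coords n) 1" if k: "k < n * n" for k
  proof -
    have "(\<lambda>\<sigma>. ls sg (\<lambda>s. co s (\<lambda>p q.
     an p (\<lambda>t. kd t (i mod d)) * (\<Sum>c<n*n. X (i div d) c * ?T \<sigma> q $$ (c,k))))) \<in> pol (coords n) 1"
      unfolding ls_def[of sg] co_def using k by (intro pol_sum pol_scale T) auto
    then show ?thesis using ij k by (simp add: to_free_def)
  qed
  have 2: "(\<lambda>\<sigma>. from_free r (n * n) Y (?T \<sigma>) $$ (k,j)) \<in> pol (coords n) 1" if k: "k < n * n" for k
  proof -
    have "(\<lambda>\<sigma>. \<Sum>c<n*n. ?T \<sigma> (j mod d) $$ (k,c) * Y (j div d) c) \<in> pol (coords n) 1"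
      using k divmod_less[OF ij(2)] by (intro pol_sum pol_scale_right T) auto
    then show ?thesis using ij k by (simp add: from_free_def)
  qed
  have "(\<lambda>\<sigma>. \<Sum>k<n*n. to_free sg r (n * n) X (?T \<sigma>) $$ (i,k) * from_free r (n * n) Y (?T \<sigma>) $$ (k,j)) \<in> pol (coords n) (1 + 1)"
    by (intro pol_sum pol_mult 1 2) auto
  then show "(\<lambda>\<sigma>. (to_free sg r (n * n) X (?T \<sigma>) * from_free r (n * n) Y (?T \<sigma>)) $$ (i,j)) \<in> pol (coords n) 2"
    by (simp only: index_mult_mat_carrier[OF to_free_carrier from_free_carrier ij] one_add_one)
qed (intro mult_carrier_mat[OF to_free_carrier from_free_carrier])

text \<open>Projection to and inclusion of the free summand compose to the identity, and both can be
  encoded by functionals and vectors.\<close>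

lemma detector_exists:
  assumes int: "\<And>h f. h < d \<Longrightarrow> ls sg (\<lambda>s. mu s h f) = e h * ls sg f"
    and x0: "\<And>f. ls sg (\<lambda>s. co s (\<lambda>p q. an p f * x0 q)) = un f"
    and V: "is_module H n \<rho>"
    and iso: "iso n \<rho> (1 + r * d) (dsum_mod 1 (triv_mod H) (r * d) (free_mod H r))"
  shows "\<exists>X Y. to_free sg r n X \<rho> * from_free r n Y \<rho> = 1\<^sub>m (r * d)"
proof -
  note R = is_module_rep[OF V] is_module_rep[OF is_module_triv] rep_free dsum_rep
  note bh = biprod_mhom[OF R(2) rep_free[of r]] and bp = biprod_inj_prj[of 1 "r * d"]
  obtain P Q where P: "mhom n \<rho> (1 + r * d) (dsum_mod 1 (triv_mod H) (r * d) (free_mod H r)) P"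
    and Q: "mhom (1 + r * d) (dsum_mod 1 (triv_mod H) (r * d) (free_mod H r)) n \<rho> Q"
    and PQ: "P * Q = 1\<^sub>m (1 + r * d)"
    by (rule isoE[OF iso]) (intro R)+
  have \<Psi>: "mhom n \<rho> (r * d) (free_mod H r) (prj2 1 (r * d) * P)"
    by (rule mhom_mult[OF _ _ _ P bh(4)]) (intro R)+
  have \<Phi>: "mhom (r * d) (free_mod H r) n \<rho> (Q * inj2 1 (r * d))"
    by (rule mhom_mult[OF _ _ _ bh(2) Q]) (intro R)+
  let ?\<Psi> = "prj2 1 (r * d) * P" and ?\<Phi> = "Q * inj2 1 (r * d)"
  have "?\<Psi> * ?\<Phi> = prj2 1 (r * d) * (P * Q * inj2 1 (r * d))"
    using mhom_dim[OF P] mhom_dim[OF Q] by (simp add: mat_assoc)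
  then have "?\<Psi> * ?\<Phi> = 1\<^sub>m (r * d)" using bp(2) by (simp add: PQ)
  then have "to_free sg r n (\<lambda>j b. \<Sum>c<d. x0 c * ?\<Psi> $$ (j * d + c, b)) \<rho>
      * from_free r n (\<lambda>j c. un (\<lambda>t. ?\<Phi> $$ (c, j * d + t))) \<rho> = 1\<^sub>m (r * d)"
    by (simp only: mhom_to_free_eq[OF int x0 V \<Psi>] mhom_from_free_eq[OF V \<Phi>])
  then show ?thesis by (intro exI)
qed

lemma finitely_many_endotrivial:
  assumes cc: "cocommutative H"
  shows "\<exists>F. finite F \<and> (\<forall>\<rho>. endotrivial H n \<rho> \<longrightarrow> (\<exists>\<sigma>\<in>F. iso_mod H n \<rho> n \<sigma>))"
proof -
  obtain sg x0 where int: "\<And>h f. h < d \<Longrightarrow> ls sg (\<lambda>s. mu s h f) = e h * ls sg f"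
    and x0: "\<And>f. ls sg (\<lambda>s. co s (\<lambda>p q. an p f * x0 q)) = un f"
    using integral_functional_exists by blast
  define r where "r = (n * n - 1) div d"
  let ?E = "{\<rho>. endotrivial H n \<rho>}"
  let ?W = "\<lambda>\<rho> \<sigma>. tensor_mod H n (dual_mod H n \<rho>) n \<sigma>"
  have mod: "is_module H n \<rho>" if "\<rho> \<in> ?E" for \<rho> using that by (simp add: endotrivial_def)
  have W: "is_module H (n * n) (?W \<rho> \<sigma>)" if "\<rho> \<in> ?E" "\<sigma> \<in> ?E" for \<rho> \<sigma>
    using that by (intro is_module_tensor is_module_dual mod)
  have diag: "iso (n * n) (?W \<rho> \<rho>) (1 + r * d) (dsum_mod 1 (triv_mod H) (r * d) (free_mod H r))" if "\<rho> \<in> ?E" for \<rho>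
    using endotrivial_free(1)[of n \<rho>] that by (simp add: r_def)
  let ?D = "\<lambda>\<rho> XY. to_free sg r (n * n) (fst XY) (?W \<rho> \<rho>) * from_free r (n * n) (snd XY) (?W \<rho> \<rho>) = 1\<^sub>m (r * d)"
  have "\<exists>XY. ?D \<rho> XY" if \<rho>: "\<rho> \<in> ?E" for \<rho>
    using detector_exists[OF int x0 W[OF \<rho> \<rho>] diag[OF \<rho>]] by simp
  then have "\<exists>XY. \<forall>\<rho>\<in>?E. ?D \<rho> (XY \<rho>)" by (intro bchoice ballI)
  then obtain XY where "\<forall>\<rho>\<in>?E. ?D \<rho> (XY \<rho>)" by (rule exE)
  then have XY: "?D \<rho> (XY \<rho>)" if "\<rho> \<in> ?E" for \<rho> using that by (rule bspec)
  \<comment> \<open>The encoding is chosen once for each \<open>\<rho>\<close>, from its own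
    splitting, and then evaluated at every \<open>\<sigma>\<close>.\<close>
  define f where "f \<rho> \<sigma> = det (to_free sg r (n * n) (fst (XY \<rho>)) (?W \<rho> \<sigma>) * from_free r (n * n) (snd (XY \<rho>)) (?W \<rho> \<sigma>))" for \<rho> \<sigma>
  have iso: "iso n \<rho> n \<sigma>" if "\<rho> \<in> ?E" "\<sigma> \<in> ?E" "f \<rho> \<sigma> \<noteq> 0" for \<rho> \<sigma>
  proof -
    have "n * n = 1 + r * d" using endotrivial_free(2)[of n \<rho>] that(1) by (simp add: r_def)
    then have W\<sigma>: "iso (n * n) (?W \<rho> \<sigma>) (1 + r * d) (dsum_mod 1 (triv_mod H) (r * d) (free_mod H r))"
      using split_free_of_det[OF int W[OF that(1,2)]] that(3) unfolding f_def by blast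
    show ?thesis
      by (rule endotrivial_iso[OF cc mod[OF that(1)] mod[OF that(2)] diag[OF that(1)] W\<sigma>])
  qed
  have "\<exists>F\<subseteq>?E. finite F \<and> (\<forall>M\<in>?E. \<exists>N\<in>F. f M N \<noteq> 0 \<or> f N M \<noteq> 0)"
  proof (rule finitely_many_classes)
    show "finite (monomials (coords n) (r * d * 2))"
      by (rule finite_monomials) (simp add: coords_def)
    show "f \<rho> \<in> fun_space.span (monomials (coords n) (r * d * 2))" for \<rho>
      using detector_pol unfolding f_def[abs_def] pol_def by blast
    show "f \<rho> \<rho> \<noteq> 0" if "\<rho> \<in> ?E" for \<rho> by (simp add: f_def XY[OF that])
  qed
  then obtain F where F: "F \<subseteq> ?E" "finite F" "\<forall>M\<in>?E. \<exists>N\<in>F. f M N \<noteq> 0 \<or> f N M \<noteq> 0"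
    by (elim exE conjE)
  have "\<exists>\<sigma>\<in>F. iso n \<rho> n \<sigma>" if \<rho>: "\<rho> \<in> ?E" for \<rho>
  proof -
    obtain \<sigma> where \<sigma>: "\<sigma> \<in> F" "f \<rho> \<sigma> \<noteq> 0 \<or> f \<sigma> \<rho> \<noteq> 0" using bspec[OF F(3) \<rho>] by blast
    then have \<sigma>E: "\<sigma> \<in> ?E" using F(1) by blast
    \<comment> \<open>\<open>f\<close> need not be symmetric, but nonvanishing in either order gives
      an isomorphism, which can be reversed.\<close>
    have "iso n \<rho> n \<sigma>"
      using \<sigma>(2) iso[OF \<rho> \<sigma>E] iso_sym[OF iso[OF \<sigma>E \<rho>] is_module_rep[OF mod[OF \<sigma>E]] is_module_rep[OF mod[OF \<rho>]]]
      by blast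
    then show ?thesis using \<sigma>(1) by blast
  qed
  then show ?thesis using F(2) by blast
qed

end

theorem theorem3p5:
  fixes H :: "'k::field hopf" and n :: nat
  assumes "alg_closed_field TYPE('k)"
    and "CHAR('k) > 0"
    and "hopf_algebra H" and "cocommutative H"
    and "local_alg H"
    and "n > 0"
  shows "\<exists>F. finite F \<and> (\<forall>\<rho>. endotrivial H n \<rho> \<longrightarrow> (\<exists>\<sigma>\<in>F. iso_mod H n \<rho> n \<sigma>))"
proof -
  interpret local_hopf_alg H by unfold_locales (rule assms)+
  show ?thesis by (rule finitely_many_endotrivial) (rule assms)
qed

end
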